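(* Let $\Omega\subset\mathbb{R}^n$ be a bounded Lipschitz domain. Let $\mathcal{O}_0,\mathcal{O}_1,\dots,\mathcal{O}_J$ be the connected components of the complement of $\Omega$, where $\mathcal{O}_0$ is the unbounded one, pick points $y_j\in\mathcal{O}_j$ and set $g_j(x):=\frac{x-y_j}{|x-y_j|^n}$ for $j=1,\dots,J$. Then there is a linear operator $\mathscr{E}'\colon\mathrm{L}^1_{\operatorname{div}}(\Omega;\mathbb{R}^n)\to\mathrm{L}^1_{\operatorname{div}}(\mathbb{R}^n;\mathbb{R}^n)$ such that for every $u\in\mathrm{L}^1_{\operatorname{div}}(\Omega;\mathbb{R}^n)$ there are real numbers $\lambda_1,\dots,\lambda_J$ (depending on $u$) with $\mathscr{E}'u=u+\sum_{j=1}^J\lambda_jg_j$ on $\Omega$.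
   Context: For an open set $U$, $\mathrm{L}^1_{\operatorname{div}}(U;\mathbb{R}^n)=\{u\in\mathrm{L}^1(U;\mathbb{R}^n)\colon\operatorname{div}u=0\text{ in }\mathscr{D}'(U)\}$. A Lipschitz domain is an open connected set with Lipschitz boundary. *)

theory Defs
  imports "HOL-Analysis.Analysis"
begin

fun iter_pd :: "'a::euclidean_space list \<Rightarrow> ('a \<Rightarrow> real) \<Rightarrow> ('a \<Rightarrow> real)" where
  "iter_pd [] f = f"
| "iter_pd (v # vs) f = (\<lambda>x. frechet_derivative (iter_pd vs f) (at x) v)"

definition smooth :: "('a::euclidean_space \<Rightarrow> real) \<Rightarrow> bool" where
  "smooth f \<longleftrightarrow> (\<forall>vs. set vs \<subseteq> Basis \<longrightarrow> (\<forall>x. iter_pd vs f differentiable at x))"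

definition test_fun :: "'a::euclidean_space set \<Rightarrow> ('a \<Rightarrow> real) \<Rightarrow> bool" where
  "test_fun U \<phi> \<longleftrightarrow> smooth \<phi> \<and> compact (closure {x. \<phi> x \<noteq> 0}) \<and> closure {x. \<phi> x \<noteq> 0} \<subseteq> U"

definition grad :: "('a::euclidean_space \<Rightarrow> real) \<Rightarrow> 'a \<Rightarrow> 'a" where
  "grad \<phi> x = (\<Sum>i\<in>Basis. frechet_derivative \<phi> (at x) i *\<^sub>R i)"

definition L1div :: "'a::euclidean_space set \<Rightarrow> ('a \<Rightarrow> 'a) set" where
  "L1div U = {u. set_integrable lebesgue U u \<and>
      (\<forall>\<phi>. test_fun U \<phi> \<longrightarrow> (LINT x:U|lebesgue. u x \<bullet> grad \<phi> x) = 0)}"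

text \<open>Lipschitz boundary: near every boundary point the set is, in suitable rotated
  coordinates (direction e = last axis), the region strictly above the graph of a
  Lipschitz function defined on the hyperplane orthogonal to e.\<close>
definition lipschitz_boundary :: "'a::euclidean_space set \<Rightarrow> bool" where
  "lipschitz_boundary \<Omega> \<longleftrightarrow>
    (\<forall>p\<in>frontier \<Omega>. \<exists>e r L \<gamma>. norm e = 1 \<and> r > 0 \<and>
        L-lipschitz_on {z. z \<bullet> e = 0} (\<gamma> :: 'a \<Rightarrow> real) \<and>
        \<Omega> \<inter> ball p r = {x \<in> ball p r. x \<bullet> e > \<gamma> (x - (x \<bullet> e) *\<^sub>R e)})"

definition lipschitz_domain :: "'a::euclidean_space set \<Rightarrow> bool" where
  "lipschitz_domain \<Omega> \<longleftrightarrow> open \<Omega> \<and> connected \<Omega> \<and> lipschitz_boundary \<Omega>"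

end

theory Submission
  imports Defs "HOL-Library.Function_Algebras"
begin

text \<open>
  No bound on the operator is claimed, so by linear selection along a Hamel basis it suffices to
  extend each single field \<open>u\<close>.

  In a graph chart with transversal direction \<open>e\<close>, push the test function from the outside into the
  domain: on the layer at height \<open>2^-k\<close> replace \<open>\<phi>(x)\<close> by \<open>\<phi>(x - s e)\<close> with \<open>s\<close> of the same
  order, gluing the layers by smooth cutoffs. What is left of \<open>\<phi>\<close> may be used as a test function for
  \<open>u\<close>, and after integration along the segments the layers express \<open>\<integral> u \<bullet> \<nabla>\<phi>\<close> as
  \<open>\<integral> w \<bullet> \<nabla>\<phi> + \<integral> f \<phi>\<close> with integrable \<open>w\<close>, \<open>f\<close> vanishing on the domain, since all pushes are
  translations. A smooth partition makes this global.

  The remaining density \<open>f\<close> is a divergence in the complement if and only if its integral over every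
  component vanishes: mass can be moved downwards along \<open>-e\<close>, spread radially in balls, and hence
  transported inside a connected component. The integrals of \<open>f\<close> are the fluxes of \<open>u\<close> through the
  bounded components, and they are cancelled by adding multiples of the fields \<open>g\<^sub>j\<close>, whose
  divergence is a multiple of the point mass at \<open>y\<^sub>j\<close>.
\<close>

section \<open>Smooth functions and test functions\<close>

text \<open>An integrable \<open>u\<close> has no boundary trace, so nothing can be evaluated on the
  boundary. A cutoff at height \<open>\<sigma>\<close> costs a gradient of size
  \<open>1 / \<sigma>\<close>, which alone is not summable over the layers. Here it only ever
  multiplies the difference of two consecutive pushes of \<open>\<phi>\<close>; these lie a distance
  \<open>\<sigma>\<close> apart, so writing the difference as an integral along the segment returns
  the factor \<open>\<sigma>\<close>. Dyadic layers overlap at most three times, hence all layers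
  together cost a multiple of the L1 norm of \<open>u\<close>. The coarsest layer has no partner to
  be subtracted from it, and this is the sole origin of the density \<open>f\<close>. Testing with a
  function that equals 1 near everything shows that the total integral of \<open>f\<close> is zero.
  So it suffices to balance \<open>f\<close> on the bounded components, provided that the unbounded
  component is unique: this is where \<open>DIM('a) \<ge> 2\<close> enters and why no radial field
  is attached to that component. Since fields are functions and not classes, the selection has to
  send fields that vanish almost everywhere on \<open>\<Omega>\<close> to zero.\<close>

lemma iter_pd_in:
  assumes "f \<in> S"
    and "\<And>f v. f \<in> S \<Longrightarrow> v \<in> Basis \<Longrightarrow> (\<lambda>x. frechet_derivative f (at x) v) \<in> S"
    and "set vs \<subseteq> Basis"
  shows "iter_pd vs f \<in> S"
  using assms(3) by (induction vs) (auto intro: assms)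

text \<open>\<open>smooth\<close> speaks about all iterated partial derivatives at once. Any set of
  differentiable functions that is stable under coordinate derivatives contains only smooth
  functions, so every closure property below reduces to exhibiting such a stable set.\<close>

lemma smooth_coinduct:
  assumes "f \<in> S"
    and "\<And>f x. f \<in> S \<Longrightarrow> f differentiable (at x)"
    and "\<And>f v. f \<in> S \<Longrightarrow> v \<in> Basis \<Longrightarrow> (\<lambda>x. frechet_derivative f (at x) v) \<in> S"
  shows "smooth f"
  unfolding smooth_def using iter_pd_in[of f S, OF assms(1,3)] assms(2) by blast

text \<open>\<open>iter_pd\<close> unfolds at the derivative taken last. Passing from
  \<open>f\<close> to one of its partial derivatives concerns the derivative taken first, which sits
  at the end of the list.\<close>

lemma iter_pd_snoc: "iter_pd vs (\<lambda>x. frechet_derivative f (at x) v) = iter_pd (vs @ [v]) f"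
  by (induction vs) auto

lemma smooth_differentiable: "smooth f \<Longrightarrow> f differentiable (at x)"
  unfolding smooth_def by (metis empty_subsetI iter_pd.simps(1) list.set(1))

lemma smooth_pd: "smooth f \<Longrightarrow> v \<in> Basis \<Longrightarrow> smooth (\<lambda>x. frechet_derivative f (at x) v)"
  unfolding smooth_def iter_pd_snoc by auto

lemma has_derivative_grad:
  assumes "f differentiable (at x)"
  shows "(f has_derivative (\<lambda>h. grad f x \<bullet> h)) (at x)"
proof -
  have d: "(f has_derivative frechet_derivative f (at x)) (at x)"
    using assms frechet_derivative_works by blast
  interpret linear "frechet_derivative f (at x)"
    using d has_derivative_linear by blast
  have "frechet_derivative f (at x) h = grad f x \<bullet> h" for h
  proof -
    have "frechet_derivative f (at x) h = frechet_derivative f (at x) (\<Sum>i\<in>Basis. (h \<bullet> i) *\<^sub>R i)"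
      by (simp add: euclidean_representation)
    also have "\<dots> = (\<Sum>i\<in>Basis. (h \<bullet> i) * frechet_derivative f (at x) i)"
      by (simp add: sum scaleR)
    finally show ?thesis
      by (simp add: grad_def inner_sum_left mult.commute inner_commute[of h])
  qed
  then have "frechet_derivative f (at x) = (\<lambda>h. grad f x \<bullet> h)" by blast
  then show ?thesis using d by simp
qed

lemma grad_eqI:
  assumes "(f has_derivative (\<lambda>h. g \<bullet> h)) (at x)"
  shows "grad f x = g"
proof -
  have "frechet_derivative f (at x) = (\<lambda>h. g \<bullet> h)"
    using assms frechet_derivative_at by metis
  then show ?thesis
    by (simp add: grad_def euclidean_representation)
qed

lemma pd_eqI:
  assumes "(f has_derivative f') (at x)"
  shows "frechet_derivative f (at x) v = f' v"
  using assms frechet_derivative_at by metis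

lemmas smooth_has_derivative = has_derivative_grad[OF smooth_differentiable]

lemma pd_grad: "smooth f \<Longrightarrow> frechet_derivative f (at x) v = grad f x \<bullet> v"
  using pd_eqI smooth_has_derivative by blast

lemma smooth_continuous: "smooth f \<Longrightarrow> continuous_on S f"
  by (meson continuous_at_imp_continuous_on differentiable_imp_continuous_within smooth_differentiable)

lemma smooth_grad_continuous: "smooth f \<Longrightarrow> continuous_on S (grad f)"
  unfolding grad_def
  by (intro continuous_intros smooth_continuous smooth_pd)

lemma smooth_const [simp]: "smooth (\<lambda>x. c)"
proof (rule smooth_coinduct[of _ "{(\<lambda>x. d) |d. True}"])
  fix f :: "'a \<Rightarrow> real" and v :: 'a assume "f \<in> {(\<lambda>x. d) |d. True}" "v \<in> Basis"
  then show "(\<lambda>x. frechet_derivative f (at x) v) \<in> {(\<lambda>x. d) |d. True}"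
    by auto
qed auto

lemma smooth_add:
  assumes "smooth f" "smooth g" shows "smooth (\<lambda>x. f x + g x)"
proof (rule smooth_coinduct[of _ "{(\<lambda>x. f x + g x) |f g. smooth f \<and> smooth g}"])
  show "(\<lambda>x. f x + g x) \<in> {(\<lambda>x. f x + g x) |f g. smooth f \<and> smooth g}" using assms by blast
next
  fix h :: "'a \<Rightarrow> real" and x assume "h \<in> {(\<lambda>x. f x + g x) |f g. smooth f \<and> smooth g}"
  then show "h differentiable (at x)" by (auto intro: smooth_differentiable differentiable_add)
next
  fix h :: "'a \<Rightarrow> real" and v :: 'a assume "h \<in> {(\<lambda>x. f x + g x) |f g. smooth f \<and> smooth g}" "v \<in> Basis"
  then obtain f g where *: "h = (\<lambda>x. f x + g x)" "smooth f" "smooth g" by auto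
  have "(\<lambda>x. frechet_derivative h (at x) v) =
     (\<lambda>x. frechet_derivative f (at x) v + frechet_derivative g (at x) v)"
  proof
    fix x show "frechet_derivative h (at x) v = frechet_derivative f (at x) v + frechet_derivative g (at x) v"
      unfolding * pd_grad[OF *(2)] pd_grad[OF *(3)]
      by (rule pd_eqI) (auto intro!: derivative_eq_intros smooth_has_derivative *)
  qed
  then show "(\<lambda>x. frechet_derivative h (at x) v) \<in> {(\<lambda>x. f x + g x) |f g. smooth f \<and> smooth g}"
    using smooth_pd[OF *(2) \<open>v \<in> Basis\<close>] smooth_pd[OF *(3) \<open>v \<in> Basis\<close>] by auto
qed

text \<open>Stable set for products: the Leibniz rule turns one product into a sum of two, so sums
  have to be included.\<close>

inductive_set prods :: "('a::euclidean_space \<Rightarrow> real) set" where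
  prods_mult: "smooth f \<Longrightarrow> smooth g \<Longrightarrow> (\<lambda>x. f x * g x) \<in> prods"
| prods_add: "f \<in> prods \<Longrightarrow> g \<in> prods \<Longrightarrow> (\<lambda>x. f x + g x) \<in> prods"

lemma smooth_mult:
  assumes "smooth f" "smooth g" shows "smooth (\<lambda>x. f x * g x)"
proof (rule smooth_coinduct[of _ prods])
  show "(\<lambda>x. f x * g x) \<in> prods" using assms by (rule prods_mult)
next
  show diff: "h differentiable (at x)" if "h \<in> prods" for h :: "'a \<Rightarrow> real" and x
    using that by induction (auto intro: smooth_differentiable differentiable_add differentiable_mult)
  fix h :: "'a \<Rightarrow> real" and v :: 'a assume "h \<in> prods" and v: "v \<in> Basis"
  then show "(\<lambda>x. frechet_derivative h (at x) v) \<in> prods"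
  proof induction
    case (prods_mult f g)
    have "(\<lambda>x. frechet_derivative (\<lambda>x. f x * g x) (at x) v) =
       (\<lambda>x. f x * frechet_derivative g (at x) v + frechet_derivative f (at x) v * g x)"
    proof
      fix x show "frechet_derivative (\<lambda>x. f x * g x) (at x) v =
        f x * frechet_derivative g (at x) v + frechet_derivative f (at x) v * g x"
        unfolding pd_grad[OF prods_mult(1)] pd_grad[OF prods_mult(2)]
        by (rule pd_eqI) (auto intro!: derivative_eq_intros smooth_has_derivative prods_mult)
    qed
    then show ?case
      using prods_mult v by (auto intro!: prods.intros smooth_pd)
  next
    case (prods_add f g)
    have "(\<lambda>x. frechet_derivative (\<lambda>x. f x + g x) (at x) v) =
       (\<lambda>x. frechet_derivative f (at x) v + frechet_derivative g (at x) v)"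
    proof
      fix x show "frechet_derivative (\<lambda>x. f x + g x) (at x) v =
        frechet_derivative f (at x) v + frechet_derivative g (at x) v"
        by (rule pd_eqI) (intro has_derivative_add frechet_derivative_works[THEN iffD1] diff prods_add)
    qed
    then show ?case
      using prods_add by (auto intro!: prods.intros)
  qed
qed

lemma smooth_cmult: "smooth f \<Longrightarrow> smooth (\<lambda>x. c * f x)"
  by (intro smooth_mult smooth_const)

lemma smooth_diff:
  assumes "smooth f" "smooth g" shows "smooth (\<lambda>x. f x - g x)"
proof -
  have "smooth (\<lambda>x. f x + (-1) * g x)"
    by (intro smooth_add smooth_cmult assms)
  then show ?thesis by simp
qed

lemma smooth_sum: "(\<And>i. i \<in> I \<Longrightarrow> smooth (f i)) \<Longrightarrow> smooth (\<lambda>x. \<Sum>i\<in>I. f i x)"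
  by (induction I rule: infinite_finite_induct) (auto intro!: smooth_add)

lemma smooth_inner [simp]: "smooth (\<lambda>x. x \<bullet> v)"
proof (rule smooth_coinduct[of _ "{\<lambda>x. x \<bullet> v} \<union> {(\<lambda>x. d) |d. True}"])
  fix f :: "'a \<Rightarrow> real" and w :: 'a
  assume "f \<in> {\<lambda>x. x \<bullet> v} \<union> {(\<lambda>x. d) |d. True}" "w \<in> Basis"
  moreover have "frechet_derivative (\<lambda>x. x \<bullet> v) (at x) w = w \<bullet> v" for x
    by (rule pd_eqI) (auto intro!: derivative_eq_intros)
  ultimately show "(\<lambda>x. frechet_derivative f (at x) w) \<in> {\<lambda>x. x \<bullet> v} \<union> {(\<lambda>x. d) |d. True}"
    by auto
qed auto

text \<open>The free factor \<open>d\<close> collects the powers of \<open>c\<close> that the chain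
  rule produces.\<close>

inductive_set affine_comps :: "real \<Rightarrow> 'a \<Rightarrow> ('a::euclidean_space \<Rightarrow> real) set" for c t where
  affine_comps: "smooth f \<Longrightarrow> (\<lambda>x. d * f (c *\<^sub>R x + t)) \<in> affine_comps c t"

lemma smooth_affine:
  assumes "smooth f" shows "smooth (\<lambda>x. f (c *\<^sub>R x + t))"
proof (rule smooth_coinduct[of _ "affine_comps c t"])
  show "(\<lambda>x. f (c *\<^sub>R x + t)) \<in> affine_comps c t"
    using affine_comps[OF assms, of 1 c t] by simp
next
  have D: "((\<lambda>x. d * f (c *\<^sub>R x + t)) has_derivative (\<lambda>h. d * (grad f (c *\<^sub>R x + t) \<bullet> (c *\<^sub>R h)))) (at x)"
    if "smooth f" for f :: "'a \<Rightarrow> real" and d x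
  proof -
    have "((f \<circ> (\<lambda>x. c *\<^sub>R x + t)) has_derivative ((\<lambda>h. grad f (c *\<^sub>R x + t) \<bullet> h) \<circ> (\<lambda>h. c *\<^sub>R h))) (at x)"
      by (rule diff_chain_at) (auto intro!: derivative_eq_intros smooth_has_derivative that)
    then have "((\<lambda>x. f (c *\<^sub>R x + t)) has_derivative (\<lambda>h. grad f (c *\<^sub>R x + t) \<bullet> (c *\<^sub>R h))) (at x)"
      by (simp only: o_def)
    then show ?thesis
      by (rule has_derivative_mult_right)
  qed
  show "h differentiable (at x)" if "h \<in> affine_comps c t" for h and x :: 'a
    using that by cases (simp only:, rule differentiableI, rule D)
  fix h :: "'a \<Rightarrow> real" and v :: 'a
  assume "h \<in> affine_comps c t" and v: "v \<in> Basis"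
  from this(1) show "(\<lambda>x. frechet_derivative h (at x) v) \<in> affine_comps c t"
  proof cases
    case (affine_comps f d)
    have "(\<lambda>x. frechet_derivative h (at x) v) = (\<lambda>x. (d * c) * (\<lambda>x. frechet_derivative f (at x) v) (c *\<^sub>R x + t))"
      using affine_comps by (simp add: pd_eqI[OF D] pd_grad mult.assoc)
    then show ?thesis
      using affine_comps.affine_comps[OF smooth_pd[OF affine_comps(2) v]] by simp
  qed
qed

lemma has_derivative_locally:
  assumes "smooth g" "open U" "x \<in> U" "\<And>y. y \<in> U \<Longrightarrow> f y = g y"
  shows "(f has_derivative (\<lambda>h. grad g x \<bullet> h)) (at x)"
  by (rule has_derivative_transform_within_open[OF smooth_has_derivative[OF assms(1)] assms(2,3)])
     (use assms(4) in auto)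

definition locally_smooth :: "('a::euclidean_space \<Rightarrow> real) set" where
  "locally_smooth = {f. \<forall>x. \<exists>U g. open U \<and> x \<in> U \<and> smooth g \<and> (\<forall>y\<in>U. f y = g y)}"

text \<open>Differentiation is local, so functions that agree near every point with some smooth
  function form a stable set. This serves functions glued from different formulas, such as
  extensions by zero.\<close>

lemma smooth_local:
  assumes "\<And>x. \<exists>U g. open U \<and> x \<in> U \<and> smooth g \<and> (\<forall>y\<in>U. f y = g y)"
  shows "smooth f"
proof (rule smooth_coinduct[of _ locally_smooth])
  show "f \<in> locally_smooth" using assms by (simp add: locally_smooth_def)
next
  fix h :: "'a \<Rightarrow> real" assume "h \<in> locally_smooth"
  then have h: "\<exists>U g. open U \<and> x \<in> U \<and> smooth g \<and> (\<forall>y\<in>U. h y = g y)" for x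
    by (simp add: locally_smooth_def)
  show "h differentiable (at x)" for x
  proof -
    obtain U g where "open U" "x \<in> U" "smooth g" "\<forall>y\<in>U. h y = g y" using h by blast
    then show ?thesis using has_derivative_locally[of g U x h] differentiableI by metis
  qed
  fix v :: 'a assume v: "v \<in> Basis"
  have "\<exists>U g. open U \<and> x \<in> U \<and> smooth g \<and> (\<forall>y\<in>U. frechet_derivative h (at y) v = g y)" for x
  proof -
    obtain U g where *: "open U" "x \<in> U" "smooth g" "\<forall>y\<in>U. h y = g y" using h by blast
    have "\<forall>y\<in>U. frechet_derivative h (at y) v = frechet_derivative g (at y) v"
    proof
      fix y assume "y \<in> U"
      then have "(h has_derivative (\<lambda>v. grad g y \<bullet> v)) (at y)"
        using * by (intro has_derivative_locally) auto
      then show "frechet_derivative h (at y) v = frechet_derivative g (at y) v"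
        by (simp add: pd_grad[OF *(3)] pd_eqI)
    qed
    then show ?thesis using * smooth_pd[OF *(3) v] by blast
  qed
  then show "(\<lambda>x. frechet_derivative h (at x) v) \<in> locally_smooth"
    by (simp add: locally_smooth_def)
qed

section \<open>Weak pairings, calculus of gradients, and test functions\<close>

abbreviation pairing :: "('a::euclidean_space \<Rightarrow> 'a) \<Rightarrow> ('a \<Rightarrow> real) \<Rightarrow> real" where
  "pairing u \<phi> \<equiv> \<integral>x. u x \<bullet> grad \<phi> x \<partial>lborel"

text \<open>In these terms \<open>div w = - f\<close> in the sense of distributions reads
  \<open>moment f \<phi> = pairing w \<phi>\<close> for all test functions. The body is symmetric in
  its arguments, and \<open>moment (indicator C) f\<close> later stands for the mass of
  \<open>f\<close> on \<open>C\<close>.\<close>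

abbreviation moment :: "('a::euclidean_space \<Rightarrow> real) \<Rightarrow> ('a \<Rightarrow> real) \<Rightarrow> real" where
  "moment f \<phi> \<equiv> \<integral>x. f x * \<phi> x \<partial>lborel"

lemma grad_local:
  assumes "smooth g" "open U" "x \<in> U" "\<And>y. y \<in> U \<Longrightarrow> f y = g y"
  shows "grad f x = grad g x"
  by (rule grad_eqI, rule has_derivative_transform_within_open[OF smooth_has_derivative[OF assms(1)] assms(2,3)])
     (use assms(4) in auto)

lemma grad_const_on:
  assumes "open U" "x \<in> U" "\<And>y. y \<in> U \<Longrightarrow> f y = c"
  shows "grad f x = 0"
proof -
  have "grad f x = grad (\<lambda>_. c) x" by (rule grad_local[OF _ assms]) auto
  also have "\<dots> = 0" by (rule grad_eqI) auto
  finally show ?thesis .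
qed

lemma grad_add: "smooth f \<Longrightarrow> smooth g \<Longrightarrow> grad (\<lambda>x. f x + g x) x = grad f x + grad g x"
  by (rule grad_eqI, unfold inner_add_left inner_scaleR_left, (rule derivative_eq_intros smooth_has_derivative | assumption)+) auto

lemma grad_diff: "smooth f \<Longrightarrow> smooth g \<Longrightarrow> grad (\<lambda>x. f x - g x) x = grad f x - grad g x"
  by (rule grad_eqI) (auto intro!: derivative_eq_intros smooth_has_derivative simp: inner_diff_left)

lemma grad_mult: "smooth f \<Longrightarrow> smooth g \<Longrightarrow> grad (\<lambda>x. f x * g x) x = f x *\<^sub>R grad g x + g x *\<^sub>R grad f x"
  by (rule grad_eqI, unfold inner_add_left inner_scaleR_left, (rule derivative_eq_intros smooth_has_derivative | assumption)+) auto

lemma grad_sum: "(\<And>i. i \<in> I \<Longrightarrow> smooth (f i)) \<Longrightarrow> grad (\<lambda>x. \<Sum>i\<in>I. f i x) x = (\<Sum>i\<in>I. grad (f i) x)"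
proof (induction I rule: infinite_finite_induct)
  case (insert i I)
  then show ?case by (simp add: grad_add smooth_sum)
qed (auto intro!: grad_eqI)

lemma grad_translate: "smooth f \<Longrightarrow> grad (\<lambda>x. f (x - t)) x = grad f (x - t)"
proof (rule grad_eqI)
  assume "smooth f"
  have "((f \<circ> (\<lambda>x. x - t)) has_derivative ((\<lambda>h. grad f (x - t) \<bullet> h) \<circ> (\<lambda>h. h))) (at x)"
    by (rule diff_chain_at) (auto intro!: derivative_eq_intros smooth_has_derivative \<open>smooth f\<close>)
  then show "((\<lambda>x. f (x - t)) has_derivative (\<bullet>) (grad f (x - t))) (at x)"
    by (simp add: o_def)
qed

lemma smooth_translate: "smooth f \<Longrightarrow> smooth (\<lambda>x. f (x - t))"
  using smooth_affine[of f 1 "-t"] by simp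

lemma test_funD:
  assumes "test_fun U f"
  shows "smooth f" "compact (closure {x. f x \<noteq> 0})" "closure {x. f x \<noteq> 0} \<subseteq> U"
  using assms by (auto simp: test_fun_def)

lemma test_fun_mono: "test_fun U f \<Longrightarrow> U \<subseteq> V \<Longrightarrow> test_fun V f"
  by (auto simp: test_fun_def)

lemma test_funI:
  assumes "smooth f" "compact K" "K \<subseteq> U" "\<And>x. x \<notin> K \<Longrightarrow> f x = 0"
  shows "test_fun U f"
proof -
  have "closure {x. f x \<noteq> 0} \<subseteq> K"
    using assms by (intro closure_minimal) (auto intro: compact_imp_closed)
  moreover from this have "compact (closure {x. f x \<noteq> 0})"
    using compact_Int_closed[OF assms(2) closed_closure[of "{x. f x \<noteq> 0}"]] by (simp add: Int_absorb1)
  ultimately show ?thesis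
    using assms(1,3) unfolding test_fun_def by blast
qed

lemma test_fun_grad_support: "x \<notin> closure {x. f x \<noteq> 0} \<Longrightarrow> grad f x = 0"
  by (rule grad_const_on[of "- closure {x. f x \<noteq> 0}" _ _ 0])
     (use closure_subset[of "{x. f x \<noteq> 0}"] in auto)

lemma test_fun_support: "x \<notin> closure {x. f x \<noteq> 0} \<Longrightarrow> f x = 0"
  using closure_subset[of "{x. f x \<noteq> 0}"] by auto

lemma test_fun_mult:
  assumes "test_fun U f" "smooth g" shows "test_fun U (\<lambda>x. g x * f x)"
proof (rule test_funI)
  show "smooth (\<lambda>x. g x * f x)" using assms(2) test_funD(1)[OF assms(1)] by (rule smooth_mult)
  show "compact (closure {x. f x \<noteq> 0})" "closure {x. f x \<noteq> 0} \<subseteq> U" using test_funD[OF assms(1)] by auto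
  show "g x * f x = 0" if "x \<notin> closure {x. f x \<noteq> 0}" for x
    unfolding test_fun_support[OF that] by simp
qed

lemma test_fun_grad_bounded:
  assumes "test_fun U f"
  obtains B where "B \<ge> 0" "\<And>x. norm (grad f x) \<le> B" "\<And>x. \<bar>f x\<bar> \<le> B"
proof -
  let ?K = "closure {x. f x \<noteq> 0}"
  note K = test_funD[OF assms]
  have "bounded (grad f ` ?K)" "bounded (f ` ?K)"
    by (intro compact_imp_bounded compact_continuous_image smooth_grad_continuous smooth_continuous K)+
  then obtain B1 B2 where B: "\<And>x. x \<in> ?K \<Longrightarrow> norm (grad f x) \<le> B1" "\<And>x. x \<in> ?K \<Longrightarrow> \<bar>f x\<bar> \<le> B2"
    unfolding bounded_iff by auto
  show ?thesis
  proof (rule that[of "max 0 (max B1 B2)"])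
    fix x
    show "norm (grad f x) \<le> max 0 (max B1 B2)"
      using B(1)[of x] test_fun_grad_support[of x f] by (cases "x \<in> ?K") auto
    show "\<bar>f x\<bar> \<le> max 0 (max B1 B2)"
      using B(2)[of x] test_fun_support[of x f] by (cases "x \<in> ?K") auto
  qed simp
qed

lemma smooth_measurable [measurable_dest]: "smooth f \<Longrightarrow> f \<in> borel_measurable borel"
  by (intro borel_measurable_continuous_onI smooth_continuous)

lemma grad_measurable [measurable_dest]: "smooth f \<Longrightarrow> grad f \<in> borel_measurable borel"
  by (intro borel_measurable_continuous_onI smooth_grad_continuous)

section \<open>Images of integrable densities\<close>

lemma
  fixes f :: "'a::euclidean_space \<Rightarrow> 'b::{banach, second_countable_topology}"
  assumes c: "c \<noteq> 0" and f: "f \<in> borel_measurable borel"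
  shows lborel_integrable_affine: "integrable lborel (\<lambda>x. f (t + c *\<^sub>R x)) \<longleftrightarrow> integrable lborel f"
    and lborel_integral_affine:
      "(\<integral>x. f (t + c *\<^sub>R x) \<partial>lborel) = (1 / \<bar>c\<bar> ^ DIM('a)) *\<^sub>R (\<integral>x. f x \<partial>lborel)"
proof -
  have T[measurable]: "(\<lambda>x::'a. t + c *\<^sub>R x) \<in> lborel \<rightarrow>\<^sub>M borel" by simp
  have f'[measurable]: "f \<in> borel_measurable (distr lborel borel (\<lambda>x::'a. t + c *\<^sub>R x))" "f \<in> borel_measurable lborel"
    using f by simp_all
  have eq: "(lborel :: 'a measure) = density (distr lborel borel (\<lambda>x. t + c *\<^sub>R x)) (\<lambda>_. ennreal (\<bar>c\<bar> ^ DIM('a)))"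
    using lborel_affine[OF c, of t] by simp
  have "integrable lborel f \<longleftrightarrow> integrable (density (distr lborel borel (\<lambda>x. t + c *\<^sub>R x)) (\<lambda>_. ennreal (\<bar>c\<bar> ^ DIM('a)))) f"
    by (subst eq) simp
  also have "\<dots> \<longleftrightarrow> integrable (distr lborel borel (\<lambda>x. t + c *\<^sub>R x)) (\<lambda>x. (\<bar>c\<bar> ^ DIM('a)) *\<^sub>R f x)"
    by (subst integrable_density) auto
  also have "\<dots> \<longleftrightarrow> integrable lborel (\<lambda>x. (\<bar>c\<bar> ^ DIM('a)) *\<^sub>R f (t + c *\<^sub>R x))"
    by (subst integrable_distr_eq) (use f in auto)
  also have "\<dots> \<longleftrightarrow> integrable lborel (\<lambda>x. f (t + c *\<^sub>R x))"
  proof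
    assume "integrable lborel (\<lambda>x. (\<bar>c\<bar> ^ DIM('a)) *\<^sub>R f (t + c *\<^sub>R x))"
    then have "integrable lborel (\<lambda>x. (1 / \<bar>c\<bar> ^ DIM('a)) *\<^sub>R (\<bar>c\<bar> ^ DIM('a)) *\<^sub>R f (t + c *\<^sub>R x))"
      by (rule integrable_scaleR_right)
    then show "integrable lborel (\<lambda>x. f (t + c *\<^sub>R x))" using c by simp
  qed (rule integrable_scaleR_right)
  finally show "integrable lborel (\<lambda>x. f (t + c *\<^sub>R x)) \<longleftrightarrow> integrable lborel f" by simp
  have "(\<integral>x. f x \<partial>lborel) = (\<integral>x. f x \<partial>density (distr lborel borel (\<lambda>x. t + c *\<^sub>R x)) (\<lambda>_. ennreal (\<bar>c\<bar> ^ DIM('a))))"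
    by (subst eq) simp
  also have "\<dots> = (\<integral>x. (\<bar>c\<bar> ^ DIM('a)) *\<^sub>R f x \<partial>distr lborel borel (\<lambda>x. t + c *\<^sub>R x))"
    by (subst integral_density) auto
  also have "\<dots> = (\<integral>x. (\<bar>c\<bar> ^ DIM('a)) *\<^sub>R f (t + c *\<^sub>R x) \<partial>lborel)"
    by (subst integral_distr) (use f in auto)
  finally show "(\<integral>x. f (t + c *\<^sub>R x) \<partial>lborel) = (1 / \<bar>c\<bar> ^ DIM('a)) *\<^sub>R (\<integral>x. f x \<partial>lborel)"
    using c by simp
qed

text \<open>This discharges the \<open>null\<close> hypotheses of the lemmas on images: at a fixed
  intermediate time each transport used below moves points by an affine map with nonzero factor,
  possibly after one further variable has been frozen.\<close>

lemma AE_lborel_affine: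
  fixes N :: "'a::euclidean_space set"
  assumes c: "c \<noteq> 0" and N: "N \<in> null_sets lborel"
  shows "AE x in lborel. t + c *\<^sub>R x \<notin> N"
proof -
  have T[measurable]: "(\<lambda>x::'a. t + c *\<^sub>R x) \<in> lborel \<rightarrow>\<^sub>M borel" by simp
  have eq: "(lborel :: 'a measure) = density (distr lborel borel (\<lambda>x. t + c *\<^sub>R x)) (\<lambda>_. ennreal (\<bar>c\<bar> ^ DIM('a)))"
    using lborel_affine[OF c, of t] by simp
  have [measurable]: "N \<in> sets borel" using N by auto
  have "AE x in lborel. x \<notin> N" using N by (rule AE_not_in)
  then have "AE x in density (distr lborel borel (\<lambda>x. t + c *\<^sub>R x)) (\<lambda>_. ennreal (\<bar>c\<bar> ^ DIM('a))). x \<notin> N"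
    by (subst (asm) eq)
  then have "AE x in distr lborel borel (\<lambda>x. t + c *\<^sub>R x). x \<notin> N"
    using c by (subst (asm) AE_density) auto
  then show ?thesis
    by (subst (asm) AE_distr_iff) auto
qed

lemma integrable_mult_bounded_borel:
  fixes w G :: "'b \<Rightarrow> real"
  assumes "integrable M w" "G \<in> borel_measurable M" "\<And>x. \<bar>G x\<bar> \<le> B"
  shows "integrable M (\<lambda>x. w x * G x)"
proof (rule Bochner_Integration.integrable_bound)
  show "integrable M (\<lambda>x. B * w x)" using assms by simp
  show "AE x in M. norm (w x * G x) \<le> norm (B * w x)"
  proof (rule AE_I2)
    fix x
    have "\<bar>G x\<bar> \<le> \<bar>B\<bar>" using assms(3)[of x] by linarith
    then show "norm (w x * G x) \<le> norm (B * w x)"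
      using mult_right_mono[of "\<bar>G x\<bar>" "\<bar>B\<bar>" "\<bar>w x\<bar>"] by (simp add: abs_mult mult.commute)
  qed
qed (use assms in \<open>auto intro: borel_measurable_times\<close>)

lemma integrable_inner_bounded_borel:
  fixes w G :: "'b \<Rightarrow> 'a::euclidean_space"
  assumes "integrable M w" "G \<in> borel_measurable M" "\<And>x. norm (G x) \<le> B"
  shows "integrable M (\<lambda>x. w x \<bullet> G x)"
proof (rule Bochner_Integration.integrable_bound)
  show "integrable M (\<lambda>x. B * norm (w x))" using assms by simp
  show "AE x in M. norm (w x \<bullet> G x) \<le> norm (B * norm (w x))"
  proof (rule AE_I2)
    fix x
    have "\<bar>w x \<bullet> G x\<bar> \<le> norm (w x) * norm (G x)" by (rule Cauchy_Schwarz_ineq2)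
    also have "\<dots> \<le> norm (w x) * B" using assms(3)[of x] by (simp add: mult_left_mono)
    finally show "norm (w x \<bullet> G x) \<le> norm (B * norm (w x))"
      by (simp add: mult.commute)
  qed
qed (use assms in \<open>auto intro: borel_measurable_inner\<close>)

text \<open>Radon--Nikodym replaces any explicit computation of the image density.\<close>

lemma push_density_nonneg:
  fixes h :: "'b \<Rightarrow> real" and \<Psi> :: "'b \<Rightarrow> 'a::euclidean_space"
  assumes h: "integrable M h" and nn: "\<And>m. h m \<ge> 0" and \<Psi>[measurable]: "\<Psi> \<in> M \<rightarrow>\<^sub>M borel"
    and null: "\<And>N. N \<in> null_sets lborel \<Longrightarrow> AE m in M. h m \<noteq> 0 \<longrightarrow> \<Psi> m \<notin> N"
  obtains w where "integrable lborel w" "\<And>x. w x \<ge> 0"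
    "\<And>G :: 'a \<Rightarrow> real. G \<in> borel_measurable borel \<Longrightarrow> (\<integral>m. h m * G (\<Psi> m) \<partial>M) = (\<integral>x. w x * G x \<partial>lborel)"
proof -
  have hm[measurable]: "h \<in> borel_measurable M" using h by auto
  define N where "N = distr (density M (\<lambda>m. ennreal (h m))) borel \<Psi>"
  have sN: "sets N = sets (lborel :: 'a measure)" by (simp add: N_def)
  have eN: "emeasure N A = (\<integral>\<^sup>+m. ennreal (h m) * indicator A (\<Psi> m) \<partial>M)" if "A \<in> sets borel" for A
    using that by (simp add: N_def emeasure_distr emeasure_density measurable_sets) 
      (auto intro!: nn_integral_cong simp: indicator_def)
  have fin: "finite_measure N"
  proof
    have "emeasure N (space N) = (\<integral>\<^sup>+m. ennreal (h m) \<partial>M)"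
      using eN[of UNIV] by (simp add: N_def)
    also have "\<dots> < \<infinity>" using h nn by (simp add: integrable_iff_bounded)
    finally show "emeasure N (space N) \<noteq> \<infinity>" by simp
  qed
  have ac: "absolutely_continuous lborel N"
    unfolding absolutely_continuous_def
  proof
    fix A :: "'a set" assume A: "A \<in> null_sets lborel"
    then have [measurable]: "A \<in> sets borel" by auto
    have "emeasure N A = (\<integral>\<^sup>+m. 0 \<partial>M)"
      unfolding eN[OF \<open>A \<in> sets borel\<close>]
      by (rule nn_integral_cong_AE) (use null[OF A] in \<open>auto simp: indicator_def\<close>)
    then show "A \<in> null_sets N" using sN by (auto simp: null_sets_def)
  qed
  obtain D where D[measurable]: "D \<in> borel_measurable lborel" "AE x in lborel. RN_deriv lborel N x = ennreal (D x)" "\<And>x. 0 \<le> D x"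
    by (rule sigma_finite_measure.real_RN_deriv[OF lborel.sigma_finite_measure_axioms fin ac sN]) blast
  have "density lborel (RN_deriv lborel N) = N"
    by (rule sigma_finite_measure.density_RN_deriv[OF lborel.sigma_finite_measure_axioms ac sN])
  moreover have "density lborel (RN_deriv lborel N) = density lborel (\<lambda>x. ennreal (D x))"
    by (rule density_cong) (use D in auto)
  ultimately have dD: "density lborel (\<lambda>x. ennreal (D x)) = N" by simp
  \<comment> \<open>The total mass of \<open>N\<close> is the integral of \<open>D\<close>, so
    finiteness of the image measure is integrability of its density.\<close>
  have "integrable N (\<lambda>x. 1::real)" using fin by (simp add: finite_measure.integrable_const)
  then have "integrable lborel D"
    unfolding dD[symmetric] using D by (subst (asm) integrable_density) auto
  moreover have "(\<integral>m. h m * G (\<Psi> m) \<partial>M) = (\<integral>x. D x * G x \<partial>lborel)" if [measurable]: "G \<in> borel_measurable borel" for G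
  proof -
    have "(\<integral>x. D x * G x \<partial>lborel) = integral\<^sup>L N G"
      unfolding dD[symmetric] using D by (subst integral_density) auto
    also have "\<dots> = (\<integral>m. G (\<Psi> m) \<partial>density M (\<lambda>m. ennreal (h m)))"
      unfolding N_def by (subst integral_distr) auto
    also have "\<dots> = (\<integral>m. h m * G (\<Psi> m) \<partial>M)"
      using nn by (subst integral_density) auto
    finally show ?thesis by simp
  qed
  ultimately show ?thesis using that D(3) by blast
qed

text \<open>Positive and negative part are pushed separately. Their images may overlap and cancel,
  so the L1 norm can only drop. Boundedness of \<open>G\<close> keeps both integrals finite when
  they are subtracted.\<close>

lemma push_density:
  fixes h :: "'b \<Rightarrow> real" and \<Psi> :: "'b \<Rightarrow> 'a::euclidean_space"
  assumes h: "integrable M h" and \<Psi>[measurable]: "\<Psi> \<in> M \<rightarrow>\<^sub>M borel"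
    and null: "\<And>N. N \<in> null_sets lborel \<Longrightarrow> AE m in M. h m \<noteq> 0 \<longrightarrow> \<Psi> m \<notin> N"
  obtains w where "integrable lborel w" "(\<integral>x. \<bar>w x\<bar> \<partial>lborel) \<le> (\<integral>m. \<bar>h m\<bar> \<partial>M)"
    "\<And>(G :: 'a \<Rightarrow> real) B. G \<in> borel_measurable borel \<Longrightarrow> (\<And>x. \<bar>G x\<bar> \<le> B) \<Longrightarrow>
       (\<integral>m. h m * G (\<Psi> m) \<partial>M) = (\<integral>x. w x * G x \<partial>lborel)"
proof -
  have hm[measurable]: "h \<in> borel_measurable M" using h by auto
  let ?p = "\<lambda>m. max 0 (h m)" and ?n = "\<lambda>m. max 0 (- h m)"
  have ip: "integrable M ?p" "integrable M ?n" using h by auto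
  obtain p where p: "integrable lborel p" "\<And>x. p x \<ge> 0"
    "\<And>G. G \<in> borel_measurable borel \<Longrightarrow> (\<integral>m. ?p m * G (\<Psi> m) \<partial>M) = (\<integral>x. p x * G x \<partial>lborel)"
  proof (rule push_density_nonneg[OF ip(1) _ \<Psi>])
    show "AE m in M. ?p m \<noteq> 0 \<longrightarrow> \<Psi> m \<notin> N" if "N \<in> null_sets lborel" for N
      using null[OF that] by (rule AE_mp) (auto simp: max_def)
  qed auto
  obtain n where n: "integrable lborel n" "\<And>x. n x \<ge> 0"
    "\<And>G. G \<in> borel_measurable borel \<Longrightarrow> (\<integral>m. ?n m * G (\<Psi> m) \<partial>M) = (\<integral>x. n x * G x \<partial>lborel)"
  proof (rule push_density_nonneg[OF ip(2) _ \<Psi>])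
    show "AE m in M. ?n m \<noteq> 0 \<longrightarrow> \<Psi> m \<notin> N" if "N \<in> null_sets lborel" for N
      using null[OF that] by (rule AE_mp) (auto simp: max_def)
  qed auto
  have "integrable lborel (\<lambda>x. p x - n x)" using p n by simp
  moreover have "(\<integral>x. \<bar>p x - n x\<bar> \<partial>lborel) \<le> (\<integral>m. \<bar>h m\<bar> \<partial>M)"
  proof -
    have "(\<integral>x. \<bar>p x - n x\<bar> \<partial>lborel) \<le> (\<integral>x. p x + n x \<partial>lborel)"
    proof (rule integral_mono)
      fix x show "\<bar>p x - n x\<bar> \<le> p x + n x" using p(2)[of x] n(2)[of x] by linarith
    qed (use p n in auto)
    also have "\<dots> = (\<integral>m. ?p m \<partial>M) + (\<integral>m. ?n m \<partial>M)"
      using p(3)[of "\<lambda>_. 1"] n(3)[of "\<lambda>_. 1"] p(1) n(1) by simp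
    also have "\<dots> = (\<integral>m. ?p m + ?n m \<partial>M)" using ip by simp
    also have "\<dots> = (\<integral>m. \<bar>h m\<bar> \<partial>M)" by (rule Bochner_Integration.integral_cong) auto
    finally show ?thesis .
  qed
  moreover have "(\<integral>m. h m * G (\<Psi> m) \<partial>M) = (\<integral>x. (p x - n x) * G x \<partial>lborel)"
    if G[measurable]: "G \<in> borel_measurable borel" and B: "\<And>x. \<bar>G x\<bar> \<le> B" for G :: "'a \<Rightarrow> real" and B
  proof -
    have "(\<integral>x. (p x - n x) * G x \<partial>lborel) = (\<integral>x. p x * G x \<partial>lborel) - (\<integral>x. n x * G x \<partial>lborel)"
      unfolding left_diff_distrib
      by (intro Bochner_Integration.integral_diff integrable_mult_bounded_borel[OF _ _ B] p n) auto
    also have "\<dots> = (\<integral>m. ?p m * G (\<Psi> m) \<partial>M) - (\<integral>m. ?n m * G (\<Psi> m) \<partial>M)"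
      using p(3)[OF G] n(3)[OF G] by simp
    also have "\<dots> = (\<integral>m. ?p m * G (\<Psi> m) - ?n m * G (\<Psi> m) \<partial>M)"
      by (intro Bochner_Integration.integral_diff[symmetric] integrable_mult_bounded_borel[OF _ _ B] ip) auto
    also have "\<dots> = (\<integral>m. h m * G (\<Psi> m) \<partial>M)"
      by (rule Bochner_Integration.integral_cong) (auto simp: max_def)
    finally show ?thesis by simp
  qed
  ultimately show ?thesis using that by blast
qed

text \<open>Coordinate by coordinate; each coordinate of \<open>h\<close> is bounded by
  \<open>norm h\<close>, and summing over the basis gives the factor \<open>DIM('a)\<close>.\<close>

lemma push_vector:
  fixes h :: "'b \<Rightarrow> 'a::euclidean_space" and \<Psi> :: "'b \<Rightarrow> 'a"
  assumes h: "integrable M h" and \<Psi>[measurable]: "\<Psi> \<in> M \<rightarrow>\<^sub>M borel"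
    and null: "\<And>N. N \<in> null_sets lborel \<Longrightarrow> AE m in M. h m \<noteq> 0 \<longrightarrow> \<Psi> m \<notin> N"
    and \<Omega>: "\<Omega> \<in> sets borel" "\<And>m. h m \<noteq> 0 \<Longrightarrow> \<Psi> m \<notin> \<Omega>"
  obtains w :: "'a \<Rightarrow> 'a" where "integrable lborel w" "\<And>x. x \<in> \<Omega> \<Longrightarrow> w x = 0"
    "(\<integral>x. norm (w x) \<partial>lborel) \<le> DIM('a) * (\<integral>m. norm (h m) \<partial>M)"
    "\<And>(G :: 'a \<Rightarrow> 'a) B. G \<in> borel_measurable borel \<Longrightarrow> (\<And>x. norm (G x) \<le> B) \<Longrightarrow>
       (\<integral>m. h m \<bullet> G (\<Psi> m) \<partial>M) = (\<integral>x. w x \<bullet> G x \<partial>lborel)"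
proof -
  have hb: "integrable M (\<lambda>m. h m \<bullet> b)" for b using h by simp
  have "\<exists>w. integrable lborel w \<and> (\<integral>x. \<bar>w x\<bar> \<partial>lborel) \<le> (\<integral>m. \<bar>h m \<bullet> b\<bar> \<partial>M) \<and>
    (\<forall>(G :: 'a \<Rightarrow> real) B. G \<in> borel_measurable borel \<longrightarrow> (\<forall>x. \<bar>G x\<bar> \<le> B) \<longrightarrow>
       (\<integral>m. (h m \<bullet> b) * G (\<Psi> m) \<partial>M) = (\<integral>x. w x * G x \<partial>lborel))" for b
  proof (rule push_density[OF hb \<Psi>])
    show "AE m in M. h m \<bullet> b \<noteq> 0 \<longrightarrow> \<Psi> m \<notin> N" if "N \<in> null_sets lborel" for N
      using null[OF that] by (rule AE_mp) auto
  qed blast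
  then have "\<forall>b. \<exists>w. integrable lborel w \<and> (\<integral>x. \<bar>w x\<bar> \<partial>lborel) \<le> (\<integral>m. \<bar>h m \<bullet> b\<bar> \<partial>M) \<and>
    (\<forall>(G :: 'a \<Rightarrow> real) B. G \<in> borel_measurable borel \<longrightarrow> (\<forall>x. \<bar>G x\<bar> \<le> B) \<longrightarrow>
       (\<integral>m. (h m \<bullet> b) * G (\<Psi> m) \<partial>M) = (\<integral>x. w x * G x \<partial>lborel))" by (rule allI)
  from choice[OF this] obtain W where W0: "\<forall>b. integrable lborel (W b) \<and> (\<integral>x. \<bar>W b x\<bar> \<partial>lborel) \<le> (\<integral>m. \<bar>h m \<bullet> b\<bar> \<partial>M) \<and>
    (\<forall>(G :: 'a \<Rightarrow> real) B. G \<in> borel_measurable borel \<longrightarrow> (\<forall>x. \<bar>G x\<bar> \<le> B) \<longrightarrow>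
       (\<integral>m. (h m \<bullet> b) * G (\<Psi> m) \<partial>M) = (\<integral>x. W b x * G x \<partial>lborel))" by (rule exE)
  have W: "integrable lborel (W b)" "(\<integral>x. \<bar>W b x\<bar> \<partial>lborel) \<le> (\<integral>m. \<bar>h m \<bullet> b\<bar> \<partial>M)"
    "G \<in> borel_measurable borel \<Longrightarrow> (\<And>x. \<bar>G x\<bar> \<le> B) \<Longrightarrow>
       (\<integral>m. (h m \<bullet> b) * G (\<Psi> m) \<partial>M) = (\<integral>x. W b x * G x \<partial>lborel)" for b and G :: "'a \<Rightarrow> real" and B
    using W0[rule_format, of b] by auto
  \<comment> \<open>The image measure does not charge \<open>\<Omega>\<close>, but that only makes
    its density zero almost everywhere there. Cutting off by hand makes \<open>w\<close> vanish at
    every point of \<open>\<Omega>\<close>.\<close>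
  define w where "w x = indicator (- \<Omega>) x *\<^sub>R (\<Sum>b\<in>Basis. W b x *\<^sub>R b)" for x
  have iw0: "integrable lborel (\<lambda>x. \<Sum>b\<in>Basis. W b x *\<^sub>R b)" using W by auto
  have iw: "integrable lborel w"
    unfolding w_def by (rule integrable_mult_indicator) (use \<Omega> iw0 in auto)
  moreover have "w x = 0" if "x \<in> \<Omega>" for x using that by (simp add: w_def)
  moreover have "(\<integral>x. norm (w x) \<partial>lborel) \<le> DIM('a) * (\<integral>m. norm (h m) \<partial>M)"
  proof -
    have "(\<integral>x. norm (w x) \<partial>lborel) \<le> (\<integral>x. (\<Sum>b\<in>Basis. \<bar>W b x\<bar>) \<partial>lborel)"
    proof (rule integral_mono)
      fix x
      have "norm (w x) \<le> norm (\<Sum>b\<in>Basis. W b x *\<^sub>R b)" by (auto simp: w_def indicator_def)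
      also have "\<dots> \<le> (\<Sum>b\<in>Basis. norm (W b x *\<^sub>R b))" by (rule norm_sum)
      finally show "norm (w x) \<le> (\<Sum>b\<in>Basis. \<bar>W b x\<bar>)" by simp
    qed (use iw W in auto)
    also have "\<dots> = (\<Sum>b\<in>Basis. \<integral>x. \<bar>W b x\<bar> \<partial>lborel)"
      using W by (subst Bochner_Integration.integral_sum) auto
    also have "\<dots> \<le> (\<Sum>b\<in>(Basis::'a set). \<integral>m. norm (h m) \<partial>M)"
    proof (rule sum_mono)
      fix b :: 'a assume b: "b \<in> Basis"
      have "(\<integral>x. \<bar>W b x\<bar> \<partial>lborel) \<le> (\<integral>m. \<bar>h m \<bullet> b\<bar> \<partial>M)" by (rule W)
      also have "\<dots> \<le> (\<integral>m. norm (h m) \<partial>M)"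
        by (rule integral_mono) (use h hb b Basis_le_norm in auto)
      finally show "(\<integral>x. \<bar>W b x\<bar> \<partial>lborel) \<le> (\<integral>m. norm (h m) \<partial>M)" .
    qed
    finally show ?thesis by simp
  qed
  moreover have "(\<integral>m. h m \<bullet> G (\<Psi> m) \<partial>M) = (\<integral>x. w x \<bullet> G x \<partial>lborel)"
    if G[measurable]: "G \<in> borel_measurable borel" and B: "\<And>x. norm (G x) \<le> B" for G B
  proof -
    \<comment> \<open>The cutoff is moved from \<open>w\<close> to the integrand, where it changes
      nothing: \<open>\<Psi> m\<close> avoids \<open>\<Omega>\<close> wherever \<open>h m\<close> is
      nonzero.\<close>
    define G' where "G' x = indicator (- \<Omega>) x *\<^sub>R G x" for x
    have [measurable]: "G' \<in> borel_measurable borel" unfolding G'_def using \<Omega> by measurable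
    have Gb: "\<bar>G' x \<bullet> b\<bar> \<le> B" if "b \<in> Basis" for x b
    proof -
      have "norm (G' x) \<le> norm (G x)" by (simp add: G'_def indicator_def)
      then show ?thesis using Basis_le_norm[OF that, of "G' x"] B[of x] by linarith
    qed
    have "(\<integral>m. h m \<bullet> G (\<Psi> m) \<partial>M) = (\<integral>m. (\<Sum>b\<in>Basis. (h m \<bullet> b) * (G' (\<Psi> m) \<bullet> b)) \<partial>M)"
    proof (rule Bochner_Integration.integral_cong)
      fix m
      show "h m \<bullet> G (\<Psi> m) = (\<Sum>b\<in>Basis. (h m \<bullet> b) * (G' (\<Psi> m) \<bullet> b))"
      proof (cases "h m = 0")
        case False
        then have "G' (\<Psi> m) = G (\<Psi> m)" using \<Omega>(2)[of m] by (simp add: G'_def)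
        then show ?thesis using euclidean_inner[of "h m" "G (\<Psi> m)"] by simp
      qed simp
    qed simp
    also have "\<dots> = (\<Sum>b\<in>Basis. \<integral>m. (h m \<bullet> b) * (G' (\<Psi> m) \<bullet> b) \<partial>M)"
      by (intro Bochner_Integration.integral_sum integrable_mult_bounded_borel[OF hb _ Gb]) auto
    also have "\<dots> = (\<Sum>b\<in>Basis. \<integral>x. W b x * (G' x \<bullet> b) \<partial>lborel)"
      by (intro sum.cong refl W(3)[OF _ Gb]) auto
    also have "\<dots> = (\<integral>x. (\<Sum>b\<in>Basis. W b x * (G' x \<bullet> b)) \<partial>lborel)"
      by (intro Bochner_Integration.integral_sum[symmetric] integrable_mult_bounded_borel[OF W(1) _ Gb]) auto
    also have "\<dots> = (\<integral>x. w x \<bullet> G x \<partial>lborel)"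
      by (rule Bochner_Integration.integral_cong)
         (auto simp: w_def G'_def inner_sum_left inner_commute[of "G _"] indicator_def)
    finally show ?thesis .
  qed
  ultimately show ?thesis using that by blast
qed

text \<open>The mass \<open>h m\<close> travels along the segment from \<open>A m\<close> to
  \<open>B m\<close>. By the fundamental theorem of calculus,
  \<open>\<phi> (B m) - \<phi> (A m)\<close> is the integral of
  \<open>grad \<phi> \<bullet> (B m - A m)\<close> over the segment, so the field is the image of
  \<open>h m *\<^sub>R (B m - A m)\<close> under
  \<open>(t, m) \<mapsto> A m + t *\<^sub>R (B m - A m)\<close>. The null set condition is asked for
  \<open>0 < t < 1\<close> only, because the map may degenerate at an endpoint when part of
  \<open>m\<close> is frozen.\<close>

lemma transport:
  fixes A B :: "'b \<Rightarrow> 'a::euclidean_space" and h :: "'b \<Rightarrow> real" and D :: real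
  assumes M: "sigma_finite_measure M" and h: "integrable M h"
    and A[measurable]: "A \<in> M \<rightarrow>\<^sub>M borel" and B[measurable]: "B \<in> M \<rightarrow>\<^sub>M borel"
    and D: "\<And>m. h m \<noteq> 0 \<Longrightarrow> norm (B m - A m) \<le> D" "D \<ge> 0"
    and null: "\<And>t N. 0 < t \<Longrightarrow> t < 1 \<Longrightarrow> N \<in> null_sets lborel \<Longrightarrow> AE m in M. h m \<noteq> 0 \<longrightarrow> A m + t *\<^sub>R (B m - A m) \<notin> N"
    and \<Omega>: "\<Omega> \<in> sets borel" "\<And>m t. h m \<noteq> 0 \<Longrightarrow> 0 \<le> t \<Longrightarrow> t \<le> 1 \<Longrightarrow> A m + t *\<^sub>R (B m - A m) \<notin> \<Omega>"
  obtains w :: "'a \<Rightarrow> 'a" where "integrable lborel w" "\<And>x. x \<in> \<Omega> \<Longrightarrow> w x = 0"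
    "(\<integral>x. norm (w x) \<partial>lborel) \<le> DIM('a) * D * (\<integral>m. \<bar>h m\<bar> \<partial>M)"
    "\<And>\<phi>. test_fun UNIV \<phi> \<Longrightarrow> (\<integral>m. h m * (\<phi> (B m) - \<phi> (A m)) \<partial>M) = pairing w \<phi>"
proof -
  interpret M: sigma_finite_measure M by fact
  interpret P: pair_sigma_finite "lborel :: real measure" M ..
  have hm[measurable]: "h \<in> borel_measurable M" using h by auto
  let ?P = "(lborel :: real measure) \<Otimes>\<^sub>M M"
  \<comment> \<open>The open interval matches the null set hypothesis; the two omitted times form a
    null set in \<open>t\<close>.\<close>
  define H where "H = (\<lambda>(t::real, m). (indicator {0<..<1} t * h m) *\<^sub>R (B m - A m))"
  define \<Psi> where "\<Psi> = (\<lambda>(t::real, m). A m + t *\<^sub>R (B m - A m))"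
  have H[measurable]: "H \<in> borel_measurable ?P" unfolding H_def by measurable
  have \<Psi>[measurable]: "\<Psi> \<in> ?P \<rightarrow>\<^sub>M borel" unfolding \<Psi>_def by measurable
  have nH: "norm (H (t, m)) \<le> indicator {0<..<1} t * (D * \<bar>h m\<bar>)" for t m
    using D(1)[of m] mult_left_mono[of "norm (B m - A m)" D "\<bar>h m\<bar>"]
    by (cases "h m = 0") (auto simp: H_def indicator_def mult.commute)
  have ibound: "integrable ?P (\<lambda>(t, m). indicator {0<..<1::real} t * (D * \<bar>h m\<bar>))"
  proof (rule P.Fubini_integrable)
    show "integrable lborel (\<lambda>t. \<integral>m. norm (case (t, m) of (t, m) \<Rightarrow> indicator {0<..<1::real} t * (D * \<bar>h m\<bar>)) \<partial>M)"
      using D(2) by (simp add: abs_mult)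
  qed (use h in auto)
  have iH: "integrable ?P H"
    by (rule Bochner_Integration.integrable_bound[OF ibound H])
       (use nH D(2) in \<open>auto simp: case_prod_beta' intro!: AE_I2 order_trans[OF nH]\<close>)
  have ival: "(\<integral>p. norm (H p) \<partial>?P) \<le> D * (\<integral>m. \<bar>h m\<bar> \<partial>M)"
  proof -
    have "(\<integral>p. norm (H p) \<partial>?P) \<le> (\<integral>p. (case p of (t, m) \<Rightarrow> indicator {0<..<1::real} t * (D * \<bar>h m\<bar>)) \<partial>?P)"
      by (rule integral_mono) (use iH ibound nH in auto)
    also have "\<dots> = (\<integral>t. (\<integral>m. indicator {0<..<1::real} t * (D * \<bar>h m\<bar>) \<partial>M) \<partial>lborel)"
      using P.integral_fst'[OF ibound] by (simp add: case_prod_beta')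
    also have "\<dots> = D * (\<integral>m. \<bar>h m\<bar> \<partial>M)"
      by simp
    finally show ?thesis .
  qed
  have nullP: "AE p in ?P. H p \<noteq> 0 \<longrightarrow> \<Psi> p \<notin> N" if N: "N \<in> null_sets lborel" for N
  proof -
    have [measurable]: "N \<in> sets borel" using N by auto
    \<comment> \<open>Absolute continuity of the image is checked for each time separately and
      assembled by Fubini, which needs the exceptional set to be measurable in the product.\<close>
    have "AE t in lborel. AE m in M. H (t, m) \<noteq> 0 \<longrightarrow> \<Psi> (t, m) \<notin> N"
    proof (rule AE_I2)
      fix t :: real
      show "AE m in M. H (t, m) \<noteq> 0 \<longrightarrow> \<Psi> (t, m) \<notin> N"
      proof (cases "0 < t \<and> t < 1")
        case True
        then have "AE m in M. h m \<noteq> 0 \<longrightarrow> A m + t *\<^sub>R (B m - A m) \<notin> N" using null N by auto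
        then show ?thesis by (rule AE_mp) (auto simp: H_def \<Psi>_def)
      qed (auto simp: H_def)
    qed
    moreover have "{p \<in> space ?P. H p \<noteq> 0 \<longrightarrow> \<Psi> p \<notin> N} \<in> sets ?P" by measurable
    ultimately show ?thesis by (rule P.AE_pair_measure[rotated])
  qed
  obtain w :: "'a \<Rightarrow> 'a" where w: "integrable lborel w" "\<And>x. x \<in> \<Omega> \<Longrightarrow> w x = 0"
    "(\<integral>x. norm (w x) \<partial>lborel) \<le> DIM('a) * (\<integral>p. norm (H p) \<partial>?P)"
    "\<And>(G :: 'a \<Rightarrow> 'a) B. G \<in> borel_measurable borel \<Longrightarrow> (\<And>x. norm (G x) \<le> B) \<Longrightarrow>
       (\<integral>p. H p \<bullet> G (\<Psi> p) \<partial>?P) = (\<integral>x. w x \<bullet> G x \<partial>lborel)"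
  proof (rule push_vector[OF iH \<Psi> nullP \<Omega>(1)])
    show "\<Psi> p \<notin> \<Omega>" if "H p \<noteq> 0" for p
      using that \<Omega>(2) by (cases p) (auto simp: H_def \<Psi>_def indicator_def split: if_splits)
  qed blast+
  have "(\<integral>x. norm (w x) \<partial>lborel) \<le> DIM('a) * D * (\<integral>m. \<bar>h m\<bar> \<partial>M)"
    using order_trans[OF w(3) mult_left_mono[OF ival, of "real DIM('a)"]] unfolding mult.assoc by simp
  moreover have "(\<integral>m. h m * (\<phi> (B m) - \<phi> (A m)) \<partial>M) = pairing w \<phi>" if \<phi>: "test_fun UNIV \<phi>" for \<phi>
  proof -
    note sm = test_funD(1)[OF \<phi>]
    have [measurable]: "grad \<phi> \<in> borel_measurable borel" using sm by (rule grad_measurable)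
    obtain C where C: "C \<ge> 0" "\<And>x. norm (grad \<phi> x) \<le> C" "\<And>x. \<bar>\<phi> x\<bar> \<le> C"
      by (rule test_fun_grad_bounded[OF \<phi>], rule that)
    have "integrable ?P (\<lambda>p. H p \<bullet> grad \<phi> (\<Psi> p))"
      by (rule integrable_inner_bounded_borel[OF iH _ C(2)]) auto
    then have i: "integrable ?P (\<lambda>(t, m). H (t, m) \<bullet> grad \<phi> (\<Psi> (t, m)))"
      by (simp add: case_prod_beta')
    have "pairing w \<phi> = (\<integral>p. H p \<bullet> grad \<phi> (\<Psi> p) \<partial>?P)"
      using w(4)[of "grad \<phi>" C] C(2) by simp
    also have "\<dots> = (\<integral>m. (\<integral>t. H (t, m) \<bullet> grad \<phi> (\<Psi> (t, m)) \<partial>lborel) \<partial>M)"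
      using P.integral_snd[OF i] by (simp add: case_prod_beta')
    also have "\<dots> = (\<integral>m. h m * (\<phi> (B m) - \<phi> (A m)) \<partial>M)"
    proof (rule Bochner_Integration.integral_cong[OF refl])
      fix m
      let ?c = "\<lambda>t. A m + t *\<^sub>R (B m - A m)"
      have FTC: "(\<integral>t. indicator {0..1} t *\<^sub>R (grad \<phi> (?c t) \<bullet> (B m - A m)) \<partial>lborel) = \<phi> (?c 1) - \<phi> (?c 0)"
      proof (rule integral_FTC_atLeastAtMost)
        fix t
        have "((\<phi> \<circ> ?c) has_derivative ((\<lambda>h. grad \<phi> (?c t) \<bullet> h) \<circ> (\<lambda>s. s *\<^sub>R (B m - A m)))) (at t within {0..1})"
          by (rule diff_chain_within)
             (auto intro!: derivative_eq_intros has_derivative_at_withinI[OF smooth_has_derivative[OF sm]])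
        then show "((\<lambda>t. \<phi> (?c t)) has_vector_derivative grad \<phi> (?c t) \<bullet> (B m - A m)) (at t within {0..1})"
          by (simp add: has_vector_derivative_def o_def)
      next
        have "continuous_on UNIV (\<lambda>t. grad \<phi> (?c t))"
          by (rule continuous_on_compose2[OF smooth_grad_continuous[OF sm, of UNIV]]) (auto intro!: continuous_intros)
        then show "continuous_on {0..1} (\<lambda>t. grad \<phi> (?c t) \<bullet> (B m - A m))"
          by (intro continuous_intros) (auto intro: continuous_on_subset)
      qed simp
      have "(\<integral>t. H (t, m) \<bullet> grad \<phi> (\<Psi> (t, m)) \<partial>lborel) = (\<integral>t. h m * (indicator {0..1} t *\<^sub>R (grad \<phi> (?c t) \<bullet> (B m - A m))) \<partial>lborel)"
      proof (rule integral_cong_AE)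
        have "AE t in lborel. t \<noteq> 0 \<and> t \<noteq> (1::real)"
          by (simp add: AE_lborel_singleton)
        then show "AE t in lborel. H (t, m) \<bullet> grad \<phi> (\<Psi> (t, m)) = h m * (indicator {0..1} t *\<^sub>R (grad \<phi> (?c t) \<bullet> (B m - A m)))"
          by eventually_elim (auto simp: H_def \<Psi>_def indicator_def inner_commute)
      qed (auto simp: H_def \<Psi>_def)
      also have "\<dots> = h m * (\<phi> (B m) - \<phi> (A m))" unfolding integral_mult_right_zero FTC by simp
      finally show "(\<integral>t. H (t, m) \<bullet> grad \<phi> (\<Psi> (t, m)) \<partial>lborel) = h m * (\<phi> (B m) - \<phi> (A m))" .
    qed
    finally show ?thesis by simp
  qed
  ultimately show ?thesis using that w by blast
qed

text \<open>For a translation the image density is explicit and keeps its norm. The pointwise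
  formula later shows that shifted fields vanish everywhere on \<open>\<Omega>\<close>, not merely
  almost everywhere.\<close>

lemma push_translate:
  fixes h :: "'a::euclidean_space \<Rightarrow> 'b::euclidean_space"
  assumes h: "integrable lborel h"
  shows "integrable lborel (\<lambda>z. h (z + v))" "(\<integral>z. norm (h (z + v)) \<partial>lborel) = (\<integral>x. norm (h x) \<partial>lborel)"
    "G \<in> borel_measurable borel \<Longrightarrow> (\<integral>x. h x \<bullet> G (x - v) \<partial>lborel) = (\<integral>z. h (z + v) \<bullet> G z \<partial>lborel)"
proof -
  have [measurable]: "h \<in> borel_measurable borel" using h by auto
  show "integrable lborel (\<lambda>z. h (z + v))"
    using lborel_integrable_affine[of 1 h v] h by (simp add: add.commute)
  show "(\<integral>z. norm (h (z + v)) \<partial>lborel) = (\<integral>x. norm (h x) \<partial>lborel)"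
    using lborel_integral_affine[of 1 "\<lambda>x. norm (h x)" v] by (simp add: add.commute)
  show "(\<integral>x. h x \<bullet> G (x - v) \<partial>lborel) = (\<integral>z. h (z + v) \<bullet> G z \<partial>lborel)" if [measurable]: "G \<in> borel_measurable borel"
    using lborel_integral_affine[of 1 "\<lambda>x. h x \<bullet> G (x - v)" v] by (simp add: add.commute)
qed

text \<open>Summable norms make the series converge absolutely at almost every point and allow
  termwise integration against a bounded \<open>G\<close>. On \<open>\<Omega>\<close> every term is
  zero, so the sum is zero there without exception.\<close>

lemma push_series:
  fixes w :: "nat \<Rightarrow> 'a::euclidean_space \<Rightarrow> 'a"
  assumes w: "\<And>k. integrable lborel (w k)" and s: "summable (\<lambda>k. \<integral>x. norm (w k x) \<partial>lborel)"
    and z: "\<And>k x. x \<in> \<Omega> \<Longrightarrow> w k x = 0"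
  obtains W where "integrable lborel W" "\<And>x. x \<in> \<Omega> \<Longrightarrow> W x = 0"
    "\<And>(G :: 'a \<Rightarrow> 'a) B. G \<in> borel_measurable borel \<Longrightarrow> (\<And>x. norm (G x) \<le> B) \<Longrightarrow>
       (\<lambda>k. \<integral>x. w k x \<bullet> G x \<partial>lborel) sums (\<integral>x. W x \<bullet> G x \<partial>lborel)"
proof -
  have [measurable]: "w k \<in> borel_measurable borel" for k using w[of k] by auto
  have "(\<integral>\<^sup>+x. (\<Sum>k. ennreal (norm (w k x))) \<partial>lborel) = (\<Sum>k. \<integral>\<^sup>+x. ennreal (norm (w k x)) \<partial>lborel)"
    by (rule nn_integral_suminf) auto
  also have "\<dots> = (\<Sum>k. ennreal (\<integral>x. norm (w k x) \<partial>lborel))"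
    using w by (subst nn_integral_eq_integral) auto
  also have "\<dots> = ennreal (\<Sum>k. \<integral>x. norm (w k x) \<partial>lborel)"
    by (rule suminf_ennreal2) (use s in auto)
  finally have "(\<integral>\<^sup>+x. (\<Sum>k. ennreal (norm (w k x))) \<partial>lborel) \<noteq> \<infinity>" by simp
  then have "AE x in lborel. (\<Sum>k. ennreal (norm (w k x))) \<noteq> \<infinity>"
    by (intro nn_integral_PInf_AE) auto
  then have AEs: "AE x in lborel. summable (\<lambda>k. norm (w k x))"
    by eventually_elim (rule summable_suminf_not_top, auto)
  define W where "W x = (\<Sum>k. w k x)" for x
  have iW: "integrable lborel W" unfolding W_def by (rule integrable_suminf[OF w AEs s])
  moreover have "W x = 0" if "x \<in> \<Omega>" for x using z[OF that] by (simp add: W_def)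
  moreover have "(\<lambda>k. \<integral>x. w k x \<bullet> G x \<partial>lborel) sums (\<integral>x. W x \<bullet> G x \<partial>lborel)"
    if G[measurable]: "G \<in> borel_measurable borel" and B: "\<And>x. norm (G x) \<le> B" for G B
  proof -
    have i: "integrable lborel (\<lambda>x. w k x \<bullet> G x)" for k
      by (rule integrable_inner_bounded_borel[OF w _ B]) auto
    have le: "norm (w k x \<bullet> G x) \<le> B * norm (w k x)" for k x
      using Cauchy_Schwarz_ineq2[of "w k x" "G x"] mult_left_mono[OF B[of x], of "norm (w k x)"]
      by (simp add: mult.commute)
    have AEs': "AE x in lborel. summable (\<lambda>k. norm (w k x \<bullet> G x))"
      using AEs
    proof eventually_elim
      case (elim x)
      show ?case by (rule summable_comparison_test'[of "\<lambda>k. B * norm (w k x)" 0])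
         (use elim le in \<open>auto intro: summable_mult\<close>)
    qed
    have s': "summable (\<lambda>k. \<integral>x. norm (w k x \<bullet> G x) \<partial>lborel)"
    proof (rule summable_comparison_test'[of "\<lambda>k. B * (\<integral>x. norm (w k x) \<partial>lborel)" 0])
      show "summable (\<lambda>k. B * (\<integral>x. norm (w k x) \<partial>lborel))" using s by (rule summable_mult)
      fix k
      have "(\<integral>x. norm (w k x \<bullet> G x) \<partial>lborel) \<le> (\<integral>x. B * norm (w k x) \<partial>lborel)"
        by (rule integral_mono) (use i w le in auto)
      then show "norm (\<integral>x. norm (w k x \<bullet> G x) \<partial>lborel) \<le> B * (\<integral>x. norm (w k x) \<partial>lborel)"
        by simp
    qed
    have "(\<lambda>k. \<integral>x. w k x \<bullet> G x \<partial>lborel) sums (\<integral>x. (\<Sum>k. w k x \<bullet> G x) \<partial>lborel)"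
      by (rule sums_integral[OF i AEs' s'])
    also have "(\<integral>x. (\<Sum>k. w k x \<bullet> G x) \<partial>lborel) = (\<integral>x. W x \<bullet> G x \<partial>lborel)"
    proof (rule integral_cong_AE)
      show "AE x in lborel. (\<Sum>k. w k x \<bullet> G x) = W x \<bullet> G x"
        using AEs
      proof eventually_elim
        case (elim x)
        then show ?case unfolding W_def
          by (rule bounded_linear.suminf[OF bounded_linear_inner_left summable_norm_cancel, symmetric])
      qed
    qed (use iW in auto)
    finally show ?thesis .
  qed
  ultimately show ?thesis using that by blast
qed

section \<open>Mollification\<close>

text \<open>The classical flat function \<open>exp (- 1 / t)\<close> together with its multiples by
  powers of \<open>1 / t\<close>. The extra index makes the family closed under differentiation up
  to linear combinations.\<close>

definition bump1 :: "nat \<Rightarrow> real \<Rightarrow> real" where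
  "bump1 m t = (if t > 0 then exp (- inverse t) * inverse t ^ m else 0)"

lemma power_div_fact_le_exp:
  assumes "(s::real) \<ge> 0" shows "s ^ n / fact n \<le> exp s"
proof -
  have "s ^ n / fact n = (\<Sum>k\<in>{n}. s ^ k /\<^sub>R fact k)" by (simp add: divide_inverse mult.commute)
  also have "\<dots> \<le> (\<Sum>k. s ^ k /\<^sub>R fact k)"
    by (rule sum_le_suminf) (use assms summable_exp_generic[of s] in auto)
  finally show ?thesis by (simp add: exp_def)
qed

text \<open>One term of the exponential series at \<open>inverse t\<close> beats
  \<open>inverse t ^ (m + 2)\<close>. The two surplus powers of \<open>t\<close> make the difference
  quotient at 0 tend to 0, for every \<open>m\<close> at once.\<close>

lemma bump1_le: "\<bar>bump1 m t\<bar> \<le> fact (m + 2) * t\<^sup>2"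
proof (cases "t > 0")
  case True
  have "inverse t ^ (m + 2) \<le> fact (m + 2) * exp (inverse t)"
    using power_div_fact_le_exp[of "inverse t" "m + 2"] True
    by (simp only: pos_divide_le_eq fact_gt_zero mult.commute) simp
  then have "exp (- inverse t) * (inverse t ^ (m + 2)) \<le> exp (- inverse t) * (fact (m + 2) * exp (inverse t))"
    by (rule mult_left_mono) simp
  also have "\<dots> = fact (m + 2)" by (simp add: exp_minus field_simps)
  finally have *: "exp (- inverse t) * inverse t ^ (m + 2) \<le> fact (m + 2)" .
  have "bump1 m t = exp (- inverse t) * inverse t ^ (m + 2) * t\<^sup>2"
    using True by (simp add: bump1_def power_add power2_eq_square field_simps)
  also have "\<dots> \<le> fact (m + 2) * t\<^sup>2" using * by (rule mult_right_mono) simp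
  finally show ?thesis using True by (simp add: bump1_def)
qed (simp add: bump1_def)

lemma bump1_deriv: "(bump1 m has_real_derivative (bump1 (m + 2) t - real m * bump1 (m + 1) t)) (at t)"
proof -
  consider "t > 0" | "t < 0" | "t = 0" by linarith
  then show ?thesis
  proof cases
    case 1
    have "((\<lambda>t. inverse t ^ m) has_real_derivative - real m * inverse t ^ (m + 1)) (at t)"
    proof (cases m)
      case (Suc k)
      show ?thesis unfolding Suc
        by (rule DERIV_cong[OF DERIV_power_Suc[OF DERIV_inverse]]) (use 1 in \<open>auto simp: algebra_simps\<close>)
    qed simp
    note p = this
    have "((\<lambda>t. exp (- inverse t)) has_real_derivative exp (- inverse t) * inverse t ^ 2) (at t)"
      using 1 by (auto intro!: derivative_eq_intros simp: power2_eq_square)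
    from DERIV_mult[OF this p] have "((\<lambda>t. exp (- inverse t) * inverse t ^ m) has_real_derivative (bump1 (m + 2) t - real m * bump1 (m + 1) t)) (at t)"
      by (rule DERIV_cong) (use 1 in \<open>auto simp: bump1_def power_add power2_eq_square algebra_simps\<close>)
    then show ?thesis
    proof (rule has_field_derivative_transform_within_open[where S = "{0<..}"])
    qed (use 1 in \<open>auto simp: bump1_def\<close>)
  next
    case 2
    have "((\<lambda>t. 0) has_real_derivative (bump1 (m + 2) t - real m * bump1 (m + 1) t)) (at t)"
      using 2 by (simp add: bump1_def)
    then show ?thesis
    proof (rule has_field_derivative_transform_within_open[where S = "{..<0}"])
    qed (use 2 in \<open>auto simp: bump1_def\<close>)
  next
    case 3
    have "((\<lambda>h. (bump1 m (0 + h) - bump1 m 0) / h) \<longlongrightarrow> 0) (at 0)"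
    proof (rule tendsto_norm_zero_cancel, rule Lim_null_comparison)
      show "\<forall>\<^sub>F h in at 0. norm (norm ((bump1 m (0 + h) - bump1 m 0) / h)) \<le> fact (m + 2) * \<bar>h\<bar>"
        unfolding eventually_at_filter
      proof (intro always_eventually allI impI)
        fix h :: real assume "h \<noteq> 0"
        have "norm (norm ((bump1 m (0 + h) - bump1 m 0) / h)) = \<bar>bump1 m h\<bar> / \<bar>h\<bar>"
          by (simp add: bump1_def)
        also have "\<dots> \<le> fact (m + 2) * h\<^sup>2 / \<bar>h\<bar>" by (intro divide_right_mono bump1_le) simp
        also have "\<dots> = fact (m + 2) * \<bar>h\<bar>"
        proof -
          have "c * h\<^sup>2 / \<bar>h\<bar> = c * \<bar>h\<bar>" for c :: real
            using \<open>h \<noteq> 0\<close> by (simp add: power2_eq_square abs_if)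
          then show ?thesis .
        qed
        finally show "norm (norm ((bump1 m (0 + h) - bump1 m 0) / h)) \<le> fact (m + 2) * \<bar>h\<bar>" .
      qed
      show "((\<lambda>h::real. fact (m + 2) * \<bar>h\<bar>) \<longlongrightarrow> 0) (at 0)"
        by (rule tendsto_eq_intros refl | simp)+
    qed
    then show ?thesis using 3 by (simp add: DERIV_def bump1_def)
  qed
qed

text \<open>Stable set for \<open>bump\<close>: differentiating
  \<open>bump1 m (1 - x \<bullet> x)\<close> raises the index by one or two and produces polynomial
  factors, which the smooth coefficient \<open>g\<close> absorbs.\<close>

inductive_set bumps :: "('a::euclidean_space \<Rightarrow> real) set" where
  bumps_mult: "smooth g \<Longrightarrow> (\<lambda>x. g x * bump1 m (1 - x \<bullet> x)) \<in> bumps"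
| bumps_add: "f \<in> bumps \<Longrightarrow> g \<in> bumps \<Longrightarrow> (\<lambda>x. f x + g x) \<in> bumps"

definition bump :: "'a::euclidean_space \<Rightarrow> real" where
  "bump x = bump1 0 (1 - x \<bullet> x)"

lemma smooth_bump: "smooth (bump :: 'a::euclidean_space \<Rightarrow> real)"
proof (rule smooth_coinduct[of _ bumps])
  show "bump \<in> bumps" using bumps_mult[of "\<lambda>_. 1" 0] by (simp add: bump_def[abs_def])
next
  have D: "((\<lambda>x. g x * bump1 m (1 - x \<bullet> x)) has_derivative
     (\<lambda>h. (grad g x \<bullet> h) * bump1 m (1 - x \<bullet> x) + (-2 * (x \<bullet> h) * g x) * bump1 (m + 2) (1 - x \<bullet> x)
        + (2 * real m * (x \<bullet> h) * g x) * bump1 (m + 1) (1 - x \<bullet> x))) (at x)"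
    if "smooth g" for g m and x :: 'a
  proof -
    have "((bump1 m \<circ> (\<lambda>x. 1 - x \<bullet> x)) has_derivative
       ((*) (bump1 (m + 2) (1 - x \<bullet> x) - real m * bump1 (m + 1) (1 - x \<bullet> x)) \<circ> (\<lambda>h. - 2 * (x \<bullet> h)))) (at x)"
    proof (rule diff_chain_at)
      show "(bump1 m has_derivative (*) (bump1 (m + 2) (1 - x \<bullet> x) - real m * bump1 (m + 1) (1 - x \<bullet> x))) (at (1 - x \<bullet> x))"
        using bump1_deriv[of m "1 - x \<bullet> x"] unfolding has_field_derivative_def .
    qed (auto intro!: derivative_eq_intros simp: inner_commute)
    then have "((\<lambda>x. bump1 m (1 - x \<bullet> x)) has_derivative
       (\<lambda>h. (bump1 (m + 2) (1 - x \<bullet> x) - real m * bump1 (m + 1) (1 - x \<bullet> x)) * (- 2 * (x \<bullet> h)))) (at x)"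
      by (simp only: o_def)
    from has_derivative_mult[OF smooth_has_derivative[OF that, of x] this] show ?thesis
      by (rule has_derivative_eq_rhs) (auto simp: algebra_simps)
  qed
  show diff: "h differentiable (at x)" if "h \<in> bumps" for h and x :: 'a
    using that
  proof induction
    case (bumps_mult g m)
    show ?case by (rule differentiableI[OF D[OF bumps_mult]])
  qed (rule differentiable_add)
  fix h :: "'a \<Rightarrow> real" and v :: 'a assume "h \<in> bumps" and v: "v \<in> Basis"
  from this(1) show "(\<lambda>x. frechet_derivative h (at x) v) \<in> bumps"
  proof induction
    case (bumps_mult g m)
    show ?case
      unfolding pd_eqI[OF D[OF bumps_mult]]
    proof (intro bumps.intros)
      show "smooth (\<lambda>x. grad g x \<bullet> v)"
        using smooth_pd[OF bumps_mult v] by (simp add: pd_grad[OF bumps_mult])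
    qed (intro smooth_mult smooth_const smooth_inner bumps_mult)+
  next
    case (bumps_add f g)
    have "frechet_derivative (\<lambda>x. f x + g x) (at x) v =
        frechet_derivative f (at x) v + frechet_derivative g (at x) v" for x
      by (rule pd_eqI) (intro has_derivative_add frechet_derivative_works[THEN iffD1] diff bumps_add)
    then show ?case
      using bumps_add by (auto intro!: bumps.intros)
  qed
qed

lemma bump_nonneg: "bump x \<ge> 0" and bump_pos: "norm x < 1 \<Longrightarrow> bump x > 0"
  and bump_zero: "norm x \<ge> 1 \<Longrightarrow> bump x = 0"
proof -
  show "bump x \<ge> 0" by (simp add: bump_def bump1_def)
  have "x \<bullet> x < 1 \<longleftrightarrow> norm x < 1"
    by (simp add: dot_square_norm power_less_one_iff)
  then show "norm x < 1 \<Longrightarrow> bump x > 0" "norm x \<ge> 1 \<Longrightarrow> bump x = 0"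
    by (auto simp: bump_def bump1_def)
qed

lemma integrable_continuous_compact_support:
  fixes f :: "'a::euclidean_space \<Rightarrow> 'b::{banach, second_countable_topology}"
  assumes "continuous_on UNIV f" "compact K" "\<And>x. x \<notin> K \<Longrightarrow> f x = 0"
  shows "integrable lborel f"
proof -
  have "integrable lborel (\<lambda>x. indicator K x *\<^sub>R f x)"
    using assms(1,2) by (intro borel_integrable_compact) (auto intro: continuous_on_subset)
  also have "(\<lambda>x. indicator K x *\<^sub>R f x) = f" using assms(3) by (auto simp: indicator_def fun_eq_iff)
  finally show ?thesis .
qed

lemma bump_integrable: "integrable lborel (bump :: 'a::euclidean_space \<Rightarrow> real)"
  by (rule integrable_continuous_compact_support[of _ "cball 0 1"])
     (use smooth_continuous[OF smooth_bump] in \<open>auto intro: bump_zero\<close>)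

lemma bump_integral_pos: "(\<integral>x. bump (x :: 'a::euclidean_space) \<partial>lborel) > 0"
proof -
  have "(\<integral>x. bump (x :: 'a) \<partial>lborel) \<noteq> 0"
  proof
    assume "(\<integral>x. bump (x :: 'a) \<partial>lborel) = 0"
    then have "AE x in lborel. bump (x :: 'a) = 0"
      using integral_nonneg_eq_0_iff_AE[OF bump_integrable] bump_nonneg by auto
    then have "AE x in lborel. x \<notin> ball (0 :: 'a) 1"
      by eventually_elim (use bump_pos in \<open>auto simp: less_le\<close>)
    then have "emeasure lborel (ball (0 :: 'a) 1) = 0"
      by (subst (asm) AE_iff_measurable[of "ball 0 1"]) auto
    then show False using content_ball_pos[of 1 "0 :: 'a"] by (simp add: measure_def)
  qed
  moreover have "(\<integral>x. bump (x :: 'a) \<partial>lborel) \<ge> 0" by (simp add: bump_nonneg)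
  ultimately show ?thesis by linarith
qed

section \<open>Convolution with smooth kernels of bounded support\<close>

inductive_set convs :: "('a::euclidean_space \<Rightarrow> real) \<Rightarrow> ('a \<Rightarrow> real) set" for g where
  convs: "smooth k \<Longrightarrow> (\<And>x. norm x > 1 \<Longrightarrow> k x = 0) \<Longrightarrow> (\<lambda>x. \<integral>y. k (x - y) * g y \<partial>lborel) \<in> convs g"

text \<open>Derivatives fall on the kernel, and a derivative of a kernel supported in the unit ball
  is again such a kernel. So the convolutions with a fixed continuous \<open>g\<close> form a stable
  set.\<close>

lemma smooth_conv:
  fixes g k :: "'a::euclidean_space \<Rightarrow> real"
  assumes g: "continuous_on UNIV g" and k: "smooth k" "\<And>x. norm x > 1 \<Longrightarrow> k x = 0"
  shows "smooth (\<lambda>x. \<integral>y. k (x - y) * g y \<partial>lborel)"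
proof (rule smooth_coinduct[of _ "convs g"])
  show "(\<lambda>x. \<integral>y. k (x - y) * g y \<partial>lborel) \<in> convs g" using k by (rule convs)
next
  have D: "((\<lambda>x. \<integral>y. k (x - y) * g y \<partial>lborel) has_derivative
     blinfun_apply (integral (cbox (x0 - 2 *\<^sub>R One) (x0 + 2 *\<^sub>R One)) (\<lambda>y. g y *\<^sub>R blinfun_inner_right (grad k (x0 - y))))) (at x0)"
    "frechet_derivative (\<lambda>x. \<integral>y. k (x - y) * g y \<partial>lborel) (at x0) v = (\<integral>y. (grad k (x0 - y) \<bullet> v) * g y \<partial>lborel)"
    if k: "smooth k" "\<And>x. norm x > 1 \<Longrightarrow> k x = 0" for k :: "'a \<Rightarrow> real" and x0 v
  proof -
    \<comment> \<open>For \<open>x\<close> within distance 1 of \<open>x0\<close> the kernel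
      \<open>k (x - y)\<close> vanishes unless \<open>y\<close> is within distance 2 of
      \<open>x0\<close>. A box containing that ball gives a domain of integration independent of
      \<open>x\<close>, as differentiation under the integral requires.\<close>
    let ?B = "cbox (x0 - 2 *\<^sub>R One) (x0 + 2 *\<^sub>R One)"
    have inB: "y \<in> ?B" if "norm (y - x0) \<le> 2" for y
      unfolding mem_box
    proof
      fix i :: 'a assume "i \<in> Basis"
      then have "\<bar>(y - x0) \<bullet> i\<bar> \<le> 2" using that Basis_le_norm by (meson order_trans)
      then show "(x0 - 2 *\<^sub>R One) \<bullet> i \<le> y \<bullet> i \<and> y \<bullet> i \<le> (x0 + 2 *\<^sub>R One) \<bullet> i"
        using \<open>i \<in> Basis\<close> by (auto simp: inner_diff_left inner_add_left)
    qed
    have conv: "(\<integral>y. q (x - y) * g y \<partial>lborel) = integral ?B (\<lambda>y. q (x - y) * g y)"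
      if q: "continuous_on UNIV q" "\<And>x. norm x > 1 \<Longrightarrow> q x = 0" and x: "dist x0 x < 1" for q x
    proof -
      have c: "continuous_on S (\<lambda>y. q (x - y) * g y)" for S
        by (intro continuous_intros continuous_on_compose2[OF q(1)] continuous_on_subset[OF g]) auto
      have "y \<in> ?B" if "q (x - y) \<noteq> 0" for y
      proof -
        have "norm (x - y) \<le> 1" using q(2)[of "x - y"] that by force
        then have "dist y x0 \<le> 2" using x dist_triangle[of y x0 x] by (simp add: dist_norm norm_minus_commute)
        then show ?thesis by (intro inB) (simp add: dist_norm)
      qed
      then have eq: "(\<lambda>y. q (x - y) * g y) = (\<lambda>y. indicator ?B y *\<^sub>R (q (x - y) * g y))"
        by (force simp: fun_eq_iff indicator_def)
      have "set_integrable lborel ?B (\<lambda>y. q (x - y) * g y)"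
        unfolding set_integrable_def by (rule borel_integrable_compact[OF compact_cbox c])
      from set_borel_integral_eq_integral(2)[OF this] show ?thesis
        unfolding set_lebesgue_integral_def eq[symmetric] .
    qed
    have ck: "continuous_on UNIV k" using k(1) by (rule smooth_continuous)
    have cg: "continuous_on S (grad k)" for S using k(1) by (rule smooth_grad_continuous)
    have g0: "grad k x = 0" if "norm x > 1" for x
    proof (rule grad_const_on[of "{x. norm x > 1}"])
      show "open {x :: 'a. norm x > 1}" by (intro open_Collect_less continuous_intros)
    qed (use that k(2) in auto)
    have "((\<lambda>x. integral ?B (\<lambda>y. k (x - y) * g y)) has_derivative
       integral ?B (\<lambda>y. g y *\<^sub>R blinfun_inner_right (grad k (x0 - y)))) (at x0 within ball x0 1)"
    proof (rule leibniz_rule)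
      fix x t
      have "((k \<circ> (\<lambda>x. x - t)) has_derivative ((\<lambda>h. grad k (x - t) \<bullet> h) \<circ> (\<lambda>h. h))) (at x within ball x0 1)"
        by (rule diff_chain_within)
           (auto intro!: derivative_eq_intros has_derivative_at_withinI[OF smooth_has_derivative[OF k(1)]])
      then have "((\<lambda>x. k (x - t)) has_derivative (\<lambda>h. grad k (x - t) \<bullet> h)) (at x within ball x0 1)"
        by (simp add: o_def)
      from has_derivative_mult_left[OF this, of "g t"]
      show "((\<lambda>x. k (x - t) * g t) has_derivative blinfun_apply (g t *\<^sub>R blinfun_inner_right (grad k (x - t)))) (at x within ball x0 1)"
        by (rule has_derivative_eq_rhs) (auto simp: scaleR_blinfun.rep_eq mult.commute)
    next
      fix x
      show "(\<lambda>y. k (x - y) * g y) integrable_on ?B"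
        by (intro integrable_continuous continuous_intros continuous_on_compose2[OF ck] continuous_on_subset[OF g]) auto
    next
      have "continuous_on UNIV (\<lambda>(x, t). g t *\<^sub>R blinfun_inner_right (grad k (x - t)))"
        unfolding case_prod_beta'
        by (intro continuous_intros continuous_on_compose2[OF g] continuous_on_compose2[OF cg[of UNIV]]
              bounded_linear.continuous_on[OF bounded_linear_blinfun_inner_right]) auto
      then show "continuous_on (ball x0 1 \<times> ?B) (\<lambda>(x, t). g t *\<^sub>R blinfun_inner_right (grad k (x - t)))"
        by (rule continuous_on_subset) auto
    qed auto
    then have "((\<lambda>x. integral ?B (\<lambda>y. k (x - y) * g y)) has_derivative
       integral ?B (\<lambda>y. g y *\<^sub>R blinfun_inner_right (grad k (x0 - y)))) (at x0)"
      by (simp add: at_within_open[of x0 "ball x0 1"])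
    then show D: "((\<lambda>x. \<integral>y. k (x - y) * g y \<partial>lborel) has_derivative
       blinfun_apply (integral ?B (\<lambda>y. g y *\<^sub>R blinfun_inner_right (grad k (x0 - y))))) (at x0)"
      by (rule has_derivative_transform_within_open[where s = "ball x0 1"]) (use conv[OF ck k(2)] in auto)
    have "continuous_on ?B (\<lambda>y. g y *\<^sub>R blinfun_inner_right (grad k (x0 - y)))"
      by (intro continuous_intros continuous_on_compose2[OF g] continuous_on_compose2[OF cg[of UNIV]]
              bounded_linear.continuous_on[OF bounded_linear_blinfun_inner_right]) auto
    then have "(\<lambda>y. g y *\<^sub>R blinfun_inner_right (grad k (x0 - y))) integrable_on ?B"
      by (rule integrable_continuous)
    then have "frechet_derivative (\<lambda>x. \<integral>y. k (x - y) * g y \<partial>lborel) (at x0) v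
      = integral ?B (\<lambda>y. (grad k (x0 - y) \<bullet> v) * g y)"
      unfolding pd_eqI[OF D] by (subst blinfun_apply_integral) (auto simp: scaleR_blinfun.rep_eq mult.commute)
    also have "\<dots> = (\<integral>y. (grad k (x0 - y) \<bullet> v) * g y \<partial>lborel)"
      by (rule conv[symmetric, of "\<lambda>x. grad k x \<bullet> v"]) (use g0 cg in \<open>auto intro!: continuous_intros\<close>)
    finally show "frechet_derivative (\<lambda>x. \<integral>y. k (x - y) * g y \<partial>lborel) (at x0) v = (\<integral>y. (grad k (x0 - y) \<bullet> v) * g y \<partial>lborel)" .
  qed
  show "h differentiable (at x)" if "h \<in> convs g" for h and x :: 'a
    using that by cases (simp only:, rule differentiableI, rule D(1))
  fix h :: "'a \<Rightarrow> real" and v :: 'a assume "h \<in> convs g" and v: "v \<in> Basis"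
  from this(1) show "(\<lambda>x. frechet_derivative h (at x) v) \<in> convs g"
  proof cases
    case (convs k)
    have "(\<lambda>x. frechet_derivative h (at x) v) = (\<lambda>x. \<integral>y. (\<lambda>z. frechet_derivative k (at z) v) (x - y) * g y \<partial>lborel)"
      proof
      fix x show "frechet_derivative h (at x) v = (\<integral>y. (\<lambda>z. frechet_derivative k (at z) v) (x - y) * g y \<partial>lborel)"
        unfolding convs(1) using D(2)[OF convs(2,3), of x v] by (simp add: pd_grad[OF convs(2)])
    qed
    also have "\<dots> \<in> convs g"
    proof (rule convs.convs[OF smooth_pd[OF convs(2) v]])
      fix x :: 'a assume "norm x > 1"
      have "grad k x = 0"
      proof (rule grad_const_on[of "{x. norm x > 1}"])
        show "open {x :: 'a. norm x > 1}" by (intro open_Collect_less continuous_intros)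
      qed (use convs(3) \<open>norm x > 1\<close> in auto)
      then show "frechet_derivative k (at x) v = 0" by (simp add: pd_grad[OF convs(2)])
    qed
    finally show ?thesis .
  qed
qed

text \<open>A convex average of translates keeps the Lipschitz constant and the bounds, and
  reproduces constants on which \<open>f\<close> is locally constant at scale
  \<open>\<epsilon>\<close>. All cutoffs below are clamped Lipschitz functions passed through this
  lemma.\<close>

lemma mollify:
  fixes f :: "'a::euclidean_space \<Rightarrow> real"
  assumes L: "L-lipschitz_on UNIV f" and e: "\<epsilon> > 0" and ab: "\<And>x. a \<le> f x" "\<And>x. f x \<le> b"
  obtains F where "smooth F" "L-lipschitz_on UNIV F" "\<And>x. a \<le> F x" "\<And>x. F x \<le> b"
    "\<And>x c. (\<And>y. y \<in> cball x \<epsilon> \<Longrightarrow> f y = c) \<Longrightarrow> F x = c"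
proof -
  define Z where "Z = (\<integral>x. bump (x :: 'a) \<partial>lborel)"
  have Z: "Z > 0" unfolding Z_def by (rule bump_integral_pos)
  define F where "F x = (1 / Z) * (\<integral>y. bump (y :: 'a) * f (x - \<epsilon> *\<^sub>R y) \<partial>lborel)" for x
  have cf: "continuous_on S f" for S
    using lipschitz_on_continuous_on[OF L] continuous_on_subset by blast
  have cb: "continuous_on S (bump :: 'a \<Rightarrow> real)" for S by (rule smooth_continuous[OF smooth_bump])
  have i: "integrable lborel (\<lambda>y. bump y * f (x - \<epsilon> *\<^sub>R y))" for x
    by (rule integrable_continuous_compact_support[of _ "cball 0 1"])
       (auto intro!: bump_zero continuous_intros cb continuous_on_compose2[OF cf[of UNIV]])
  have ic: "integrable lborel (\<lambda>y::'a. bump y * c)" for c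
    using bump_integrable[where 'a = 'a] by simp
  have Fc: "(1 / Z) * (\<integral>y. bump (y::'a) * c \<partial>lborel) = c" for c
    using Z by (simp add: Z_def)
  have "smooth F"
  proof -
    \<comment> \<open>In \<open>F\<close> the point \<open>x\<close> occurs inside the merely
      Lipschitz \<open>f\<close>. After rescaling by \<open>\<epsilon>\<close> and a reflection it
      occurs inside \<open>bump\<close>, where differentiation is possible.\<close>
    have "smooth (\<lambda>x. \<integral>y. bump (x - y) * f (\<epsilon> *\<^sub>R y) \<partial>lborel)"
      by (rule smooth_conv[OF _ smooth_bump])
         (auto intro!: bump_zero continuous_intros continuous_on_compose2[OF cf[of UNIV]])
    from smooth_cmult[OF smooth_affine[OF this, of "1 / \<epsilon>" 0], of "1 / Z"]
    have "smooth (\<lambda>x. (1 / Z) * (\<integral>y. bump ((1 / \<epsilon>) *\<^sub>R x - y) * f (\<epsilon> *\<^sub>R y) \<partial>lborel))" by simp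
    also have "(\<lambda>x. (1 / Z) * (\<integral>y. bump ((1 / \<epsilon>) *\<^sub>R x - y) * f (\<epsilon> *\<^sub>R y) \<partial>lborel)) = F"
    proof
      fix x
      have m: "(\<lambda>y. bump ((1 / \<epsilon>) *\<^sub>R x - y) * f (\<epsilon> *\<^sub>R y)) \<in> borel_measurable borel"
        by (intro borel_measurable_continuous_onI continuous_intros continuous_on_compose2[OF cf[of UNIV]]
              continuous_on_compose2[OF cb[of UNIV]]) auto
      show "(1 / Z) * (\<integral>y. bump ((1 / \<epsilon>) *\<^sub>R x - y) * f (\<epsilon> *\<^sub>R y) \<partial>lborel) = F x"
        using lborel_integral_affine[OF _ m, of "-1" "(1 / \<epsilon>) *\<^sub>R x"] e
        by (simp add: F_def scaleR_diff_right)
    qed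
    finally show ?thesis .
  qed
  moreover have "L-lipschitz_on UNIV F"
  proof (rule lipschitz_onI)
    fix x x' :: 'a
    have "dist (F x) (F x') = (1 / Z) * \<bar>\<integral>y. bump y * f (x - \<epsilon> *\<^sub>R y) - bump y * f (x' - \<epsilon> *\<^sub>R y) \<partial>lborel\<bar>"
    proof -
      have "F x - F x' = (1 / Z) * (\<integral>y. bump y * f (x - \<epsilon> *\<^sub>R y) - bump y * f (x' - \<epsilon> *\<^sub>R y) \<partial>lborel)"
        unfolding F_def by (subst Bochner_Integration.integral_diff[OF i i]) (rule right_diff_distrib[symmetric])
      then show ?thesis using Z by (simp only: dist_real_def abs_mult) simp
    qed
    also have "\<dots> \<le> (1 / Z) * (\<integral>y. bump (y::'a) * (L * dist x x') \<partial>lborel)"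
    proof (intro mult_left_mono)
      have "\<bar>\<integral>y. bump y * f (x - \<epsilon> *\<^sub>R y) - bump y * f (x' - \<epsilon> *\<^sub>R y) \<partial>lborel\<bar>
         \<le> (\<integral>y. \<bar>bump y * f (x - \<epsilon> *\<^sub>R y) - bump y * f (x' - \<epsilon> *\<^sub>R y)\<bar> \<partial>lborel)"
        by (rule integral_abs_bound)
      also have "\<dots> \<le> (\<integral>y. bump (y::'a) * (L * dist x x') \<partial>lborel)"
      proof (rule integral_mono[OF _ ic])
        fix y :: 'a
        have "\<bar>f (x - \<epsilon> *\<^sub>R y) - f (x' - \<epsilon> *\<^sub>R y)\<bar> \<le> L * dist x x'"
          using lipschitz_onD[OF L, of "x - \<epsilon> *\<^sub>R y" "x' - \<epsilon> *\<^sub>R y"] by (simp add: dist_norm)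
        then show "\<bar>bump y * f (x - \<epsilon> *\<^sub>R y) - bump y * f (x' - \<epsilon> *\<^sub>R y)\<bar> \<le> bump y * (L * dist x x')"
          using bump_nonneg[of y] by (simp add: abs_mult mult_left_mono flip: right_diff_distrib)
      qed (use i in auto)
      finally show "\<bar>\<integral>y. bump y * f (x - \<epsilon> *\<^sub>R y) - bump y * f (x' - \<epsilon> *\<^sub>R y) \<partial>lborel\<bar> \<le> (\<integral>y. bump (y::'a) * (L * dist x x') \<partial>lborel)" .
    qed (use Z in auto)
    finally show "dist (F x) (F x') \<le> L * dist x x'" unfolding Fc .
  qed (rule lipschitz_on_nonneg[OF L])
  moreover have "a \<le> F x" for x
  proof -
    have "(1 / Z) * (\<integral>y. bump (y::'a) * a \<partial>lborel) \<le> F x"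
      unfolding F_def using Z i ic ab bump_nonneg by (intro mult_left_mono integral_mono) auto
    then show ?thesis unfolding Fc .
  qed
  moreover have "F x \<le> b" for x
  proof -
    have "F x \<le> (1 / Z) * (\<integral>y. bump (y::'a) * b \<partial>lborel)"
      unfolding F_def using Z i ic ab bump_nonneg by (intro mult_left_mono integral_mono) auto
    then show ?thesis unfolding Fc .
  qed
  moreover have "F x = c" if "\<And>y. y \<in> cball x \<epsilon> \<Longrightarrow> f y = c" for x c
  proof -
    have "bump y * f (x - \<epsilon> *\<^sub>R y) = bump y * c" for y
    proof (cases "norm y < 1")
      case True
      then have "x - \<epsilon> *\<^sub>R y \<in> cball x \<epsilon>" using e by (simp add: dist_norm)
      then show ?thesis using that by simp
    qed (simp add: bump_zero)
    then have "F x = (1 / Z) * (\<integral>y. bump (y::'a) * c \<partial>lborel)" by (simp only: F_def)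
    then show ?thesis unfolding Fc .
  qed
  ultimately show ?thesis using that by blast
qed

text \<open>Differentiating in the direction \<open>v = grad F x\<close> itself gives
  \<open>v \<bullet> v \<le> L * norm v\<close>.\<close>

lemma grad_lipschitz_bound:
  assumes "L-lipschitz_on UNIV F" "smooth F" shows "norm (grad F x) \<le> L"
proof (rule ccontr)
  assume "\<not> norm (grad F x) \<le> L"
  have L0: "L \<ge> 0" using lipschitz_on_nonneg[OF assms(1)] .
  define v where "v = grad F x"
  have d: "((\<lambda>t. F (x + t *\<^sub>R v)) has_real_derivative (v \<bullet> v)) (at 0)"
  proof -
    have "((F \<circ> (\<lambda>t::real. x + t *\<^sub>R v)) has_derivative ((\<lambda>h. grad F (x + 0 *\<^sub>R v) \<bullet> h) \<circ> (\<lambda>t. t *\<^sub>R v))) (at 0)"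
      by (rule diff_chain_at) (auto intro!: derivative_eq_intros smooth_has_derivative[OF assms(2)])
    then show ?thesis by (simp add: o_def has_field_derivative_def v_def mult.commute[of _ "_ \<bullet> _"])
  qed
  then have "((\<lambda>h. \<bar>(F (x + h *\<^sub>R v) - F x) / h\<bar>) \<longlongrightarrow> \<bar>v \<bullet> v\<bar>) (at 0)"
    by (intro tendsto_rabs) (simp add: DERIV_def)
  moreover have "\<bar>(F (x + h *\<^sub>R v) - F x) / h\<bar> \<le> L * norm v" if "h \<noteq> 0" for h
    using lipschitz_onD[OF assms(1), of "x + h *\<^sub>R v" x] that
    by (simp add: dist_norm field_simps abs_mult)
  ultimately have "\<bar>v \<bullet> v\<bar> \<le> L * norm v"
    by (intro tendsto_upperbound[of _ _ "at (0::real)"]) (auto simp: eventually_at_filter)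
  then have "norm v * norm v \<le> L * norm v" by (simp add: dot_square_norm power2_eq_square)
  then show False using \<open>\<not> norm (grad F x) \<le> L\<close> L0 by (auto simp: v_def mult_le_cancel_right)
qed

section \<open>Extension across a Lipschitz graph\<close>

lemma AE_lborel_translate:
  fixes N :: "'a::euclidean_space set"
  assumes "N \<in> null_sets lborel" shows "AE x in lborel. x - v \<notin> N"
  using AE_lborel_affine[OF _ assms, of 1 "- v"] by simp

lemma clamp_diff_le: "\<bar>max 0 (min 1 a) - max 0 (min 1 b)\<bar> \<le> \<bar>a - b\<bar>" for a b :: real
  by linarith

text \<open>\<open>\<delta>\<close> plays the role of the height above the graph. The transition is
  confined to heights between \<open>\<sigma> / 2\<close> and \<open>\<sigma>\<close>, at the
  unavoidable gradient cost of order \<open>1 / \<sigma>\<close>.\<close>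

lemma layer_cutoff:
  fixes \<delta> :: "'a::euclidean_space \<Rightarrow> real"
  assumes M: "M-lipschitz_on UNIV \<delta>" "M > 0" and s: "\<sigma> > 0"
  obtains \<xi> where "smooth \<xi>" "\<And>x. 0 \<le> \<xi> x" "\<And>x. \<xi> x \<le> 1"
    "\<And>x. \<delta> x \<ge> \<sigma> \<Longrightarrow> \<xi> x = 1" "\<And>x. \<delta> x \<le> \<sigma> / 2 \<Longrightarrow> \<xi> x = 0"
    "\<And>x. norm (grad \<xi> x) \<le> 4 * M / \<sigma>"
    "\<And>x. \<not> (\<sigma> / 2 \<le> \<delta> x \<and> \<delta> x \<le> \<sigma>) \<Longrightarrow> grad \<xi> x = 0"
proof -
  \<comment> \<open>The ramp rises while \<open>\<delta> x / \<sigma>\<close> runs from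
    \<open>5 / 8\<close> to \<open>7 / 8\<close>. Averaging over balls of radius
    \<open>\<sigma> / (8 * M)\<close> changes \<open>\<delta>\<close> by at most
    \<open>\<sigma> / 8\<close>, which widens this to the range from \<open>1 / 2\<close> to
    \<open>1\<close>.\<close>
  define f where "f x = max 0 (min 1 (4 * (\<delta> x / \<sigma>) - 5 / 2))" for x
  have "(4 * M / \<sigma>)-lipschitz_on UNIV f"
  proof (rule lipschitz_onI)
    fix x y
    have "dist (f x) (f y) \<le> \<bar>4 * (\<delta> x / \<sigma>) - 4 * (\<delta> y / \<sigma>)\<bar>"
      using clamp_diff_le[of "4 * (\<delta> x / \<sigma>) - 5 / 2" "4 * (\<delta> y / \<sigma>) - 5 / 2"]
      by (simp add: f_def dist_real_def)
    also have "\<dots> = (4 / \<sigma>) * dist (\<delta> x) (\<delta> y)"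
    proof -
      have "4 * (\<delta> x / \<sigma>) - 4 * (\<delta> y / \<sigma>) = (4 / \<sigma>) * (\<delta> x - \<delta> y)"
        by (simp add: right_diff_distrib)
      then show ?thesis using s by (simp only: dist_real_def abs_mult) simp
    qed
    also have "\<dots> \<le> (4 / \<sigma>) * (M * dist x y)"
      using lipschitz_onD[OF M(1)] s by (intro mult_left_mono) auto
    finally show "dist (f x) (f y) \<le> 4 * M / \<sigma> * dist x y" by simp
  qed (use M s in auto)
  then obtain \<xi> where \<xi>: "smooth \<xi>" "(4 * M / \<sigma>)-lipschitz_on UNIV \<xi>" "\<And>x. 0 \<le> \<xi> x" "\<And>x. \<xi> x \<le> 1"
    "\<And>x c. (\<And>y. y \<in> cball x (\<sigma> / (8 * M)) \<Longrightarrow> f y = c) \<Longrightarrow> \<xi> x = c"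
    by (rule mollify[of _ f "\<sigma> / (8 * M)" 0 1]) (use M s in \<open>auto simp: f_def\<close>)
  have near: "\<bar>\<delta> x - \<delta> y\<bar> \<le> \<sigma> / 8" if "y \<in> cball x (\<sigma> / (8 * M))" for x y
  proof -
    have "\<bar>\<delta> x - \<delta> y\<bar> \<le> M * dist x y" using lipschitz_onD[OF M(1), of x y] by (simp add: dist_real_def)
    also have "\<dots> \<le> M * (\<sigma> / (8 * M))" using that M by (intro mult_left_mono) auto
    finally show ?thesis using M by simp
  qed
  have one: "\<xi> x = 1" if "\<delta> x \<ge> \<sigma>" for x
  proof (rule \<xi>(5))
    fix y assume "y \<in> cball x (\<sigma> / (8 * M))"
    then have "\<delta> y \<ge> 7 / 8 * \<sigma>" using near[of y x] that by linarith
    then have "4 * (\<delta> y / \<sigma>) - 5 / 2 \<ge> 1" using s by (simp add: field_simps)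
    then show "f y = 1" by (simp add: f_def)
  qed
  have zero: "\<xi> x = 0" if "\<delta> x \<le> \<sigma> / 2" for x
  proof (rule \<xi>(5))
    fix y assume "y \<in> cball x (\<sigma> / (8 * M))"
    then have "\<delta> y \<le> 5 / 8 * \<sigma>" using near[of y x] that by linarith
    then have "4 * (\<delta> y / \<sigma>) - 5 / 2 \<le> 0" using s by (simp add: field_simps)
    then show "f y = 0" by (simp add: f_def)
  qed
  have cd: "continuous_on UNIV \<delta>" using lipschitz_on_continuous_on[OF M(1)] .
  have "grad \<xi> x = 0" if "\<not> (\<sigma> / 2 \<le> \<delta> x \<and> \<delta> x \<le> \<sigma>)" for x
  proof (cases "\<delta> x < \<sigma> / 2")
    case True
    show ?thesis
    proof (rule grad_const_on[of "{x. \<delta> x < \<sigma> / 2}"])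
      show "open {x. \<delta> x < \<sigma> / 2}" by (intro open_Collect_less cd continuous_intros)
    qed (use True zero in auto)
  next
    case False
    show ?thesis
    proof (rule grad_const_on[of "{x. \<sigma> < \<delta> x}"])
      show "open {x. \<sigma> < \<delta> x}" by (intro open_Collect_less cd continuous_intros)
    qed (use False that one in auto)
  qed
  then show ?thesis
    using that[OF \<xi>(1,3,4) one zero grad_lipschitz_bound[OF \<xi>(2,1)]] by blast
qed

text \<open>If \<open>t\<close> lies in the layers \<open>k0\<close> and \<open>k\<close>, then
  \<open>c / 2 ^ k0 / 4 \<le> c / 2 ^ k\<close>, hence \<open>k \<le> k0 + 2\<close>. So at most
  three consecutive layers meet at one height. The layers have ratio four rather than two because
  each also contains the transition zone of the next cutoff.\<close>

lemma dyadic_layers_overlap: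
  fixes c t :: real
  assumes "c > 0"
  shows "(\<Sum>k<n. indicator {t. c / 2 ^ k / 4 \<le> t \<and> t \<le> c / 2 ^ k} t) \<le> (3::real)"
proof -
  define S where "S = {k\<in>{..<n}. c / 2 ^ k / 4 \<le> t \<and> t \<le> c / 2 ^ k}"
  have "finite S" by (simp add: S_def)
  have "(\<Sum>k<n. indicator {t. c / 2 ^ k / 4 \<le> t \<and> t \<le> c / 2 ^ k} t) = (\<Sum>k\<in>{..<n}. if k \<in> S then 1 else (0::real))"
    by (rule sum.cong) (auto simp: S_def indicator_def)
  also have "\<dots> = card S"
    using sum.inter_filter[of "{..<n}" "\<lambda>_. 1::real" "\<lambda>k. k \<in> S"] by (simp add: S_def)
  also have "card S \<le> 3"
  proof (cases "S = {}")
    case False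
    define k0 where "k0 = Min S"
    have k0: "k0 \<in> S" "\<And>k. k \<in> S \<Longrightarrow> k0 \<le> k" using False \<open>finite S\<close> by (auto simp: k0_def)
    have "k \<le> k0 + 2" if "k \<in> S" for k
    proof -
      have "c / 2 ^ k0 / 4 \<le> c / 2 ^ k" using k0(1) that by (auto simp: S_def)
      then have "(2::real) ^ k \<le> 2 ^ (k0 + 2)" using assms by (simp add: field_simps power_add)
      then show ?thesis by (rule power_le_imp_le_exp[rotated]) simp
    qed
    then have "S \<subseteq> {k0..k0 + 2}" using k0 by auto
    then have "card S \<le> card {k0..k0 + 2}" by (intro card_mono) auto
    then show ?thesis by simp
  qed simp
  finally show ?thesis by simp
qed

text \<open>The height over the graph, measured along \<open>e\<close>. It is defined on the whole
  space since \<open>\<gamma>\<close> lives on the whole hyperplane, and it decreases at unit speed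
  along \<open>- e\<close>, so that translations turn into subtraction of heights.\<close>

lemma chart_height:
  fixes e :: "'a::euclidean_space" and \<gamma> :: "'a \<Rightarrow> real"
  assumes e: "norm e = 1" and L: "L-lipschitz_on {z. z \<bullet> e = 0} \<gamma>"
    and chart: "\<Omega> \<inter> ball p r = {x \<in> ball p r. x \<bullet> e > \<gamma> (x - (x \<bullet> e) *\<^sub>R e)}"
  obtains \<delta> :: "'a \<Rightarrow> real" and M where "M > 0" "M-lipschitz_on UNIV \<delta>" "\<And>x t. \<delta> (x - t *\<^sub>R e) = \<delta> x - t"
    "\<And>x. x \<in> ball p r \<Longrightarrow> x \<in> \<Omega> \<longleftrightarrow> \<delta> x > 0"
proof -
  have ee: "e \<bullet> e = 1" using e by (simp add: dot_square_norm)
  have L0: "L \<ge> 0" using lipschitz_on_nonneg[OF L] .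
  \<comment> \<open>The 1 comes from \<open>x \<bullet> e\<close>, the \<open>2 * L\<close> from a
    crude bound 2 for the Lipschitz constant of the projection. In particular \<open>M\<close> is
    positive even for \<open>L = 0\<close>, so one may divide by it.\<close>
  define M where "M = 1 + 2 * L"
  have M: "M > 0" using L0 by (simp add: M_def)
  define \<delta> where "\<delta> x = x \<bullet> e - \<gamma> (x - (x \<bullet> e) *\<^sub>R e)" for x
  have Lip: "M-lipschitz_on UNIV \<delta>"
  proof (rule lipschitz_onI)
    fix x y :: 'a
    have pr: "x - (x \<bullet> e) *\<^sub>R e \<in> {z. z \<bullet> e = 0}" for x by (simp add: inner_diff_left ee)
    have 1: "\<bar>(x - y) \<bullet> e\<bar> \<le> dist x y"
      using Cauchy_Schwarz_ineq2[of "x - y" e] e by (simp add: dist_norm)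
    have "dist (x - (x \<bullet> e) *\<^sub>R e) (y - (y \<bullet> e) *\<^sub>R e) = norm ((x - y) - ((x - y) \<bullet> e) *\<^sub>R e)"
      by (simp add: dist_norm inner_diff_left scaleR_diff_left algebra_simps)
    also have "\<dots> \<le> norm (x - y) + norm (((x - y) \<bullet> e) *\<^sub>R e)" by (rule norm_triangle_ineq4)
    also have "\<dots> \<le> 2 * dist x y" using 1 e by (simp add: dist_norm)
    finally have "L * dist (x - (x \<bullet> e) *\<^sub>R e) (y - (y \<bullet> e) *\<^sub>R e) \<le> L * (2 * dist x y)"
      using L0 by (rule mult_left_mono)
    then have "dist (\<gamma> (x - (x \<bullet> e) *\<^sub>R e)) (\<gamma> (y - (y \<bullet> e) *\<^sub>R e)) \<le> 2 * L * dist x y"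
      using lipschitz_onD[OF L pr[of x] pr[of y]] by simp
    then show "dist (\<delta> x) (\<delta> y) \<le> M * dist x y"
      using 1 by (simp add: \<delta>_def dist_real_def M_def inner_diff_left algebra_simps abs_if split: if_splits)
  qed (use M in simp)
  have \<delta>shift: "\<delta> (x - t *\<^sub>R e) = \<delta> x - t" for x t
    by (simp add: \<delta>_def inner_diff_left ee algebra_simps)
  have iff: "x \<in> \<Omega> \<longleftrightarrow> \<delta> x > 0" if "x \<in> ball p r" for x
    using arg_cong[OF chart, of "\<lambda>S. x \<in> S"] that by (simp add: \<delta>_def)
  show ?thesis by (rule that[OF M Lip \<delta>shift iff])
qed

text \<open>The functions \<open>\<psi> K\<close> below are test functions on
  \<open>\<Omega>\<close> that approximate \<open>\<phi>\<close> minus its pushed copy, so that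
  \<open>pairing u (\<psi> K) = 0\<close>. The product rule splits this identity into gradients of
  \<open>\<phi>\<close> at shifted points (the fields \<open>w2\<close>), gradients of cutoffs times
  differences of shifts (the fields \<open>w1\<close>, by \<open>transport\<close>), and the single
  term with \<open>\<xi> 0\<close> (the density \<open>f\<close>). The claim is the limit of
  infinite \<open>K\<close>.\<close>

lemma local_extension:
  fixes u :: "'a::euclidean_space \<Rightarrow> 'a" and \<gamma> :: "'a \<Rightarrow> real"
  assumes u: "integrable lborel u" "\<And>x. x \<notin> \<Omega> \<Longrightarrow> u x = 0"
    and div: "\<And>\<phi>. test_fun \<Omega> \<phi> \<Longrightarrow> pairing u \<phi> = 0"
    and op: "open \<Omega>" and e: "norm e = 1" and r: "r > 0"
    and L: "L-lipschitz_on {z. z \<bullet> e = 0} \<gamma>"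
    and chart: "\<Omega> \<inter> ball p r = {x \<in> ball p r. x \<bullet> e > \<gamma> (x - (x \<bullet> e) *\<^sub>R e)}"
  obtains w :: "'a \<Rightarrow> 'a" and f :: "'a \<Rightarrow> real" where "integrable lborel w" "integrable lborel f"
    "\<And>x. x \<in> \<Omega> \<Longrightarrow> w x = 0" "\<And>x. x \<in> \<Omega> \<Longrightarrow> f x = 0"
    "\<And>\<phi>. test_fun (ball p (r / 4)) \<phi> \<Longrightarrow>
       pairing u \<phi> = pairing w \<phi> + moment f \<phi>"
proof -
  obtain \<delta> M where M: "M > 0" and Lip: "M-lipschitz_on UNIV \<delta>" and \<delta>shift: "\<And>x t. \<delta> (x - t *\<^sub>R e) = \<delta> x - t"
    and iff: "\<And>x. x \<in> ball p r \<Longrightarrow> x \<in> \<Omega> \<longleftrightarrow> \<delta> x > 0"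
    by (rule chart_height[OF e L chart], rule that)
  have c\<delta>: "continuous_on UNIV \<delta>" using lipschitz_on_continuous_on[OF Lip] .
  have [measurable]: "\<delta> \<in> borel_measurable borel" using c\<delta> by (rule borel_measurable_continuous_onI)
  have out: "x \<notin> \<Omega>" if "\<delta> x \<le> 0" "x \<in> ball p r" for x using iff that by auto
  have inn: "x \<in> \<Omega>" if "\<delta> x > 0" "x \<in> ball p r" for x using iff that by auto
  have \<Omega>pos: "\<delta> x > 0" if "x \<in> \<Omega>" "x \<in> ball p r" for x using iff that by auto
  have [measurable]: "\<Omega> \<in> sets borel" using op by simp
  \<comment> \<open>The factor \<open>1 / 8\<close> keeps every shift \<open>2 * \<sigma> k\<close>
    below \<open>r / 4\<close>: shifted copies of a test function from the ball of radius
    \<open>r / 4\<close> stay within radius \<open>r / 2\<close>, and pushing a point from there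
    remains inside the chart.\<close>
  define \<sigma> where "\<sigma> k = r / 8 / 2 ^ k" for k :: nat
  have \<sigma>: "\<sigma> k > 0" "\<sigma> (Suc k) = \<sigma> k / 2" "\<sigma> k \<le> r / 8" for k
    using r by (auto simp: \<sigma>_def field_simps)
  have "\<exists>\<xi>. smooth \<xi> \<and> (\<forall>x. 0 \<le> \<xi> x \<and> \<xi> x \<le> 1 \<and> (\<delta> x \<ge> \<sigma> k \<longrightarrow> \<xi> x = 1) \<and> (\<delta> x \<le> \<sigma> k / 2 \<longrightarrow> \<xi> x = 0) \<and>
      norm (grad \<xi> x) \<le> 4 * M / \<sigma> k \<and> (\<not> (\<sigma> k / 2 \<le> \<delta> x \<and> \<delta> x \<le> \<sigma> k) \<longrightarrow> grad \<xi> x = 0))" for k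
    by (rule layer_cutoff[OF Lip M \<sigma>(1)]) blast
  then obtain \<xi> where \<xi>': "\<And>k. smooth (\<xi> k) \<and> (\<forall>x. 0 \<le> \<xi> k x \<and> \<xi> k x \<le> 1 \<and> (\<delta> x \<ge> \<sigma> k \<longrightarrow> \<xi> k x = 1) \<and> (\<delta> x \<le> \<sigma> k / 2 \<longrightarrow> \<xi> k x = 0) \<and>
      norm (grad (\<xi> k) x) \<le> 4 * M / \<sigma> k \<and> (\<not> (\<sigma> k / 2 \<le> \<delta> x \<and> \<delta> x \<le> \<sigma> k) \<longrightarrow> grad (\<xi> k) x = 0))"
    by metis
  then have \<xi>: "smooth (\<xi> k)" "0 \<le> \<xi> k x" "\<xi> k x \<le> 1" "\<delta> x \<ge> \<sigma> k \<Longrightarrow> \<xi> k x = 1" "\<delta> x \<le> \<sigma> k / 2 \<Longrightarrow> \<xi> k x = 0"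
    "norm (grad (\<xi> k) x) \<le> 4 * M / \<sigma> k" "\<not> (\<sigma> k / 2 \<le> \<delta> x \<and> \<delta> x \<le> \<sigma> k) \<Longrightarrow> grad (\<xi> k) x = 0" for k x
    by blast+
  have [measurable]: "\<xi> k \<in> borel_measurable borel" "grad (\<xi> k) \<in> borel_measurable borel" for k
    using smooth_measurable[OF \<xi>(1)] grad_measurable[OF \<xi>(1)] by auto
  \<comment> \<open>These weights come from summation by parts: \<open>\<xi> K\<close> minus the sum
    of \<open>m k\<close> for \<open>k < K\<close> is \<open>\<xi> 0\<close>.\<close>
  define m where "m k x = \<xi> (Suc k) x - \<xi> k x" for k x
  have [measurable]: "m k \<in> borel_measurable borel" for k unfolding m_def by measurable
  \<comment> \<open>\<open>\<xi> k\<close> and \<open>\<xi> (Suc k)\<close> both equal 1 above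
    height \<open>\<sigma> k\<close>, and both vanish below \<open>\<sigma> (Suc k) / 2\<close>,
    which is \<open>\<sigma> k / 4\<close>.\<close>
  define A where "A k = {x. \<sigma> k / 4 \<le> \<delta> x \<and> \<delta> x \<le> \<sigma> k}" for k
  have [measurable]: "A k \<in> sets borel" for k unfolding A_def by measurable
  have m1: "\<bar>m k x\<bar> \<le> indicator (A k) x" for k x
  proof (cases "x \<in> A k")
    case True
    then show ?thesis using \<xi>(2,3)[of k x] \<xi>(2,3)[of "Suc k" x] by (simp add: m_def abs_if)
  next
    case False
    then consider "\<delta> x < \<sigma> k / 4" | "\<delta> x > \<sigma> k" by (auto simp: A_def)
    then have "m k x = 0"
    proof cases
      case 1
      then show ?thesis using \<xi>(5)[of x k] \<xi>(5)[of x "Suc k"] \<sigma>(1,2)[of k] by (simp add: m_def)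
    next
      case 2
      then show ?thesis using \<xi>(4)[of k x] \<xi>(4)[of "Suc k" x] \<sigma>(1,2)[of k] by (simp add: m_def)
    qed
    then show ?thesis by simp
  qed
  \<comment> \<open>All functions \<open>\<psi> K\<close> vanish off this ball, so replacing
    \<open>u\<close> by \<open>v\<close> changes no pairing, while points carrying \<open>v\<close>
    can be pushed without leaving the chart.\<close>
  define v where "v x = indicator (cball p (r / 2)) x *\<^sub>R u x" for x
  have iv: "integrable lborel v"
    unfolding v_def using u by (intro integrable_mult_indicator) auto
  have [measurable]: "v \<in> borel_measurable borel" using iv by auto
  \<comment> \<open>On \<open>A k\<close> the height is at most \<open>\<sigma> k\<close>, so the
    shift \<open>2 * \<sigma> k\<close> ends below the graph. Where \<open>h (Suc k)\<close> lives
    the height is at most \<open>\<sigma> k / 2\<close>, so every shift between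
    \<open>s (Suc k) = \<sigma> k\<close> and \<open>s k\<close> ends there as well: the whole
    connecting segment avoids \<open>\<Omega>\<close>.\<close>
  define s where "s k = 2 * \<sigma> k" for k
  have s: "s k > 0" "s (Suc k) = \<sigma> k" "s k \<le> r / 4" for k using \<sigma>[of k] by (auto simp: s_def)
  have vnear: "x - t *\<^sub>R e \<in> ball p r" if "v x \<noteq> 0" "0 \<le> t" "t \<le> r / 4" for x t
  proof -
    have "dist p x \<le> r / 2" using that(1) by (auto simp: v_def indicator_def split: if_splits)
    moreover have "dist x (x - t *\<^sub>R e) \<le> r / 4" using that e by (simp add: dist_norm)
    ultimately show ?thesis using dist_triangle[of p "x - t *\<^sub>R e" x] r by simp
  qed
  define h where "h k x = v x \<bullet> grad (\<xi> k) x" for k x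
  have ih: "integrable lborel (h k)" for k
    unfolding h_def by (rule integrable_inner_bounded_borel[OF iv _ \<xi>(6)]) auto
  have h0: "v x \<noteq> 0 \<and> \<sigma> k / 2 \<le> \<delta> x \<and> \<delta> x \<le> \<sigma> k" if "h k x \<noteq> 0" for k x
  proof -
    have "grad (\<xi> k) x \<noteq> 0" "v x \<noteq> 0" using that by (auto simp: h_def)
    then show ?thesis using \<xi>(7)[of k x] by blast
  qed
  \<comment> \<open>The gradient bound at level \<open>Suc k\<close> is
    \<open>4 * M / \<sigma> (Suc k) = 8 * M / \<sigma> k\<close>, and the transition zone of
    \<open>\<xi> (Suc k)\<close> is contained in \<open>A k\<close>.\<close>
  have hle: "\<bar>h (Suc k) x\<bar> \<le> 8 * M / \<sigma> k * (indicator (A k) x * norm (v x))" for k x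
  proof (cases "h (Suc k) x = 0")
    case False
    then have "x \<in> A k" using h0[OF False] \<sigma>[of k] by (simp add: A_def)
    have "\<bar>h (Suc k) x\<bar> \<le> norm (v x) * norm (grad (\<xi> (Suc k)) x)"
      unfolding h_def by (rule Cauchy_Schwarz_ineq2)
    also have "\<dots> \<le> norm (v x) * (4 * M / \<sigma> (Suc k))" by (intro mult_left_mono \<xi>) auto
    finally show ?thesis using \<open>x \<in> A k\<close> \<sigma>(2)[of k] by (simp add: mult.commute)
  qed (use M \<sigma>(1)[of k] in auto)
  have iA: "integrable lborel (\<lambda>x. indicator (A k) x * norm (v x))" for k
    using integrable_mult_indicator[of "A k" lborel "\<lambda>x. norm (v x)"] iv by simp
  define I where "I k = (\<integral>x. indicator (A k) x * norm (v x) \<partial>lborel)" for k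
  \<comment> \<open>Bounded overlap of the layers bounds every partial sum by three times the L1
    norm of \<open>v\<close>; no decay of \<open>u\<close> towards the boundary enters.\<close>
  have sI: "summable I"
  proof (rule summableI_nonneg_bounded)
    fix n
    have "(\<Sum>k<n. I k) = (\<integral>x. (\<Sum>k<n. indicator (A k) x * norm (v x)) \<partial>lborel)"
      unfolding I_def using iA by (subst Bochner_Integration.integral_sum) auto
    also have "\<dots> \<le> (\<integral>x. 3 * norm (v x) \<partial>lborel)"
    proof (rule integral_mono)
      fix x
      have "(\<Sum>k<n. indicator (A k) x) \<le> (3::real)"
        using dyadic_layers_overlap[where c = "r / 8" and n = n and t = "\<delta> x"] r by (simp add: A_def \<sigma>_def indicator_def)
      then have "(\<Sum>k<n. indicator (A k) x) * norm (v x) \<le> 3 * norm (v x)" by (rule mult_right_mono) simp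
      then show "(\<Sum>k<n. indicator (A k) x * norm (v x)) \<le> 3 * norm (v x)" by (simp add: sum_distrib_right)
    next
      show "integrable lborel (\<lambda>x. \<Sum>k<n. indicator (A k) x * norm (v x))"
        by (intro Bochner_Integration.integrable_sum iA)
    qed (use iv in simp)
    finally show "(\<Sum>k<n. I k) \<le> (\<integral>x. 3 * norm (v x) \<partial>lborel)" .
  qed (auto simp: I_def)
  \<comment> \<open>The decisive cancellation: the segments have length \<open>\<sigma> k\<close>,
    the mass carried is bounded by \<open>8 * M / \<sigma> k * I k\<close>, and the product no
    longer contains \<open>\<sigma> k\<close>.\<close>
  have "\<exists>w. integrable lborel w \<and> (\<forall>x\<in>\<Omega>. w x = 0) \<and>
      (\<integral>x. norm (w x) \<partial>lborel) \<le> DIM('a) * (8 * M) * I k \<and>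
      (\<forall>\<phi>. test_fun UNIV \<phi> \<longrightarrow> (\<integral>x. h (Suc k) x * (\<phi> (x - s (Suc k) *\<^sub>R e) - \<phi> (x - s k *\<^sub>R e)) \<partial>lborel)
         = pairing w \<phi>)" for k
  proof -
    have seg: "x - s k *\<^sub>R e + t *\<^sub>R (x - s (Suc k) *\<^sub>R e - (x - s k *\<^sub>R e)) = x - (2 * \<sigma> k - t * \<sigma> k) *\<^sub>R e" for x t
    proof -
      have "x - s k *\<^sub>R e + t *\<^sub>R (x - s (Suc k) *\<^sub>R e - (x - s k *\<^sub>R e)) = x - (s k + t * (s (Suc k) - s k)) *\<^sub>R e"
        by (simp add: algebra_simps)
      also have "s k + t * (s (Suc k) - s k) = 2 * \<sigma> k - t * \<sigma> k"
        unfolding s(2) by (simp add: s_def algebra_simps)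
      finally show ?thesis .
    qed
    obtain w where w: "integrable lborel w" "\<And>x. x \<in> \<Omega> \<Longrightarrow> w x = 0"
      "(\<integral>x. norm (w x) \<partial>lborel) \<le> DIM('a) * \<sigma> k * (\<integral>x. \<bar>h (Suc k) x\<bar> \<partial>lborel)"
      "\<And>\<phi>. test_fun UNIV \<phi> \<Longrightarrow> (\<integral>x. h (Suc k) x * (\<phi> (x - s (Suc k) *\<^sub>R e) - \<phi> (x - s k *\<^sub>R e)) \<partial>lborel)
         = pairing w \<phi>"
    proof (rule transport[OF lborel.sigma_finite_measure_axioms ih[of "Suc k"], of "\<lambda>x. x - s k *\<^sub>R e" "\<lambda>x. x - s (Suc k) *\<^sub>R e" "\<sigma> k" \<Omega>])
      show "norm (x - s (Suc k) *\<^sub>R e - (x - s k *\<^sub>R e)) \<le> \<sigma> k" for x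
        unfolding s(2) using e \<sigma>(1)[of k] by (simp add: s_def flip: scaleR_diff_left)
      show "\<sigma> k \<ge> 0" using \<sigma>(1)[of k] by simp
    next
      fix t and N :: "'a set" assume "N \<in> null_sets lborel"
      then have "AE x in lborel. x - (2 * \<sigma> k - t * \<sigma> k) *\<^sub>R e \<notin> N" by (rule AE_lborel_translate)
      then show "AE x in lborel. h (Suc k) x \<noteq> 0 \<longrightarrow> x - s k *\<^sub>R e + t *\<^sub>R (x - s (Suc k) *\<^sub>R e - (x - s k *\<^sub>R e)) \<notin> N"
        unfolding seg by eventually_elim simp
    next
      fix x and t :: real assume h: "h (Suc k) x \<noteq> 0" and t: "0 \<le> t" "t \<le> 1"
      have "t * \<sigma> k \<le> \<sigma> k" "0 \<le> t * \<sigma> k" using t \<sigma>(1)[of k] by (auto simp: mult_le_cancel_right1)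
      moreover have "\<delta> x \<le> \<sigma> k / 2" "v x \<noteq> 0" using h0[OF h] \<sigma>(2)[of k] by auto
      ultimately show "x - s k *\<^sub>R e + t *\<^sub>R (x - s (Suc k) *\<^sub>R e - (x - s k *\<^sub>R e)) \<notin> \<Omega>"
        unfolding seg using \<sigma>(1,3)[of k]
        by (intro out vnear, unfold \<delta>shift) linarith+
    qed (auto intro: that)
    have "(\<integral>x. \<bar>h (Suc k) x\<bar> \<partial>lborel) \<le> (\<integral>x. 8 * M / \<sigma> k * (indicator (A k) x * norm (v x)) \<partial>lborel)"
      using ih iA hle by (intro integral_mono) auto
    also have "\<dots> = 8 * M / \<sigma> k * I k" by (simp add: I_def)
    finally have "DIM('a) * \<sigma> k * (\<integral>x. \<bar>h (Suc k) x\<bar> \<partial>lborel) \<le> DIM('a) * \<sigma> k * (8 * M / \<sigma> k * I k)"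
      using \<sigma>(1)[of k] by (intro mult_left_mono) auto
    also have "\<dots> = DIM('a) * (8 * M) * I k" using \<sigma>(1)[of k] by simp
    finally have b: "DIM('a) * \<sigma> k * (\<integral>x. \<bar>h (Suc k) x\<bar> \<partial>lborel) \<le> DIM('a) * (8 * M) * I k" .
    show ?thesis using w(1,2,4) order_trans[OF w(3) b] by blast
  qed
  then have "\<forall>k. \<exists>w. integrable lborel w \<and> (\<forall>x\<in>\<Omega>. w x = 0) \<and>
      (\<integral>x. norm (w x) \<partial>lborel) \<le> DIM('a) * (8 * M) * I k \<and>
      (\<forall>\<phi>. test_fun UNIV \<phi> \<longrightarrow> (\<integral>x. h (Suc k) x * (\<phi> (x - s (Suc k) *\<^sub>R e) - \<phi> (x - s k *\<^sub>R e)) \<partial>lborel)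
         = pairing w \<phi>)" by (rule allI)
  from choice[OF this] obtain w1 where "\<forall>k. integrable lborel (w1 k) \<and> (\<forall>x\<in>\<Omega>. w1 k x = 0) \<and>
      (\<integral>x. norm (w1 k x) \<partial>lborel) \<le> DIM('a) * (8 * M) * I k \<and>
      (\<forall>\<phi>. test_fun UNIV \<phi> \<longrightarrow> (\<integral>x. h (Suc k) x * (\<phi> (x - s (Suc k) *\<^sub>R e) - \<phi> (x - s k *\<^sub>R e)) \<partial>lborel)
         = pairing (w1 k) \<phi>)" by (rule exE)
  then have w1: "integrable lborel (w1 k)" "x \<in> \<Omega> \<Longrightarrow> w1 k x = 0"
    "(\<integral>x. norm (w1 k x) \<partial>lborel) \<le> DIM('a) * (8 * M) * I k"
    "test_fun UNIV \<phi> \<Longrightarrow> (\<integral>x. h (Suc k) x * (\<phi> (x - s (Suc k) *\<^sub>R e) - \<phi> (x - s k *\<^sub>R e)) \<partial>lborel)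
         = pairing (w1 k) \<phi>" for k x \<phi>
    by auto
  have imv: "integrable lborel (\<lambda>x. m k x *\<^sub>R v x)" for k
    by (rule Bochner_Integration.integrable_bound[OF iA[of k]])
       (auto intro!: AE_I2 mult_right_mono m1 simp: abs_mult)
  \<comment> \<open>The image of \<open>m k x *\<^sub>R v x\<close> under the push by
    \<open>s k\<close>, so that pairing it with \<open>\<phi>\<close> gives back the pairing with
    the shifted function.\<close>
  define w2 where "w2 k z = m k (z + s k *\<^sub>R e) *\<^sub>R v (z + s k *\<^sub>R e)" for k z
  have iw2: "integrable lborel (w2 k)" "(\<integral>x. norm (w2 k x) \<partial>lborel) \<le> I k" for k
  proof -
    show "integrable lborel (w2 k)" unfolding w2_def using push_translate(1)[OF imv] by simp
    have "(\<integral>x. norm (w2 k x) \<partial>lborel) = (\<integral>x. norm (m k x *\<^sub>R v x) \<partial>lborel)"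
      unfolding w2_def using push_translate(2)[OF imv] by simp
    also have "\<dots> \<le> I k"
      unfolding I_def using integrable_norm[OF imv[of k]] iA by (intro integral_mono) (auto intro!: mult_right_mono m1)
    finally show "(\<integral>x. norm (w2 k x) \<partial>lborel) \<le> I k" .
  qed
  have w2z: "w2 k z = 0" if "z \<in> \<Omega>" for k z
  proof (rule ccontr)
    let ?x = "z + s k *\<^sub>R e"
    assume "w2 k z \<noteq> 0"
    then have mx: "m k ?x \<noteq> 0" "v ?x \<noteq> 0" by (auto simp: w2_def)
    then have "?x \<in> A k" using m1[of k ?x] by (cases "?x \<in> A k") auto
    then have "\<delta> (?x - s k *\<^sub>R e) \<le> 0" unfolding \<delta>shift using \<sigma>(1)[of k] by (simp add: A_def s_def)
    then have "?x - s k *\<^sub>R e \<notin> \<Omega>" using s[of k] mx by (intro out vnear) auto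
    then show False using that by simp
  qed
  define w where "w k x = w2 k x - w1 k x" for k x
  have iw: "integrable lborel (w k)" for k unfolding w_def using iw2 w1 by auto
  have sw: "summable (\<lambda>k. \<integral>x. norm (w k x) \<partial>lborel)"
  proof (rule summable_comparison_test'[of "\<lambda>k. (1 + DIM('a) * (8 * M)) * I k" 0])
    show "summable (\<lambda>k. (1 + DIM('a) * (8 * M)) * I k)" using sI by (rule summable_mult)
    fix k
    have "(\<integral>x. norm (w k x) \<partial>lborel) \<le> (\<integral>x. norm (w2 k x) + norm (w1 k x) \<partial>lborel)"
      using iw iw2 w1 by (intro integral_mono) (auto simp: w_def norm_triangle_ineq4)
    also have "\<dots> = (\<integral>x. norm (w2 k x) \<partial>lborel) + (\<integral>x. norm (w1 k x) \<partial>lborel)"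
      using iw2 w1 by simp
    also have "\<dots> \<le> I k + DIM('a) * (8 * M) * I k" by (intro add_mono iw2 w1)
    finally show "norm (\<integral>x. norm (w k x) \<partial>lborel) \<le> (1 + DIM('a) * (8 * M)) * I k"
      by (simp add: distrib_right)
  qed
  obtain W where W: "integrable lborel W" "\<And>x. x \<in> \<Omega> \<Longrightarrow> W x = 0"
    "\<And>(G :: 'a \<Rightarrow> 'a) B. G \<in> borel_measurable borel \<Longrightarrow> (\<And>x. norm (G x) \<le> B) \<Longrightarrow>
       (\<lambda>k. \<integral>x. w k x \<bullet> G x \<partial>lborel) sums (\<integral>x. W x \<bullet> G x \<partial>lborel)"
    by (rule push_series[OF iw sw, of \<Omega>]) (use w2z w1(2) in \<open>auto simp: w_def\<close>)
  \<comment> \<open>At the coarsest level the gradient of \<open>\<xi> 0\<close> meets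
    \<open>a 0\<close> itself and not a difference of shifts, so there is no segment to integrate
    along. The term stays a density, moved off \<open>\<Omega>\<close> by the shift
    \<open>s 0\<close>; the sign arises when it changes sides.\<close>
  define f where "f z = - h 0 (z + s 0 *\<^sub>R e)" for z
  have if': "integrable lborel f" unfolding f_def using push_translate(1)[OF ih[of 0]] by simp
  have fz: "f z = 0" if "z \<in> \<Omega>" for z
  proof (rule ccontr)
    let ?x = "z + s 0 *\<^sub>R e"
    assume "f z \<noteq> 0"
    then have "h 0 ?x \<noteq> 0" by (simp add: f_def)
    note hx = h0[OF this]
    have "\<delta> (?x - s 0 *\<^sub>R e) \<le> 0" unfolding \<delta>shift using hx \<sigma>(1)[of 0] by (simp add: s_def)
    then have "?x - s 0 *\<^sub>R e \<notin> \<Omega>" using s[of 0] hx by (intro out vnear) auto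
    then show False using that by simp
  qed
  have "pairing u \<phi> = pairing W \<phi> + moment f \<phi>"
    if \<phi>: "test_fun (ball p (r / 4)) \<phi>" for \<phi>
  proof -
    have sm: "smooth \<phi>" by (rule test_funD[OF \<phi>])
    have tU: "test_fun UNIV \<phi>" using \<phi> by (rule test_fun_mono) simp
    obtain C where C: "C \<ge> 0" "\<And>x. norm (grad \<phi> x) \<le> C" "\<And>x. \<bar>\<phi> x\<bar> \<le> C"
      by (rule test_fun_grad_bounded[OF \<phi>], rule that)
    have [measurable]: "\<phi> \<in> borel_measurable borel" "grad \<phi> \<in> borel_measurable borel"
      using smooth_measurable[OF sm] grad_measurable[OF sm] by auto
    have \<phi>0: "\<phi> x = 0" if "x \<notin> ball p (r / 4)" for x
      using test_fun_support[of x \<phi>] test_funD(3)[OF \<phi>] that by blast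
    define a where "a k x = \<phi> (x - s k *\<^sub>R e)" for k x
    have sa: "smooth (a k)" for k unfolding a_def using sm by (rule smooth_translate)
    have ga: "grad (a k) x = grad \<phi> (x - s k *\<^sub>R e)" for k x unfolding a_def using sm by (rule grad_translate)
    have a0: "a k x = 0" if "x \<notin> cball p (r / 2)" for k x
      unfolding a_def
    proof (rule \<phi>0, rule notI)
      assume "x - s k *\<^sub>R e \<in> ball p (r / 4)"
      moreover have "dist (x - s k *\<^sub>R e) x \<le> r / 4" using s[of k] e by (simp add: dist_norm)
      ultimately show False using that dist_triangle[of p x "x - s k *\<^sub>R e"] by simp
    qed
    \<comment> \<open>Deep inside, where all cutoffs are 1, the sum telescopes to
      \<open>a K\<close>, which tends to \<open>\<phi>\<close>. Below height
      \<open>\<sigma> K / 2\<close> all cutoffs vanish, which makes it admissible for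
      \<open>u\<close>. The form with increments is chosen so that each cutoff from level 1 on
      multiplies a difference of consecutive shifts.\<close>
    define \<psi> where "\<psi> K x = \<xi> 0 x * a 0 x + (\<Sum>k<K. \<xi> (Suc k) x * (a (Suc k) x - a k x))" for K :: nat and x
    have s\<psi>: "smooth (\<psi> K)" for K
      unfolding \<psi>_def by (intro smooth_add smooth_mult smooth_sum smooth_diff \<xi> sa)
    have \<sigma>mono: "\<sigma> K \<le> \<sigma> k" if "k \<le> K" for k K
      using that r by (auto simp: \<sigma>_def intro!: divide_left_mono power_increasing)
    have t\<psi>: "test_fun \<Omega> (\<psi> K)" for K
    proof (rule test_funI[OF s\<psi>])
      let ?S = "cball p (r / 2) \<inter> {x. \<sigma> K / 2 \<le> \<delta> x}"
      show "compact ?S" by (intro compact_Int_closed compact_cball closed_Collect_le c\<delta> continuous_intros)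
      show "?S \<subseteq> \<Omega>"
      proof
        fix x assume "x \<in> ?S"
        then show "x \<in> \<Omega>" using \<sigma>(1)[of K] r by (intro inn) auto
      qed
      show "\<psi> K x = 0" if "x \<notin> ?S" for x
      proof (cases "x \<in> cball p (r / 2)")
        case True
        then have "\<xi> k x = 0" if "k \<le> K" for k
          using \<open>x \<notin> ?S\<close> \<sigma>mono[OF that] by (intro \<xi>) auto
        then show ?thesis by (simp add: \<psi>_def)
      qed (simp add: \<psi>_def a0)
    qed
    have g\<psi>: "grad (\<psi> K) x = a 0 x *\<^sub>R grad (\<xi> 0) x + (\<Sum>k<K. (a (Suc k) x - a k x) *\<^sub>R grad (\<xi> (Suc k)) x)
       + \<xi> K x *\<^sub>R grad (a K) x - (\<Sum>k<K. m k x *\<^sub>R grad (a k) x)" for K x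
    proof -
      \<comment> \<open>Summation by parts, applied only to the terms in which \<open>\<phi>\<close>
        is differentiated. The terms in which a cutoff is differentiated keep their differences of
        shifts.\<close>
      have *: "\<xi> 0 x *\<^sub>R grad (a 0) x + (\<Sum>k<K. \<xi> (Suc k) x *\<^sub>R (grad (a (Suc k)) x - grad (a k) x))
        = \<xi> K x *\<^sub>R grad (a K) x - (\<Sum>k<K. m k x *\<^sub>R grad (a k) x)"
        by (induction K) (auto simp: m_def algebra_simps)
      have g: "grad (\<psi> K) x = (\<xi> 0 x *\<^sub>R grad (a 0) x + a 0 x *\<^sub>R grad (\<xi> 0) x)
         + (\<Sum>k<K. \<xi> (Suc k) x *\<^sub>R (grad (a (Suc k)) x - grad (a k) x) + (a (Suc k) x - a k x) *\<^sub>R grad (\<xi> (Suc k)) x)"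
        unfolding \<psi>_def
        by (simp add: grad_add grad_sum grad_mult grad_diff smooth_sum smooth_mult smooth_diff \<xi>(1) sa)
      show ?thesis
        unfolding g sum.distrib add_diff_eq[symmetric] *[symmetric] by (simp only: add_ac)
    qed
    have uv: "u x \<bullet> grad (\<psi> K) x = v x \<bullet> grad (\<psi> K) x" for K x
    proof (cases "x \<in> cball p (r / 2)")
      case False
      have "grad (\<psi> K) x = 0"
        by (rule grad_const_on[of "- cball p (r / 2)" _ _ 0]) (use False in \<open>auto simp: \<psi>_def a0 simp del: mem_cball\<close>)
      then show ?thesis by simp
    qed (simp add: v_def)
    have i1: "integrable lborel (\<lambda>x. h k x * a j x)" for k j
      unfolding a_def by (rule integrable_mult_bounded_borel[OF ih _ C(3)]) auto
    have i2: "integrable lborel (\<lambda>x. (\<xi> K x *\<^sub>R v x) \<bullet> grad (a K) x)" for K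
    proof -
      have "integrable lborel (\<lambda>x. \<xi> K x *\<^sub>R v x)"
        by (rule Bochner_Integration.integrable_bound[OF iv])
           (use \<xi>(2,3)[of K] in \<open>auto intro!: AE_I2 mult_left_le_one_le\<close>)
      then show ?thesis unfolding ga by (rule integrable_inner_bounded_borel[OF _ _ C(2)]) auto
    qed
    have i3: "integrable lborel (\<lambda>x. (m k x *\<^sub>R v x) \<bullet> grad (a k) x)" for k
      unfolding ga by (rule integrable_inner_bounded_borel[OF imv _ C(2)]) auto
    have wk: "pairing (w k) \<phi> = (\<integral>x. (m k x *\<^sub>R v x) \<bullet> grad (a k) x \<partial>lborel) - (\<integral>x. h (Suc k) x * (a (Suc k) x - a k x) \<partial>lborel)" for k
    proof -
      have "pairing (w k) \<phi> = pairing (w2 k) \<phi> - pairing (w1 k) \<phi>"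
        unfolding w_def inner_diff_left
        by (intro Bochner_Integration.integral_diff integrable_inner_bounded_borel[OF _ _ C(2)] iw2 w1) auto
      also have "pairing (w2 k) \<phi> = (\<integral>x. (m k x *\<^sub>R v x) \<bullet> grad (a k) x \<partial>lborel)"
        unfolding ga w2_def by (rule push_translate(3)[OF imv, symmetric]) auto
      also have "pairing (w1 k) \<phi> = (\<integral>x. h (Suc k) x * (a (Suc k) x - a k x) \<partial>lborel)"
        unfolding a_def by (rule w1(4)[OF tU, symmetric])
      finally show ?thesis .
    qed
    have part: "(\<Sum>k<K. \<integral>x. w k x \<bullet> grad \<phi> x \<partial>lborel) = (\<integral>x. h 0 x * a 0 x \<partial>lborel) + (\<integral>x. (\<xi> K x *\<^sub>R v x) \<bullet> grad (a K) x \<partial>lborel)" for K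
    proof -
      have "0 = pairing v (\<psi> K)" using div[OF t\<psi>[of K]] by (simp add: uv)
      also have "\<dots> = (\<integral>x. h 0 x * a 0 x + (\<Sum>k<K. h (Suc k) x * (a (Suc k) x - a k x))
         + (\<xi> K x *\<^sub>R v x) \<bullet> grad (a K) x - (\<Sum>k<K. (m k x *\<^sub>R v x) \<bullet> grad (a k) x) \<partial>lborel)"
        by (rule Bochner_Integration.integral_cong)
           (auto simp: g\<psi> inner_add_right inner_diff_right inner_sum_right h_def mult.commute)
      also have "\<dots> = (\<integral>x. h 0 x * a 0 x \<partial>lborel) + (\<Sum>k<K. \<integral>x. h (Suc k) x * (a (Suc k) x - a k x) \<partial>lborel)
         + (\<integral>x. (\<xi> K x *\<^sub>R v x) \<bullet> grad (a K) x \<partial>lborel) - (\<Sum>k<K. \<integral>x. (m k x *\<^sub>R v x) \<bullet> grad (a k) x \<partial>lborel)"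
      proof -
        have i4: "integrable lborel (\<lambda>x. h (Suc k) x * (a (Suc k) x - a k x))" for k
          unfolding right_diff_distrib by (intro Bochner_Integration.integrable_diff i1)
        show ?thesis
          using i1[of 0 0] i4 i2[of K] i3
          by (simp add: Bochner_Integration.integral_sum)
      qed
      finally show ?thesis by (simp add: wk sum_subtractf)
    qed
    \<comment> \<open>Where \<open>v\<close> is nonzero the height is positive, so
      \<open>\<xi> K\<close> is eventually 1, while the shifts tend to 0. The dominating function is
      \<open>C * norm (v x)\<close>.\<close>
    have lim: "(\<lambda>K. \<integral>x. (\<xi> K x *\<^sub>R v x) \<bullet> grad (a K) x \<partial>lborel) \<longlonglongrightarrow> pairing v \<phi>"
    proof (rule integral_dominated_convergence[where w = "\<lambda>x. C * norm (v x)"])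
      show "AE x in lborel. (\<lambda>K. (\<xi> K x *\<^sub>R v x) \<bullet> grad (a K) x) \<longlonglongrightarrow> v x \<bullet> grad \<phi> x"
      proof (rule AE_I2)
        fix x
        show "(\<lambda>K. (\<xi> K x *\<^sub>R v x) \<bullet> grad (a K) x) \<longlonglongrightarrow> v x \<bullet> grad \<phi> x"
        proof (cases "v x = 0")
          case False
          then have "x \<in> \<Omega>" "x \<in> ball p r" using u(2)[of x] r
            by (auto simp: v_def indicator_def split: if_splits)
          then have "\<delta> x > 0" by (rule \<Omega>pos)
          have \<sigma>0: "\<sigma> \<longlonglongrightarrow> 0"
            unfolding \<sigma>_def[abs_def] by (rule LIMSEQ_divide_realpow_zero) simp
          then have "\<forall>\<^sub>F K in sequentially. \<sigma> K < \<delta> x" using \<open>\<delta> x > 0\<close> by (rule order_tendstoD)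
          then have "\<forall>\<^sub>F K in sequentially. \<xi> K x = 1" by eventually_elim (auto intro: \<xi>)
          then have c1: "(\<lambda>K. \<xi> K x) \<longlonglongrightarrow> 1" by (rule tendsto_eventually)
          have "(\<lambda>K. x - s K *\<^sub>R e) \<longlonglongrightarrow> x - (2 * 0) *\<^sub>R e"
            unfolding s_def by (intro tendsto_intros \<sigma>0)
          then have "(\<lambda>K. grad \<phi> (x - s K *\<^sub>R e)) \<longlonglongrightarrow> grad \<phi> x"
            using smooth_grad_continuous[OF sm, of UNIV]
            by (auto intro!: continuous_on_tendsto_compose[of UNIV "grad \<phi>"])
          then have "(\<lambda>K. (\<xi> K x *\<^sub>R v x) \<bullet> grad (a K) x) \<longlonglongrightarrow> (1 *\<^sub>R v x) \<bullet> grad \<phi> x"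
            unfolding ga by (intro tendsto_intros c1)
          then show ?thesis by simp
        qed simp
      qed
      show "AE x in lborel. norm ((\<xi> K x *\<^sub>R v x) \<bullet> grad (a K) x) \<le> C * norm (v x)" for K
      proof (rule AE_I2)
        fix x
        have "norm ((\<xi> K x *\<^sub>R v x) \<bullet> grad (a K) x) \<le> norm (\<xi> K x *\<^sub>R v x) * norm (grad (a K) x)"
          unfolding real_norm_def by (rule Cauchy_Schwarz_ineq2)
        also have "\<dots> \<le> norm (v x) * C"
          unfolding ga using \<xi>(2,3)[of K x] C(2) by (intro mult_mono) (auto intro: mult_left_le_one_le)
        finally show "norm ((\<xi> K x *\<^sub>R v x) \<bullet> grad (a K) x) \<le> C * norm (v x)" by (simp add: mult.commute)
      qed
    qed (use iv in \<open>auto simp: ga\<close>)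
    have "(\<lambda>K. \<Sum>k<K. \<integral>x. w k x \<bullet> grad \<phi> x \<partial>lborel) \<longlonglongrightarrow> (\<integral>x. h 0 x * a 0 x \<partial>lborel) + pairing v \<phi>"
      unfolding part by (intro tendsto_intros lim)
    moreover have "(\<lambda>K. \<Sum>k<K. \<integral>x. w k x \<bullet> grad \<phi> x \<partial>lborel) \<longlonglongrightarrow> pairing W \<phi>"
      using W(3)[of "grad \<phi>" C] C(2) by (simp add: sums_def)
    ultimately have "pairing W \<phi> = (\<integral>x. h 0 x * a 0 x \<partial>lborel) + pairing v \<phi>"
      using LIMSEQ_unique by blast
    moreover have "(\<integral>x. h 0 x * a 0 x \<partial>lborel) = - moment f \<phi>"
      using push_translate(3)[OF ih[of 0], of \<phi> "s 0 *\<^sub>R e"] by (simp add: a_def f_def)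
    moreover have "u x \<bullet> grad \<phi> x = v x \<bullet> grad \<phi> x" for x
    proof (cases "x \<in> cball p (r / 2)")
      case False
      then have "x \<notin> ball p (r / 4)" using r by auto
      then have "x \<notin> closure {x. \<phi> x \<noteq> 0}" using test_funD(3)[OF \<phi>] by blast
      then have "grad \<phi> x = 0" by (rule test_fun_grad_support)
      then show ?thesis by simp
    qed (simp add: v_def)
    ultimately show ?thesis by simp
  qed
  then show ?thesis using that[of W f] W(1,2) if' fz by blast
qed

section \<open>Gluing the local extensions\<close>

text \<open>With \<open>d\<close> the distance from \<open>K\<close> to the complement of
  \<open>U\<close>, the clamped function is 1 up to distance \<open>d / 4\<close> and 0 from
  \<open>d / 2\<close> on. Averaging at scale \<open>d / 8\<close> leaves the value 1 below
  \<open>d / 8\<close> and the value 0 beyond \<open>5 * d / 8\<close>. The value 1 on a whole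
  neighbourhood is what makes gradients vanish on \<open>K\<close>.\<close>

lemma smooth_cutoff:
  fixes K U :: "'a::euclidean_space set"
  assumes K: "compact K" and U: "open U" "K \<subseteq> U"
  obtains \<theta> V where "test_fun U \<theta>" "open V" "K \<subseteq> V" "\<And>x. x \<in> V \<Longrightarrow> \<theta> x = 1"
proof (cases "K = {}")
  case True
  have "test_fun U (\<lambda>x. 0)" by (rule test_funI[of _ "{}"]) auto
  then show ?thesis using that[of "\<lambda>x. 0" "{}"] True by auto
next
  case False
  have "\<exists>d>0. \<forall>x\<in>K. \<forall>y\<in>- U. d \<le> dist x y" by (rule separate_compact_closed) (use K U in auto)
  then obtain d where d: "d > 0" "\<forall>x\<in>K. \<forall>y\<in>- U. d \<le> dist x y" by - (elim exE conjE, rule that)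
  have cK: "continuous_on UNIV (\<lambda>x. infdist x K)" by (intro continuous_intros)
  define f where "f x = max 0 (min 1 (2 - (4 / d) * infdist x K))" for x
  have "(4 / d)-lipschitz_on UNIV f"
  proof (rule lipschitz_onI)
    fix x y
    have "\<bar>infdist x K - infdist y K\<bar> \<le> dist x y"
      using infdist_triangle[of x K y] infdist_triangle[of y K x] by (simp add: dist_commute abs_le_iff)
    then have le: "(4 / d) * \<bar>infdist y K - infdist x K\<bar> \<le> (4 / d) * dist x y"
      using d by (intro mult_left_mono) (auto simp: abs_minus_commute)
    have eq: "(2 - (4 / d) * infdist x K) - (2 - (4 / d) * infdist y K) = (4 / d) * (infdist y K - infdist x K)"
      by (simp add: right_diff_distrib)
    have "dist (f x) (f y) \<le> \<bar>(2 - (4 / d) * infdist x K) - (2 - (4 / d) * infdist y K)\<bar>"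
      unfolding f_def dist_real_def by (rule clamp_diff_le)
    also have "\<dots> = (4 / d) * \<bar>infdist y K - infdist x K\<bar>"
      unfolding eq abs_mult using d by simp
    also note le
    finally show "dist (f x) (f y) \<le> (4 / d) * dist x y" .
  qed (use d in auto)
  then obtain \<theta> where \<theta>: "smooth \<theta>" "\<And>x c. (\<And>y. y \<in> cball x (d / 8) \<Longrightarrow> f y = c) \<Longrightarrow> \<theta> x = c"
    by (rule mollify[of _ f "d / 8" 0 1]) (use d in \<open>auto simp: f_def\<close>)
  have "test_fun U \<theta>"
  proof (rule test_funI[OF \<theta>(1)])
    show "compact {x. infdist x K \<le> d * 5 / 8}" using False K d by (intro compact_infdist_le) auto
    show "{x. infdist x K \<le> d * 5 / 8} \<subseteq> U"
    proof
      fix x assume "x \<in> {x. infdist x K \<le> d * 5 / 8}"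
      then have "infdist x K < d" using d by simp
      obtain k where "k \<in> K" "infdist x K = dist x k"
        using infdist_attains_inf[OF compact_imp_closed[OF K] False] by blast
      then have "dist k x < d" using \<open>infdist x K < d\<close> by (simp add: dist_commute)
      then show "x \<in> U" using d(2) \<open>k \<in> K\<close> by force
    qed
    show "\<theta> x = 0" if "x \<notin> {x. infdist x K \<le> d * 5 / 8}" for x
    proof (rule \<theta>(2))
      fix y assume "y \<in> cball x (d / 8)"
      then have "infdist y K \<ge> d / 2" using infdist_triangle[of x K y] that by auto
      then have "(4 / d) * infdist y K \<ge> 2" using d by (simp add: field_simps)
      then show "f y = 0" by (simp add: f_def)
    qed
  qed
  moreover have "open {x. infdist x K < d / 8}" by (intro open_Collect_less cK continuous_intros)
  moreover have "K \<subseteq> {x. infdist x K < d / 8}" using d by auto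
  moreover have "\<theta> x = 1" if "x \<in> {x. infdist x K < d / 8}" for x
  proof (rule \<theta>(2))
    fix y assume "y \<in> cball x (d / 8)"
    then have "infdist y K \<le> d / 4" using infdist_triangle[of y K x] that by (auto simp: dist_commute)
    then have "(4 / d) * infdist y K \<le> 1" using d by (simp add: field_simps)
    then show "f y = 1" by (simp add: f_def)
  qed
  ultimately show ?thesis using that by blast
qed

text \<open>The contribution \<open>\<theta> * \<phi>\<close> to the pairing of \<open>u\<close> can
  be represented off \<open>\<Omega>\<close>. Bounded support of \<open>w\<close> and
  \<open>f\<close> is part of the notion, because a smooth multiplier is only known to be bounded on
  compact sets.\<close>

definition localized :: "'a::euclidean_space set \<Rightarrow> ('a \<Rightarrow> 'a) \<Rightarrow> ('a \<Rightarrow> real) \<Rightarrow> bool" where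
  "localized \<Omega> u \<theta> \<longleftrightarrow> smooth \<theta> \<and> (\<exists>w f R. integrable lborel w \<and> integrable lborel f \<and>
     (\<forall>x\<in>\<Omega>. w x = 0 \<and> f x = 0) \<and> (\<forall>x. x \<notin> cball 0 R \<longrightarrow> w x = 0 \<and> f x = 0) \<and>
     (\<forall>\<phi>. test_fun UNIV \<phi> \<longrightarrow> pairing u (\<lambda>x. \<theta> x * \<phi> x)
        = pairing w \<phi> + moment f \<phi>))"

lemma integrable_scale_local:
  fixes w :: "'a::euclidean_space \<Rightarrow> 'b::euclidean_space"
  assumes w: "integrable lborel w" and z: "\<And>x. x \<notin> cball 0 R \<Longrightarrow> w x = 0" and c: "continuous_on UNIV \<theta>"
  shows "integrable lborel (\<lambda>x. (\<theta> x :: real) *\<^sub>R w x)"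
proof -
  have "bounded (\<theta> ` cball 0 R)"
    by (intro compact_imp_bounded compact_continuous_image continuous_on_subset[OF c]) auto
  then obtain B where B: "\<forall>y\<in>\<theta> ` cball 0 R. norm y \<le> B" unfolding bounded_iff by - (elim exE, rule that)
  have [measurable]: "\<theta> \<in> borel_measurable borel" using c by (rule borel_measurable_continuous_onI)
  show ?thesis
  proof (rule Bochner_Integration.integrable_bound)
    show "integrable lborel (\<lambda>x. B * norm (w x))" using w by simp
    show "AE x in lborel. norm (\<theta> x *\<^sub>R w x) \<le> norm (B * norm (w x))"
    proof (rule AE_I2)
      fix x
      show "norm (\<theta> x *\<^sub>R w x) \<le> norm (B * norm (w x))"
      proof (cases "x \<in> cball 0 R")
        case True
        have "\<bar>\<theta> x\<bar> * norm (w x) \<le> \<bar>B\<bar> * norm (w x)" using B[rule_format, OF imageI[OF True]] by (intro mult_right_mono) auto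
        then show ?thesis by (simp add: abs_mult)
      qed (use z in simp)
    qed
  qed (use w in measurable)
qed

lemma integrable_inner_local:
  fixes w :: "'a::euclidean_space \<Rightarrow> 'a"
  assumes w: "integrable lborel w" and z: "\<And>x. x \<notin> cball 0 R \<Longrightarrow> w x = 0" and c: "continuous_on UNIV G"
  shows "integrable lborel (\<lambda>x. w x \<bullet> G x)"
proof -
  have "integrable lborel (\<lambda>x. (G x \<bullet> b) *\<^sub>R (w x \<bullet> b))" if "b \<in> Basis" for b
  proof (rule integrable_scale_local)
    show "continuous_on UNIV (\<lambda>x. G x \<bullet> b)" using c by (intro continuous_intros)
    show "w x \<bullet> b = 0" if "x \<notin> cball 0 R" for x using z[OF that] by simp
  qed (use w in simp)
  then have "integrable lborel (\<lambda>x. \<Sum>b\<in>Basis. (G x \<bullet> b) *\<^sub>R (w x \<bullet> b))"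
    by (intro Bochner_Integration.integrable_sum)
  also have "(\<lambda>x. \<Sum>b\<in>Basis. (G x \<bullet> b) *\<^sub>R (w x \<bullet> b)) = (\<lambda>x. w x \<bullet> G x)"
    by (rule ext) (subst (2) euclidean_inner, simp add: mult.commute)
  finally show ?thesis .
qed

lemma integrable_test:
  assumes "test_fun U \<phi>"
  shows "integrable lborel w \<Longrightarrow> integrable lborel (\<lambda>x. w x \<bullet> grad \<phi> x)"
    "integrable lborel f \<Longrightarrow> integrable lborel (\<lambda>x. f x * \<phi> x)"
proof -
  note sm = test_funD(1)[OF assms]
  obtain B where B: "\<And>x. norm (grad \<phi> x) \<le> B" "\<And>x. \<bar>\<phi> x\<bar> \<le> B"
    by (rule test_fun_grad_bounded[OF assms], rule that)
  show "integrable lborel w \<Longrightarrow> integrable lborel (\<lambda>x. w x \<bullet> grad \<phi> x)"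
    by (rule integrable_inner_bounded_borel[OF _ _ B(1)]) (use grad_measurable[OF sm] in auto)
  show "integrable lborel f \<Longrightarrow> integrable lborel (\<lambda>x. f x * \<phi> x)"
    by (rule integrable_mult_bounded_borel[OF _ _ B(2)]) (use smooth_measurable[OF sm] in auto)
qed

text \<open>Moving a cutoff from the test function to the field costs the term
  \<open>w x \<bullet> grad \<theta> x\<close>, which is a density. This is why fields and densities
  have to be carried along together.\<close>

lemma product_rule_pairing:
  fixes w :: "'a::euclidean_space \<Rightarrow> 'a"
  assumes \<theta>: "smooth \<theta>" and \<phi>: "test_fun UNIV \<phi>"
    and i: "integrable lborel (\<lambda>x. \<theta> x *\<^sub>R w x)" "integrable lborel (\<lambda>x. \<theta> x * f x)" "integrable lborel (\<lambda>x. w x \<bullet> grad \<theta> x)"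
  shows "pairing w (\<lambda>x. \<theta> x * \<phi> x) + (\<integral>x. f x * (\<theta> x * \<phi> x) \<partial>lborel)
    = (\<integral>x. (\<theta> x *\<^sub>R w x) \<bullet> grad \<phi> x \<partial>lborel) + (\<integral>x. (\<theta> x * f x + w x \<bullet> grad \<theta> x) * \<phi> x \<partial>lborel)"
proof -
  note sm = test_funD(1)[OF \<phi>]
  have "(\<lambda>x. w x \<bullet> grad (\<lambda>x. \<theta> x * \<phi> x) x) = (\<lambda>x. (\<theta> x *\<^sub>R w x) \<bullet> grad \<phi> x + (w x \<bullet> grad \<theta> x) * \<phi> x)"
    by (rule ext) (simp add: grad_mult[OF \<theta> sm] inner_add_right)
  then have "pairing w (\<lambda>x. \<theta> x * \<phi> x)
     = (\<integral>x. (\<theta> x *\<^sub>R w x) \<bullet> grad \<phi> x \<partial>lborel) + (\<integral>x. (w x \<bullet> grad \<theta> x) * \<phi> x \<partial>lborel)"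
    by (simp only: Bochner_Integration.integral_add[OF integrable_test(1)[OF \<phi> i(1)] integrable_test(2)[OF \<phi> i(3)]])
  moreover have "(\<integral>x. (\<theta> x * f x + w x \<bullet> grad \<theta> x) * \<phi> x \<partial>lborel)
     = (\<integral>x. f x * (\<theta> x * \<phi> x) \<partial>lborel) + (\<integral>x. (w x \<bullet> grad \<theta> x) * \<phi> x \<partial>lborel)"
    unfolding distrib_right
    by (subst Bochner_Integration.integral_add[OF integrable_test(2)[OF \<phi> i(2)] integrable_test(2)[OF \<phi> i(3)]])
       (simp add: mult_ac)
  ultimately show ?thesis by simp
qed

text \<open>Together with \<open>localized_add\<close> this makes the admissible cutoffs closed
  under combinations with smooth coefficients, which is all that gluing requires.\<close>

lemma localized_mult:
  assumes "localized \<Omega> u \<theta>" and \<eta>: "smooth \<eta>"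
  shows "localized \<Omega> u (\<lambda>x. \<eta> x * \<theta> x)"
proof -
  obtain w f R where w: "smooth \<theta>" "integrable lborel w" "integrable lborel f"
    "\<And>x. x \<in> \<Omega> \<Longrightarrow> w x = 0" "\<And>x. x \<in> \<Omega> \<Longrightarrow> f x = 0"
    "\<And>x. x \<notin> cball 0 R \<Longrightarrow> w x = 0" "\<And>x. x \<notin> cball 0 R \<Longrightarrow> f x = 0"
    "\<And>\<phi>. test_fun UNIV \<phi> \<Longrightarrow> pairing u (\<lambda>x. \<theta> x * \<phi> x)
        = pairing w \<phi> + moment f \<phi>"
    using assms(1) unfolding localized_def by blast
  have c: "continuous_on UNIV \<eta>" "continuous_on UNIV (grad \<eta>)"
    using \<eta> by (auto intro: smooth_continuous smooth_grad_continuous)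
  define w' where "w' x = \<eta> x *\<^sub>R w x" for x
  define f' where "f' x = \<eta> x * f x + w x \<bullet> grad \<eta> x" for x
  have iw': "integrable lborel w'" unfolding w'_def by (rule integrable_scale_local[OF w(2,6) c(1)])
  have i: "integrable lborel (\<lambda>x. \<eta> x * f x)" "integrable lborel (\<lambda>x. w x \<bullet> grad \<eta> x)"
  proof -
    show "integrable lborel (\<lambda>x. \<eta> x * f x)" using integrable_scale_local[OF w(3,7) c(1)] by simp
    show "integrable lborel (\<lambda>x. w x \<bullet> grad \<eta> x)" by (rule integrable_inner_local[OF w(2,6) c(2)])
  qed
  have if': "integrable lborel f'" unfolding f'_def using i by simp
  have "(\<integral>x. u x \<bullet> grad (\<lambda>x. (\<eta> x * \<theta> x) * \<phi> x) x \<partial>lborel)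
        = pairing w' \<phi> + moment f' \<phi>" if \<phi>: "test_fun UNIV \<phi>" for \<phi>
  proof -
    have t: "test_fun UNIV (\<lambda>x. \<eta> x * \<phi> x)" using \<phi> \<eta> by (rule test_fun_mult)
    have "(\<integral>x. u x \<bullet> grad (\<lambda>x. (\<eta> x * \<theta> x) * \<phi> x) x \<partial>lborel) = (\<integral>x. u x \<bullet> grad (\<lambda>x. \<theta> x * (\<eta> x * \<phi> x)) x \<partial>lborel)"
      by (simp add: mult_ac)
    also have "\<dots> = pairing w' \<phi> + moment f' \<phi>"
      unfolding w(8)[OF t] w'_def f'_def by (rule product_rule_pairing[OF \<eta> \<phi> iw'[unfolded w'_def] i])
    finally show ?thesis .
  qed
  then show ?thesis
    unfolding localized_def using iw' if' w(1,4-7) \<eta>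
    by (intro conjI smooth_mult exI[of _ w'] exI[of _ f'] exI[of _ R]) (auto simp: w'_def f'_def simp del: mem_cball)
qed

lemma localized_add:
  assumes "localized \<Omega> u \<theta>" "localized \<Omega> u \<eta>" and u: "integrable lborel u"
  shows "localized \<Omega> u (\<lambda>x. \<theta> x + \<eta> x)"
proof -
  obtain w f R where w: "smooth \<theta>" "integrable lborel w" "integrable lborel f"
    "\<And>x. x \<in> \<Omega> \<Longrightarrow> w x = 0" "\<And>x. x \<in> \<Omega> \<Longrightarrow> f x = 0"
    "\<And>x. x \<notin> cball 0 R \<Longrightarrow> w x = 0" "\<And>x. x \<notin> cball 0 R \<Longrightarrow> f x = 0"
    "\<And>\<phi>. test_fun UNIV \<phi> \<Longrightarrow> pairing u (\<lambda>x. \<theta> x * \<phi> x)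
        = pairing w \<phi> + moment f \<phi>"
    using assms(1) unfolding localized_def by blast
  obtain w' f' R' where w': "smooth \<eta>" "integrable lborel w'" "integrable lborel f'"
    "\<And>x. x \<in> \<Omega> \<Longrightarrow> w' x = 0" "\<And>x. x \<in> \<Omega> \<Longrightarrow> f' x = 0"
    "\<And>x. x \<notin> cball 0 R' \<Longrightarrow> w' x = 0" "\<And>x. x \<notin> cball 0 R' \<Longrightarrow> f' x = 0"
    "\<And>\<phi>. test_fun UNIV \<phi> \<Longrightarrow> pairing u (\<lambda>x. \<eta> x * \<phi> x)
        = pairing w' \<phi> + moment f' \<phi>"
    using assms(2) unfolding localized_def by blast
  have "(\<integral>x. u x \<bullet> grad (\<lambda>x. (\<theta> x + \<eta> x) * \<phi> x) x \<partial>lborel)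
        = (\<integral>x. (w x + w' x) \<bullet> grad \<phi> x \<partial>lborel) + (\<integral>x. (f x + f' x) * \<phi> x \<partial>lborel)" if \<phi>: "test_fun UNIV \<phi>" for \<phi>
  proof -
    have t: "test_fun UNIV (\<lambda>x. \<theta> x * \<phi> x)" "test_fun UNIV (\<lambda>x. \<eta> x * \<phi> x)"
      using \<phi> w(1) w'(1) by (auto intro: test_fun_mult)
    have "(\<integral>x. u x \<bullet> grad (\<lambda>x. (\<theta> x + \<eta> x) * \<phi> x) x \<partial>lborel)
      = (\<integral>x. u x \<bullet> grad (\<lambda>x. \<theta> x * \<phi> x) x + u x \<bullet> grad (\<lambda>x. \<eta> x * \<phi> x) x \<partial>lborel)"
      by (simp add: distrib_right grad_add[OF test_funD(1)[OF t(1)] test_funD(1)[OF t(2)]] inner_add_right)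
    also have "\<dots> = pairing u (\<lambda>x. \<theta> x * \<phi> x) + pairing u (\<lambda>x. \<eta> x * \<phi> x)"
      by (intro Bochner_Integration.integral_add integrable_test(1)[OF t(1)] integrable_test(1)[OF t(2)] u)
    also have "\<dots> = (pairing w \<phi> + pairing w' \<phi>) + (moment f \<phi> + moment f' \<phi>)"
      unfolding w(8)[OF \<phi>] w'(8)[OF \<phi>] by simp
    also have "\<dots> = (\<integral>x. (w x + w' x) \<bullet> grad \<phi> x \<partial>lborel) + (\<integral>x. (f x + f' x) * \<phi> x \<partial>lborel)"
      unfolding inner_add_left distrib_right
      by (intro arg_cong2[where f = "(+)"] Bochner_Integration.integral_add[symmetric] integrable_test[OF \<phi>] w(2,3) w'(2,3))
    finally show ?thesis .
  qed
  moreover have "w x + w' x = 0 \<and> f x + f' x = 0" if "x \<notin> cball 0 (max R R')" for x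
    using that w(6,7)[of x] w'(6,7)[of x] by auto
  ultimately show ?thesis
    unfolding localized_def using w(1-5) w'(1-5)
    by (intro conjI smooth_add exI[of _ "\<lambda>x. w x + w' x"] exI[of _ "\<lambda>x. f x + f' x"] exI[of _ "max R R'"])
       (auto simp del: mem_cball)
qed

text \<open>The local extension only admits test functions from a quarter of the chart ball. A
  cutoff supported there makes arbitrary \<open>\<phi>\<close> admissible, and its support bounds
  those of the new field and density.\<close>

lemma localized_near:
  fixes u :: "'a::euclidean_space \<Rightarrow> 'a"
  assumes u: "integrable lborel u" "\<And>x. x \<notin> \<Omega> \<Longrightarrow> u x = 0"
    and div: "\<And>\<phi>. test_fun \<Omega> \<phi> \<Longrightarrow> pairing u \<phi> = 0"
    and op: "open \<Omega>" and lb: "lipschitz_boundary \<Omega>" and p: "p \<in> frontier \<Omega>"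
  obtains \<theta> V where "localized \<Omega> u \<theta>" "open V" "p \<in> V" "\<And>x. x \<in> V \<Longrightarrow> \<theta> x = 1"
proof -
  obtain e r L and \<gamma> :: "'a \<Rightarrow> real" where ch: "norm e = 1" "r > 0" "L-lipschitz_on {z. z \<bullet> e = 0} \<gamma>"
    "\<Omega> \<inter> ball p r = {x \<in> ball p r. x \<bullet> e > \<gamma> (x - (x \<bullet> e) *\<^sub>R e)}"
    using lb p unfolding lipschitz_boundary_def by blast
  obtain w :: "'a \<Rightarrow> 'a" and f :: "'a \<Rightarrow> real" where w: "integrable lborel w" "integrable lborel f"
    "\<And>x. x \<in> \<Omega> \<Longrightarrow> w x = 0" "\<And>x. x \<in> \<Omega> \<Longrightarrow> f x = 0"
    "\<And>\<phi>. test_fun (ball p (r / 4)) \<phi> \<Longrightarrow>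
       pairing u \<phi> = pairing w \<phi> + moment f \<phi>"
  proof (rule local_extension[OF u(1) _ _ op ch])
    show "u x = 0" if "x \<notin> \<Omega>" for x using u(2) that .
    show "pairing u \<phi> = 0" if "test_fun \<Omega> \<phi>" for \<phi> using div that .
  qed (rule that)
  obtain \<theta> V where \<theta>: "test_fun (ball p (r / 4)) \<theta>" "open V" "{p} \<subseteq> V" "\<And>x. x \<in> V \<Longrightarrow> \<theta> x = 1"
    by (rule smooth_cutoff[of "{p}" "ball p (r / 4)"]) (use ch(2) in auto)
  note s\<theta> = test_funD(1)[OF \<theta>(1)]
  define w' where "w' x = \<theta> x *\<^sub>R w x" for x
  define f' where "f' x = \<theta> x * f x + w x \<bullet> grad \<theta> x" for x
  obtain B where B: "\<And>x. norm (grad \<theta> x) \<le> B" "\<And>x. \<bar>\<theta> x\<bar> \<le> B"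
    by (rule test_fun_grad_bounded[OF \<theta>(1)], rule that)
  have [measurable]: "\<theta> \<in> borel_measurable borel" "grad \<theta> \<in> borel_measurable borel"
    using smooth_measurable[OF s\<theta>] grad_measurable[OF s\<theta>] by auto
  have iw': "integrable lborel w'"
    unfolding w'_def
  proof (rule Bochner_Integration.integrable_bound)
    show "integrable lborel (\<lambda>x. B * norm (w x))" using w by simp
    show "AE x in lborel. norm (\<theta> x *\<^sub>R w x) \<le> norm (B * norm (w x))"
      using B(2) by (intro AE_I2) (auto simp: abs_mult intro!: mult_right_mono order_trans[OF B(2)])
  qed (use w in measurable)
  have i: "integrable lborel (\<lambda>x. \<theta> x * f x)" "integrable lborel (\<lambda>x. w x \<bullet> grad \<theta> x)"
    using integrable_test(2)[OF \<theta>(1) w(2)] integrable_test(1)[OF \<theta>(1) w(1)] by (simp_all add: mult.commute)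
  have if': "integrable lborel f'" unfolding f'_def using i by simp
  have "pairing u (\<lambda>x. \<theta> x * \<phi> x)
        = pairing w' \<phi> + moment f' \<phi>" if \<phi>: "test_fun UNIV \<phi>" for \<phi>
  proof -
    note sm = test_funD(1)[OF \<phi>]
    have t: "test_fun (ball p (r / 4)) (\<lambda>x. \<theta> x * \<phi> x)"
      using test_fun_mult[OF \<theta>(1) sm] by (simp add: mult.commute)
    show ?thesis
      unfolding w(5)[OF t] w'_def f'_def by (rule product_rule_pairing[OF s\<theta> \<phi> iw'[unfolded w'_def] i])
  qed
  moreover have "w' x = 0 \<and> f' x = 0" if "x \<notin> cball 0 (norm p + r / 4)" for x
  proof -
    have "x \<notin> ball p (r / 4)"
      using that norm_triangle_sub[of x p] by (auto simp: dist_norm norm_minus_commute)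
    then have "x \<notin> closure {x. \<theta> x \<noteq> 0}" using test_funD(3)[OF \<theta>(1)] by blast
    then have "\<theta> x = 0" "grad \<theta> x = 0"
      by (rule test_fun_support, rule test_fun_grad_support)
    then show ?thesis by (simp add: w'_def f'_def)
  qed
  ultimately have "localized \<Omega> u \<theta>"
    unfolding localized_def using iw' if' w(3,4) s\<theta>
    by (intro conjI exI[of _ w'] exI[of _ f'] exI[of _ "norm p + r / 4"]) (auto simp: w'_def f'_def simp del: mem_cball)
  then show ?thesis using that \<theta>(2-4) by blast
qed

lemma global_extension:
  fixes u :: "'a::euclidean_space \<Rightarrow> 'a"
  assumes u: "integrable lborel u" "\<And>x. x \<notin> \<Omega> \<Longrightarrow> u x = 0"
    and div: "\<And>\<phi>. test_fun \<Omega> \<phi> \<Longrightarrow> pairing u \<phi> = 0"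
    and op: "open \<Omega>" and bd: "bounded \<Omega>" and lb: "lipschitz_boundary \<Omega>"
  obtains w f R where "integrable lborel w" "integrable lborel f"
    "\<And>x. x \<in> \<Omega> \<Longrightarrow> w x = 0" "\<And>x. x \<in> \<Omega> \<Longrightarrow> f x = 0"
    "\<And>x. x \<notin> cball 0 R \<Longrightarrow> w x = 0" "\<And>x. x \<notin> cball 0 R \<Longrightarrow> f x = 0"
    "\<And>\<phi>. test_fun UNIV \<phi> \<Longrightarrow> pairing u \<phi>
        = pairing w \<phi> + moment f \<phi>"
proof -
  have "\<forall>p\<in>frontier \<Omega>. \<exists>TV. localized \<Omega> u (fst TV) \<and> open (snd TV) \<and> p \<in> snd TV \<and> (\<forall>x\<in>snd TV. fst TV x = 1)"
  proof
    fix p assume "p \<in> frontier \<Omega>"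
    obtain \<theta> V where "localized \<Omega> u \<theta>" "open V" "p \<in> V" "\<And>x. x \<in> V \<Longrightarrow> \<theta> x = 1"
      proof (rule localized_near[OF u(1) _ _ op lb \<open>p \<in> frontier \<Omega>\<close>])
      show "u x = 0" if "x \<notin> \<Omega>" for x using u(2) that .
      show "pairing u \<phi> = 0" if "test_fun \<Omega> \<phi>" for \<phi> using div that .
    qed (rule that)
    then show "\<exists>TV. localized \<Omega> u (fst TV) \<and> open (snd TV) \<and> p \<in> snd TV \<and> (\<forall>x\<in>snd TV. fst TV x = 1)"
      by (intro exI[of _ "(\<theta>, V)"]) auto
  qed
  from bchoice[OF this] obtain T where T:
    "\<And>p. p \<in> frontier \<Omega> \<Longrightarrow> localized \<Omega> u (fst (T p))" "\<And>p. p \<in> frontier \<Omega> \<Longrightarrow> open (snd (T p))"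
    "\<And>p. p \<in> frontier \<Omega> \<Longrightarrow> p \<in> snd (T p)" "\<And>p x. p \<in> frontier \<Omega> \<Longrightarrow> x \<in> snd (T p) \<Longrightarrow> fst (T p) x = 1"
    by blast
  have "compact (frontier \<Omega>)" using bd by (rule compact_frontier_bounded)
  then obtain P where P: "P \<subseteq> frontier \<Omega>" "finite P" "frontier \<Omega> \<subseteq> (\<Union>p\<in>P. snd (T p))"
    by (rule compactE_image[of _ "frontier \<Omega>" "\<lambda>p. snd (T p)"]) (use T in auto)
  have "\<exists>\<theta> V. localized \<Omega> u \<theta> \<and> open V \<and> (\<Union>p\<in>P. snd (T p)) \<subseteq> V \<and> (\<forall>x\<in>V. \<theta> x = 1)"
    using P(2,1)
  proof induction
    case empty
    have "localized \<Omega> u (\<lambda>x. 0)"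
      unfolding localized_def
      by (intro conjI exI[of _ "\<lambda>x. 0"] exI[of _ "\<lambda>x. 0"] exI[of _ 0]) (auto simp: grad_const_on[of UNIV _ _ 0])
    then show ?case by (intro exI[of _ "\<lambda>x. 0"] exI[of _ "{}"]) auto
  next
    case (insert p P)
    have "\<exists>\<theta> V. localized \<Omega> u \<theta> \<and> open V \<and> (\<Union>p\<in>P. snd (T p)) \<subseteq> V \<and> (\<forall>x\<in>V. \<theta> x = 1)"
      by (rule insert.IH) (use insert.prems in simp)
    then obtain \<theta> V where \<theta>: "localized \<Omega> u \<theta>" "open V" "(\<Union>p\<in>P. snd (T p)) \<subseteq> V" "\<forall>x\<in>V. \<theta> x = 1"
      by - (elim exE conjE, rule that)
    have p: "p \<in> frontier \<Omega>" using insert by simp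
    have sp: "smooth (fst (T p))" using T(1)[OF p] by (simp add: localized_def)
    \<comment> \<open>\<open>1 - (1 - a) * (1 - b)\<close> is 1 where either factor function is 1.
      Building the cutoff in this way yields the value 1 on the union of the neighbourhoods without
      dividing by a sum.\<close>
    have "localized \<Omega> u (\<lambda>x. fst (T p) x + (1 - fst (T p) x) * \<theta> x)"
      by (intro localized_add localized_mult T(1)[OF p] \<theta>(1) u smooth_diff smooth_const sp)
    moreover have "open (snd (T p) \<union> V)" using T(2)[OF p] \<theta>(2) by blast
    moreover have "(\<Union>p\<in>insert p P. snd (T p)) \<subseteq> snd (T p) \<union> V" using \<theta>(3) by blast
    moreover have "\<forall>x\<in>snd (T p) \<union> V. fst (T p) x + (1 - fst (T p) x) * \<theta> x = 1"
      using T(4)[OF p] \<theta>(4) by (auto simp: algebra_simps)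
    ultimately show ?case by (intro exI conjI)
  qed
  then obtain \<theta> V where \<theta>: "localized \<Omega> u \<theta>" "open V" "(\<Union>p\<in>P. snd (T p)) \<subseteq> V" "\<forall>x\<in>V. \<theta> x = 1"
    by - (elim exE conjE, rule that)
  have fV: "frontier \<Omega> \<subseteq> V" using P(3) \<theta>(3) by (rule subset_trans)
  from \<theta>(1) obtain w f R where w: "smooth \<theta>" "integrable lborel w" "integrable lborel f"
    "\<And>x. x \<in> \<Omega> \<Longrightarrow> w x = 0" "\<And>x. x \<in> \<Omega> \<Longrightarrow> f x = 0"
    "\<And>x. x \<notin> cball 0 R \<Longrightarrow> w x = 0" "\<And>x. x \<notin> cball 0 R \<Longrightarrow> f x = 0"
    "\<And>\<phi>. test_fun UNIV \<phi> \<Longrightarrow> pairing u (\<lambda>x. \<theta> x * \<phi> x)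
        = pairing w \<phi> + moment f \<phi>"
    unfolding localized_def by blast
  have red: "pairing u \<phi> = pairing u (\<lambda>x. \<theta> x * \<phi> x)" if \<phi>: "test_fun UNIV \<phi>" for \<phi>
  proof -
    note sm = test_funD(1)[OF \<phi>]
    \<comment> \<open>The part of \<open>\<phi>\<close> away from the boundary. As
      \<open>\<theta>\<close> is 1 near the frontier, extending by zero is smooth and the support is
      a compact subset of \<open>\<Omega>\<close>, so \<open>u\<close> annihilates it.\<close>
    define \<psi> where "\<psi> x = (if x \<in> \<Omega> then (1 - \<theta> x) * \<phi> x else 0)" for x
    have sg: "smooth (\<lambda>x. (1 - \<theta> x) * \<phi> x)" by (intro smooth_mult smooth_diff smooth_const w(1) sm)
    have "smooth \<psi>"
    proof (rule smooth_local)
      fix x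
      consider "x \<in> \<Omega>" | "x \<in> V" | "x \<notin> closure \<Omega>"
        using fV op by (auto simp: frontier_def interior_open)
      then show "\<exists>U g. open U \<and> x \<in> U \<and> smooth g \<and> (\<forall>y\<in>U. \<psi> y = g y)"
      proof cases
        case 1
        then show ?thesis using op sg by (intro exI[of _ \<Omega>] exI[of _ "\<lambda>x. (1 - \<theta> x) * \<phi> x"]) (auto simp: \<psi>_def)
      next
        case 2
        then show ?thesis using \<theta>(2,4) by (intro exI[of _ V] exI[of _ "\<lambda>x. 0"]) (auto simp: \<psi>_def)
      next
        case 3
        then show ?thesis using closure_subset[of \<Omega>]
          by (intro exI[of _ "- closure \<Omega>"] exI[of _ "\<lambda>x. 0"]) (auto simp: \<psi>_def)
      qed
    qed
    then have "test_fun \<Omega> \<psi>"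
    proof (rule test_funI)
      show "compact (closure \<Omega> - V)" using bd \<theta>(2) by (intro compact_diff) (auto simp: compact_closure)
      show "closure \<Omega> - V \<subseteq> \<Omega>" using fV op by (auto simp: frontier_def interior_open)
      show "\<psi> x = 0" if "x \<notin> closure \<Omega> - V" for x
        using that \<theta>(4) closure_subset[of \<Omega>] by (auto simp: \<psi>_def)
    qed
    then have 0: "pairing u \<psi> = 0" by (rule div)
    have "u x \<bullet> grad \<phi> x = u x \<bullet> grad (\<lambda>x. \<theta> x * \<phi> x) x + u x \<bullet> grad \<psi> x" for x
    proof (cases "x \<in> \<Omega>")
      case True
      have "grad \<psi> x = grad (\<lambda>x. (1 - \<theta> x) * \<phi> x) x"
        by (rule grad_local[OF sg op True]) (simp add: \<psi>_def)
      moreover have "grad \<phi> x = grad (\<lambda>x. \<theta> x * \<phi> x + (1 - \<theta> x) * \<phi> x) x" by (simp add: algebra_simps)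
      ultimately show ?thesis
        by (simp add: grad_add[OF smooth_mult[OF w(1) sm] sg] inner_add_right)
    qed (simp add: u)
    then have "pairing u \<phi> = (\<integral>x. u x \<bullet> grad (\<lambda>x. \<theta> x * \<phi> x) x + u x \<bullet> grad \<psi> x \<partial>lborel)"
      by simp
    also have "\<dots> = pairing u (\<lambda>x. \<theta> x * \<phi> x) + pairing u \<psi>"
      by (intro Bochner_Integration.integral_add integrable_test(1)[OF test_fun_mult[OF \<phi> w(1)]]
           integrable_test(1)[OF \<open>test_fun \<Omega> \<psi>\<close>] u)
    finally show ?thesis using 0 by simp
  qed
  show ?thesis
  proof (rule that[of w f R])
    show "pairing u \<phi> = pairing w \<phi> + moment f \<phi>"
      if "test_fun UNIV \<phi>" for \<phi> using red[OF that] w(8)[OF that] by simp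
  qed (fact w)+
qed

section \<open>The divergence equation in the complement\<close>

text \<open>At a boundary point the height satisfies \<open>\<delta> p \<le> 0\<close>, so the point
  lowered by \<open>s\<close> has height at most \<open>- s\<close>. A ball with
  \<open>M * \<rho> < s\<close> around it stays below the graph. Away from the closure of
  \<open>\<Omega>\<close> the choice \<open>s = 0\<close> works. The bound by
  \<open>\<epsilon>\<close> allows the construction to be carried out inside any prescribed
  neighbourhood.\<close>

lemma complement_pushable:
  fixes \<Omega> :: "'a::euclidean_space set"
  assumes op: "open \<Omega>" and lb: "lipschitz_boundary \<Omega>" and p: "p \<notin> \<Omega>" and eps: "\<epsilon> > 0"
  obtains \<rho> s e where "\<rho> > 0" "norm e = 1" "s \<ge> 0" "s + \<rho> < \<epsilon>"
    "\<And>x \<tau>. x \<in> ball p \<rho> \<Longrightarrow> x \<notin> \<Omega> \<Longrightarrow> 0 \<le> \<tau> \<Longrightarrow> \<tau> \<le> s \<Longrightarrow> x - \<tau> *\<^sub>R e \<notin> \<Omega>"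
    "ball (p - s *\<^sub>R e) \<rho> \<inter> \<Omega> = {}"
proof (cases "p \<in> closure \<Omega>")
  case False
  then obtain d where d: "d > 0" "ball p d \<subseteq> - closure \<Omega>"
    using openE[of "- closure \<Omega>" p] by auto
  obtain e :: 'a where e: "e \<in> Basis" using nonempty_Basis by blast
  have "ball p (min d \<epsilon> / 2) \<subseteq> ball p d" by (rule subset_ball) (use d eps in auto)
  then have *: "ball p (min d \<epsilon> / 2) \<inter> \<Omega> = {}" using d(2) closure_subset[of \<Omega>] by blast
  show ?thesis
  proof (rule that[of "min d \<epsilon> / 2" e 0])
    show "norm e = 1" using e by simp
    show "ball (p - 0 *\<^sub>R e) (min d \<epsilon> / 2) \<inter> \<Omega> = {}" using * by simp
    show "x - \<tau> *\<^sub>R e \<notin> \<Omega>" if "x \<notin> \<Omega>" "0 \<le> \<tau>" "\<tau> \<le> 0" for x \<tau> using that by simp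
  qed (use d eps in auto)
next
  case True
  then have "p \<in> frontier \<Omega>" using p op by (simp add: frontier_def interior_open)
  then obtain e r L and \<gamma> :: "'a \<Rightarrow> real" where ch: "norm e = 1" "r > 0" "L-lipschitz_on {z. z \<bullet> e = 0} \<gamma>"
    "\<Omega> \<inter> ball p r = {x \<in> ball p r. x \<bullet> e > \<gamma> (x - (x \<bullet> e) *\<^sub>R e)}"
    using lb unfolding lipschitz_boundary_def by blast
  obtain \<delta> M where M: "M > 0" and Lip: "M-lipschitz_on UNIV \<delta>" and shift: "\<And>x t. \<delta> (x - t *\<^sub>R e) = \<delta> x - t"
    and iff: "\<And>x. x \<in> ball p r \<Longrightarrow> x \<in> \<Omega> \<longleftrightarrow> \<delta> x > 0"
    by (rule chart_height[OF ch(1,3,4)], rule that)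
  \<comment> \<open>The divisor 4, together with \<open>\<rho> \<le> s\<close>, leaves room in the
    chart for a ball of radius \<open>\<rho>\<close> pushed by \<open>s\<close>, and also gives
    \<open>s + \<rho> < \<epsilon>\<close>.\<close>
  define s where "s = min r \<epsilon> / 4"
  have s: "s > 0" "s \<le> r / 4" "s \<le> \<epsilon> / 4" using ch(2) eps by (auto simp: s_def)
  define \<rho> where "\<rho> = min s (s / (2 * M))"
  have \<rho>: "\<rho> > 0" "\<rho> \<le> s" "M * \<rho> < s"
  proof -
    show "\<rho> > 0" "\<rho> \<le> s" using s M by (auto simp: \<rho>_def)
    have "M * \<rho> \<le> M * (s / (2 * M))" using M by (intro mult_left_mono) (auto simp: \<rho>_def)
    also have "\<dots> = s / 2" using M by simp
    finally show "M * \<rho> < s" using s by simp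
  qed
  have \<delta>p: "\<delta> p \<le> 0" using iff[of p] p ch(2) by auto
  show ?thesis
  proof (rule that[of \<rho> e s])
    show "s + \<rho> < \<epsilon>" using \<rho> s eps by linarith
  next
    fix x \<tau> assume x: "x \<in> ball p \<rho>" "x \<notin> \<Omega>" "0 \<le> \<tau>" "\<tau> \<le> s"
    have "x \<in> ball p r" using x(1) \<rho>(2) s ch(2) by auto
    then have "\<delta> x \<le> 0" using iff x(2) by force
    have "dist x (x - \<tau> *\<^sub>R e) = \<tau>" using ch(1) x(3) by (simp add: dist_norm)
    then have "x - \<tau> *\<^sub>R e \<in> ball p r"
      using dist_triangle[of p "x - \<tau> *\<^sub>R e" x] x \<rho>(2) s ch(2) unfolding mem_ball by linarith
    then show "x - \<tau> *\<^sub>R e \<notin> \<Omega>" using iff shift[of x \<tau>] \<open>\<delta> x \<le> 0\<close> x(3) by auto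
  next
    show "ball (p - s *\<^sub>R e) \<rho> \<inter> \<Omega> = {}"
    proof (rule equals0I)
      fix z assume z: "z \<in> ball (p - s *\<^sub>R e) \<rho> \<inter> \<Omega>"
      have "dist p (p - s *\<^sub>R e) = s" using ch(1) s by (simp add: dist_norm)
      then have "z \<in> ball p r" using z dist_triangle[of p z "p - s *\<^sub>R e"] \<rho>(2) s by simp
      have "\<bar>\<delta> z - \<delta> (p - s *\<^sub>R e)\<bar> \<le> M * dist z (p - s *\<^sub>R e)"
        using lipschitz_onD[OF Lip, of z "p - s *\<^sub>R e"] by (simp add: dist_real_def)
      also have "\<dots> \<le> M * \<rho>" using z M by (intro mult_left_mono) (auto simp: dist_commute)
      finally have "\<delta> z < 0" using shift[of p s] \<delta>p \<rho>(3) by linarith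
      then show False using iff[OF \<open>z \<in> ball p r\<close>] z by auto
    qed
  qed (use ch s \<rho> in auto)
qed

text \<open>Up to the sign, \<open>f\<close> is the divergence of an integrable field that does not
  touch \<open>\<Omega>\<close>. Two densities whose difference has this property are
  interchangeable for the extension.\<close>

definition is_div :: "'a::euclidean_space set \<Rightarrow> ('a \<Rightarrow> real) \<Rightarrow> bool" where
  "is_div \<Omega> f \<longleftrightarrow> (\<exists>w. integrable lborel w \<and> (\<forall>x\<in>\<Omega>. w x = 0) \<and>
     (\<forall>\<phi>. test_fun UNIV \<phi> \<longrightarrow> moment f \<phi> = pairing w \<phi>))"

lemma is_div_lin:
  assumes "integrable lborel f" "integrable lborel g" "is_div \<Omega> f" "is_div \<Omega> g"
  shows "is_div \<Omega> (\<lambda>x. f x + c * g x)"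
proof -
  obtain w where w: "integrable lborel w" "\<And>x. x \<in> \<Omega> \<Longrightarrow> w x = 0"
     "\<And>\<phi>. test_fun UNIV \<phi> \<Longrightarrow> moment f \<phi> = pairing w \<phi>"
    using assms(3) unfolding is_div_def by auto
  obtain v where v: "integrable lborel v" "\<And>x. x \<in> \<Omega> \<Longrightarrow> v x = 0"
     "\<And>\<phi>. test_fun UNIV \<phi> \<Longrightarrow> moment g \<phi> = pairing v \<phi>"
    using assms(4) unfolding is_div_def by auto
  have "(\<integral>x. (f x + c * g x) * \<phi> x \<partial>lborel) = (\<integral>x. (w x + c *\<^sub>R v x) \<bullet> grad \<phi> x \<partial>lborel)" if \<phi>: "test_fun UNIV \<phi>" for \<phi>
    unfolding distrib_right inner_add_left inner_scaleR_left mult.assoc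
    by (simp add: integrable_test[OF \<phi>] assms w(1) v(1) w(3)[OF \<phi>] v(3)[OF \<phi>])
  then show ?thesis
    unfolding is_div_def using w v by (intro exI[of _ "\<lambda>x. w x + c *\<^sub>R v x"]) auto
qed

lemma is_div_cong: "is_div \<Omega> f \<Longrightarrow> (\<And>x. f x = g x) \<Longrightarrow> is_div \<Omega> g"
  by (metis ext)

lemma is_div_diff_trans:
  assumes "integrable lborel f" "integrable lborel g" "integrable lborel h"
    "is_div \<Omega> (\<lambda>x. f x - g x)" "is_div \<Omega> (\<lambda>x. g x - h x)"
  shows "is_div \<Omega> (\<lambda>x. f x - h x)"
  using is_div_lin[of "\<lambda>x. f x - g x" "\<lambda>x. g x - h x" \<Omega> 1] assms by simp

lemma is_div_diff_sym:
  assumes "integrable lborel f" "integrable lborel g" "is_div \<Omega> (\<lambda>x. f x - g x)"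
  shows "is_div \<Omega> (\<lambda>x. g x - f x)"
proof -
  have "is_div \<Omega> (\<lambda>x. (f x - g x) + (-2) * (f x - g x))"
    by (rule is_div_lin) (use assms in auto)
  then show ?thesis by (rule is_div_cong) simp
qed

text \<open>All mass moves by the same vector, and \<open>transport\<close> supplies the field,
  since by assumption the paths of the points carrying mass avoid \<open>\<Omega>\<close>.\<close>

lemma is_div_shift:
  assumes f: "integrable lborel f" and s: "s \<ge> 0" and e: "norm e = 1" and op: "open \<Omega>"
    and out: "\<And>x \<tau>. f x \<noteq> 0 \<Longrightarrow> 0 \<le> \<tau> \<Longrightarrow> \<tau> \<le> s \<Longrightarrow> x - \<tau> *\<^sub>R e \<notin> \<Omega>"
  shows "is_div \<Omega> (\<lambda>x. f x - f (x + s *\<^sub>R e))"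
proof -
  have seg: "x - s *\<^sub>R e + t *\<^sub>R (x - (x - s *\<^sub>R e)) = x - (s - t * s) *\<^sub>R e" for x t
    by (simp add: algebra_simps)
  obtain w where w: "integrable lborel w" "\<And>x. x \<in> \<Omega> \<Longrightarrow> w x = 0"
     "\<And>\<phi>. test_fun UNIV \<phi> \<Longrightarrow> (\<integral>x. f x * (\<phi> x - \<phi> (x - s *\<^sub>R e)) \<partial>lborel) = pairing w \<phi>"
  proof (rule transport[OF lborel.sigma_finite_measure_axioms f, of "\<lambda>x. x - s *\<^sub>R e" "\<lambda>x. x" s \<Omega>])
    fix t :: real and N :: "'a set" assume "N \<in> null_sets lborel"
    then have "AE x in lborel. x - (s - t * s) *\<^sub>R e \<notin> N" by (rule AE_lborel_translate)
    then show "AE x in lborel. f x \<noteq> 0 \<longrightarrow> x - s *\<^sub>R e + t *\<^sub>R (x - (x - s *\<^sub>R e)) \<notin> N"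
      unfolding seg by eventually_elim simp
  next
    fix x and t :: real assume h: "f x \<noteq> 0" and t: "0 \<le> t" "t \<le> 1"
    have "t * s \<le> s" "0 \<le> t * s" using t s by (auto simp: mult_left_le_one_le)
    then show "x - s *\<^sub>R e + t *\<^sub>R (x - (x - s *\<^sub>R e)) \<notin> \<Omega>"
      unfolding seg by (intro out h) auto
  qed (use op s e in \<open>auto intro: that\<close>)
  have i: "integrable lborel (\<lambda>x. f (x + s *\<^sub>R e))" using push_translate(1)[OF f] .
  have "(\<integral>x. (f x - f (x + s *\<^sub>R e)) * \<phi> x \<partial>lborel) = pairing w \<phi>" if \<phi>: "test_fun UNIV \<phi>" for \<phi>
  proof -
    have [measurable]: "\<phi> \<in> borel_measurable borel" using smooth_measurable[OF test_funD(1)[OF \<phi>]] .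
    obtain B where B: "\<And>x. \<bar>\<phi> x\<bar> \<le> B" by (rule test_fun_grad_bounded[OF \<phi>], rule that)
    have "(\<integral>x. (f x - f (x + s *\<^sub>R e)) * \<phi> x \<partial>lborel) = moment f \<phi> - (\<integral>x. f (x + s *\<^sub>R e) * \<phi> x \<partial>lborel)"
      unfolding left_diff_distrib by (intro Bochner_Integration.integral_diff integrable_test[OF \<phi>] f i)
    also have "(\<integral>x. f (x + s *\<^sub>R e) * \<phi> x \<partial>lborel) = (\<integral>x. f x * \<phi> (x - s *\<^sub>R e) \<partial>lborel)"
      using push_translate(3)[OF f, of \<phi> "s *\<^sub>R e"] by simp
    also have "moment f \<phi> - (\<integral>x. f x * \<phi> (x - s *\<^sub>R e) \<partial>lborel) = (\<integral>x. f x * (\<phi> x - \<phi> (x - s *\<^sub>R e)) \<partial>lborel)"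
      unfolding right_diff_distrib
      by (intro Bochner_Integration.integral_diff[symmetric] integrable_test[OF \<phi>] f integrable_mult_bounded_borel[OF f _ B]) auto
    finally show ?thesis using w(3)[OF \<phi>] by simp
  qed
  then show ?thesis unfolding is_div_def using w(1,2) by (intro exI[of _ w]) auto
qed

definition ball_mass :: "'a::euclidean_space \<Rightarrow> real \<Rightarrow> 'a \<Rightarrow> real" where
  "ball_mass q \<rho> x = indicator (ball q \<rho>) x / measure lborel (ball q \<rho>)"

lemma ball_mass_integrable: "integrable lborel (ball_mass q \<rho>)"
proof -
  have "integrable lborel (indicator (ball q \<rho>) :: 'a \<Rightarrow> real)"
    by (rule integrable_real_indicator) (use emeasure_bounded_finite[OF bounded_ball, of q \<rho>] in auto)
  then show ?thesis unfolding ball_mass_def[abs_def] by simp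
qed

lemma ball_mass_integral: "\<rho> > 0 \<Longrightarrow> (\<integral>x. ball_mass q \<rho> x \<partial>lborel) = 1"
  using content_ball_pos[of \<rho> q] by (simp add: ball_mass_def)

lemma ball_mass_outside: "x \<notin> ball q \<rho> \<Longrightarrow> ball_mass q \<rho> x = 0"
  by (simp add: ball_mass_def)

text \<open>The coupling is the product density \<open>f z * ball_mass q \<rho> y\<close>: every
  amount of mass at \<open>z\<close> is connected to all points \<open>y\<close> of the ball in
  equal proportion. Its marginals are \<open>f\<close> and the total mass of \<open>f\<close> times
  \<open>ball_mass\<close>, and convexity keeps the segments in the ball.\<close>

lemma is_div_ball:
  assumes f: "integrable lborel f" "\<And>x. x \<notin> ball q \<rho> \<Longrightarrow> f x = 0" and \<rho>: "\<rho> > 0"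
    and out: "ball q \<rho> \<inter> \<Omega> = {}" and op: "open \<Omega>"
  shows "is_div \<Omega> (\<lambda>x. f x - (\<integral>y. f y \<partial>lborel) * ball_mass q \<rho> x)"
proof -
  let ?b = "ball_mass q \<rho>"
  let ?M = "(lborel :: 'a measure) \<Otimes>\<^sub>M lborel"
  define h where "h = (\<lambda>(z, y). f z * ?b y)"
  have fm[measurable]: "f \<in> borel_measurable borel" "?b \<in> borel_measurable borel"
    using f(1) ball_mass_integrable[of q \<rho>] by auto
  have ip: "integrable ?M (\<lambda>(z, y). f z * (?b y * \<phi> z y))"
    if [measurable]: "(\<lambda>(z, y). \<phi> z y) \<in> borel_measurable ?M" and B: "\<And>z y. \<bar>\<phi> z y\<bar> \<le> B" for \<phi> :: "'a \<Rightarrow> 'a \<Rightarrow> real" and B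
  proof -
    have i0: "integrable ?M (\<lambda>(z, y). f z * ?b y)"
    proof (rule lborel_pair.Fubini_integrable)
      have "(\<lambda>z. \<integral>y. norm (case (z, y) of (z, y) \<Rightarrow> f z * ?b y) \<partial>lborel) = (\<lambda>z. \<bar>f z\<bar> * (\<integral>y. \<bar>?b y\<bar> \<partial>lborel))"
        by (simp add: abs_mult)
      then show "integrable lborel (\<lambda>z. \<integral>y. norm (case (z, y) of (z, y) \<Rightarrow> f z * ?b y) \<partial>lborel)"
        using f(1) by simp
    qed (use ball_mass_integrable[of q \<rho>] in auto)
    have "integrable ?M (\<lambda>p. (case p of (z, y) \<Rightarrow> f z * ?b y) * (case p of (z, y) \<Rightarrow> \<phi> z y))"
      by (rule integrable_mult_bounded_borel[OF i0]) (use B in auto)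
    then show ?thesis by (simp add: case_prod_beta' mult.assoc)
  qed
  have ih: "integrable ?M h" unfolding h_def using ip[of "\<lambda>_ _. 1" 1] by simp
  have hB: "z \<in> ball q \<rho> \<and> y \<in> ball q \<rho>" if "h (z, y) \<noteq> 0" for z y
    using that f(2)[of z] ball_mass_outside[of y q \<rho>] by (auto simp: h_def)
  obtain w where w: "integrable lborel w" "\<And>x. x \<in> \<Omega> \<Longrightarrow> w x = 0"
     "\<And>\<phi>. test_fun UNIV \<phi> \<Longrightarrow> (\<integral>m. h m * (\<phi> (fst m) - \<phi> (snd m)) \<partial>?M) = pairing w \<phi>"
  proof (rule transport[OF lborel_pair.sigma_finite_measure_axioms ih, of snd fst "2 * \<rho>" \<Omega>])
    show "norm (fst m - snd m) \<le> 2 * \<rho>" if "h m \<noteq> 0" for m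
    proof -
      have "dist (fst m) (snd m) \<le> dist q (fst m) + dist q (snd m)"
        using dist_triangle3 by (metis dist_commute)
      also have "\<dots> \<le> 2 * \<rho>" using hB[of "fst m" "snd m"] that by auto
      finally show ?thesis by (simp add: dist_norm)
    qed
  next
    fix t :: real and N :: "'a set" assume t: "0 < t" "t < 1" and N: "N \<in> null_sets lborel"
    have [measurable]: "N \<in> sets borel" using N by auto
    \<comment> \<open>With \<open>z\<close> frozen,
      \<open>y \<mapsto> t *\<^sub>R z + (1 - t) *\<^sub>R y\<close> has factor
      \<open>1 - t\<close>, nonzero since \<open>t < 1\<close>. At \<open>t = 1\<close> it would
      collapse to the point \<open>z\<close>.\<close>
    have "AE z in lborel. AE y in lborel. y + t *\<^sub>R (z - y) \<notin> N"
    proof (rule AE_I2)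
      fix z :: 'a
      have "AE y in lborel. t *\<^sub>R z + (1 - t) *\<^sub>R y \<notin> N" using t N by (intro AE_lborel_affine) auto
      then show "AE y in lborel. y + t *\<^sub>R (z - y) \<notin> N"
        by eventually_elim (simp add: algebra_simps)
    qed
    moreover have "{m \<in> space ?M. snd m + t *\<^sub>R (fst m - snd m) \<notin> N} \<in> sets ?M" by measurable
    ultimately have "AE m in ?M. snd m + t *\<^sub>R (fst m - snd m) \<notin> N"
      by (intro lborel_pair.AE_pair_measure) auto
    then show "AE m in ?M. h m \<noteq> 0 \<longrightarrow> snd m + t *\<^sub>R (fst m - snd m) \<notin> N" by eventually_elim simp
  next
    fix m and t :: real assume "h m \<noteq> 0" and t: "0 \<le> t" "t \<le> 1"
    then have "fst m \<in> ball q \<rho>" "snd m \<in> ball q \<rho>" using hB[of "fst m" "snd m"] by auto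
    then have "(1 - t) *\<^sub>R snd m + t *\<^sub>R fst m \<in> ball q \<rho>" using t by (intro convexD_alt[OF convex_ball])
    also have "(1 - t) *\<^sub>R snd m + t *\<^sub>R fst m = snd m + t *\<^sub>R (fst m - snd m)" by (simp add: algebra_simps)
    finally show "snd m + t *\<^sub>R (fst m - snd m) \<notin> \<Omega>" using out by blast
  qed (use op \<rho> in \<open>auto intro: that\<close>)
  have "(\<integral>x. (f x - (\<integral>y. f y \<partial>lborel) * ?b x) * \<phi> x \<partial>lborel) = pairing w \<phi>" if \<phi>: "test_fun UNIV \<phi>" for \<phi>
  proof -
    have [measurable]: "\<phi> \<in> borel_measurable borel" using smooth_measurable[OF test_funD(1)[OF \<phi>]] .
    obtain B where B: "\<And>x. \<bar>\<phi> x\<bar> \<le> B" by (rule test_fun_grad_bounded[OF \<phi>], rule that)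
    have i1: "integrable ?M (\<lambda>(z, y). f z * (?b y * \<phi> z))" by (rule ip[OF _ B]) auto
    have i2: "integrable ?M (\<lambda>(z, y). f z * (?b y * \<phi> y))" by (rule ip[OF _ B]) auto
    have "(\<integral>m. h m * (\<phi> (fst m) - \<phi> (snd m)) \<partial>?M)
      = (\<integral>m. (case m of (z, y) \<Rightarrow> f z * (?b y * \<phi> z)) - (case m of (z, y) \<Rightarrow> f z * (?b y * \<phi> y)) \<partial>?M)"
      by (rule Bochner_Integration.integral_cong) (auto simp: h_def algebra_simps)
    also have "\<dots> = (\<integral>m. (case m of (z, y) \<Rightarrow> f z * (?b y * \<phi> z)) \<partial>?M) - (\<integral>m. (case m of (z, y) \<Rightarrow> f z * (?b y * \<phi> y)) \<partial>?M)"
      by (rule Bochner_Integration.integral_diff[OF i1 i2])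
    also have "(\<integral>m. (case m of (z, y) \<Rightarrow> f z * (?b y * \<phi> z)) \<partial>?M) = (\<integral>z. (\<integral>y. f z * (?b y * \<phi> z) \<partial>lborel) \<partial>lborel)"
      using lborel_pair.integral_fst[OF i1] by simp
    also have "\<dots> = (\<integral>z. f z * \<phi> z \<partial>lborel)" by (simp add: ball_mass_integral[OF \<rho>])
    also have "(\<integral>m. (case m of (z, y) \<Rightarrow> f z * (?b y * \<phi> y)) \<partial>?M) = (\<integral>z. (\<integral>y. f z * (?b y * \<phi> y) \<partial>lborel) \<partial>lborel)"
      using lborel_pair.integral_fst[OF i2] by simp
    also have "\<dots> = (\<integral>y. f y \<partial>lborel) * (\<integral>y. ?b y * \<phi> y \<partial>lborel)" by simp
    finally have "pairing w \<phi> = (\<integral>z. f z * \<phi> z \<partial>lborel) - (\<integral>y. f y \<partial>lborel) * (\<integral>y. ?b y * \<phi> y \<partial>lborel)"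
      using w(3)[OF \<phi>] by simp
    moreover have "(\<integral>x. (f x - (\<integral>y. f y \<partial>lborel) * ?b x) * \<phi> x \<partial>lborel)
      = (\<integral>z. f z * \<phi> z \<partial>lborel) - (\<integral>x. (\<integral>y. f y \<partial>lborel) * (?b x * \<phi> x) \<partial>lborel)"
      unfolding left_diff_distrib mult.assoc
      by (intro Bochner_Integration.integral_diff integrable_test[OF \<phi>] f integrable_mult_right ball_mass_integrable)
    ultimately show ?thesis by simp
  qed
  then show ?thesis unfolding is_div_def using w(1,2) by (intro exI[of _ w]) auto
qed

text \<open>Mass located near \<open>p\<close> off \<open>\<Omega>\<close> may be concentrated into
  multiples of the one profile \<open>\<Phi>\<close>. The last clause records local connectedness of
  the complement, needed later to count its components.\<close>

definition absorbs :: "'a::euclidean_space set \<Rightarrow> 'a \<Rightarrow> real \<Rightarrow> ('a \<Rightarrow> real) \<Rightarrow> bool" where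
  "absorbs \<Omega> p \<rho> \<Phi> \<longleftrightarrow> \<rho> > 0 \<and> integrable lborel \<Phi> \<and>
     (\<forall>f. integrable lborel f \<longrightarrow> (\<forall>x. x \<in> \<Omega> \<longrightarrow> f x = 0) \<longrightarrow> (\<forall>x. x \<notin> ball p \<rho> \<longrightarrow> f x = 0) \<longrightarrow>
       is_div \<Omega> (\<lambda>x. f x - (\<integral>y. f y \<partial>lborel) * \<Phi> x)) \<and>
     (\<forall>x. x \<in> ball p \<rho> \<longrightarrow> x \<notin> \<Omega> \<longrightarrow> connected_component (- \<Omega>) p x)"

lemma absorbs_is_div:
  assumes "absorbs \<Omega> p \<rho> \<Phi>" "integrable lborel f"
    "\<And>x. x \<in> \<Omega> \<Longrightarrow> f x = 0" "\<And>x. x \<notin> ball p \<rho> \<Longrightarrow> f x = 0"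
  shows "is_div \<Omega> (\<lambda>x. f x - (\<integral>y. f y \<partial>lborel) * \<Phi> x)"
proof -
  note ab = assms(1)[unfolded absorbs_def, THEN conjunct2, THEN conjunct2, THEN conjunct1, rule_format]
  show ?thesis by (rule ab[OF assms(2-4)])
qed

text \<open>Near a boundary point the complement meets the ball in a region that need not be convex.
  Lowering by \<open>s\<close> moves the mass into a full ball off \<open>\<Omega>\<close>, where it
  can be spread evenly.\<close>

lemma local_mass:
  fixes \<Omega> :: "'a::euclidean_space set"
  assumes op: "open \<Omega>" and lb: "lipschitz_boundary \<Omega>" and p: "p \<notin> \<Omega>"
  shows "\<exists>\<rho> \<Phi>. absorbs \<Omega> p \<rho> \<Phi>"
proof -
  obtain \<rho> s e where l: "\<rho> > 0" "norm e = 1" "s \<ge> 0"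
    "\<And>x \<tau>. x \<in> ball p \<rho> \<Longrightarrow> x \<notin> \<Omega> \<Longrightarrow> 0 \<le> \<tau> \<Longrightarrow> \<tau> \<le> s \<Longrightarrow> x - \<tau> *\<^sub>R e \<notin> \<Omega>"
    "ball (p - s *\<^sub>R e) \<rho> \<inter> \<Omega> = {}"
    by (rule complement_pushable[OF op lb p zero_less_one], rule that)
  have "absorbs \<Omega> p \<rho> (ball_mass (p - s *\<^sub>R e) \<rho>)"
    unfolding absorbs_def
  proof (intro conjI allI impI l(1) ball_mass_integrable)
    fix f :: "'a \<Rightarrow> real" assume f0: "integrable lborel f" "\<forall>x. x \<in> \<Omega> \<longrightarrow> f x = 0" "\<forall>x. x \<notin> ball p \<rho> \<longrightarrow> f x = 0"
    have f: "integrable lborel f" "\<And>x. x \<in> \<Omega> \<Longrightarrow> f x = 0" "\<And>x. x \<notin> ball p \<rho> \<Longrightarrow> f x = 0"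
      using f0 by blast+
    have fm: "f \<in> borel_measurable borel" using f(1) by auto
    have i: "integrable lborel (\<lambda>x. f (x + s *\<^sub>R e))" using push_translate(1)[OF f(1)] .
    have "is_div \<Omega> (\<lambda>x. f x - f (x + s *\<^sub>R e))"
      by (rule is_div_shift[OF f(1) l(3,2) op]) (use l(4) f(2,3) in metis)
    moreover have "is_div \<Omega> (\<lambda>x. f (x + s *\<^sub>R e) - (\<integral>y. f (y + s *\<^sub>R e) \<partial>lborel) * ball_mass (p - s *\<^sub>R e) \<rho> x)"
    proof (rule is_div_ball[OF i _ l(1,5) op])
      fix x assume "x \<notin> ball (p - s *\<^sub>R e) \<rho>"
      then have "x + s *\<^sub>R e \<notin> ball p \<rho>" by (simp add: dist_norm algebra_simps)
      then show "f (x + s *\<^sub>R e) = 0" by (rule f(3))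
    qed
    moreover have "(\<integral>y. f (y + s *\<^sub>R e) \<partial>lborel) = (\<integral>y. f y \<partial>lborel)"
      using lborel_integral_affine[of 1 f "s *\<^sub>R e"] fm by (simp add: add.commute)
    ultimately show "is_div \<Omega> (\<lambda>x. f x - (\<integral>y. f y \<partial>lborel) * ball_mass (p - s *\<^sub>R e) \<rho> x)"
    proof -
      assume *: "is_div \<Omega> (\<lambda>x. f x - f (x + s *\<^sub>R e))"
        "is_div \<Omega> (\<lambda>x. f (x + s *\<^sub>R e) - (\<integral>y. f (y + s *\<^sub>R e) \<partial>lborel) * ball_mass (p - s *\<^sub>R e) \<rho> x)"
        "(\<integral>y. f (y + s *\<^sub>R e) \<partial>lborel) = (\<integral>y. f y \<partial>lborel)"
      show ?thesis
        by (rule is_div_diff_trans[OF f(1) i _ *(1) *(2)[unfolded *(3)]]) (intro integrable_mult_right ball_mass_integrable)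
    qed
  next
    fix x assume x: "x \<in> ball p \<rho>" "x \<notin> \<Omega>"
    \<comment> \<open>Two nearby points of the complement are joined by going down from one, across
      the lowered ball, and up to the other.\<close>
    have vert: "connected_component (- \<Omega>) x (x - s *\<^sub>R e)" if "x \<in> ball p \<rho>" "x \<notin> \<Omega>" for x
      unfolding connected_component_def
    proof (intro exI conjI)
      show "connected (closed_segment x (x - s *\<^sub>R e))" by (rule connected_segment)
      show "closed_segment x (x - s *\<^sub>R e) \<subseteq> - \<Omega>"
      proof
        fix z assume "z \<in> closed_segment x (x - s *\<^sub>R e)"
        then obtain u where u: "0 \<le> u" "u \<le> 1" "z = (1 - u) *\<^sub>R x + u *\<^sub>R (x - s *\<^sub>R e)" by (auto simp: closed_segment_def)
        then have "z = x - (u * s) *\<^sub>R e" by (simp add: algebra_simps)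
        moreover have "0 \<le> u * s" "u * s \<le> s" using u l(3) by (auto simp: mult_left_le_one_le)
        ultimately show "z \<in> - \<Omega>" using l(4)[OF that] by simp
      qed
    qed auto
    have "connected_component (- \<Omega>) (p - s *\<^sub>R e) (x - s *\<^sub>R e)"
      unfolding connected_component_def
    proof (intro exI conjI)
      show "connected (ball (p - s *\<^sub>R e) \<rho>)" by (rule connected_ball)
      show "x - s *\<^sub>R e \<in> ball (p - s *\<^sub>R e) \<rho>" using x(1) by (simp add: dist_norm)
    qed (use l in auto)
    moreover have "connected_component (- \<Omega>) p (p - s *\<^sub>R e)" using vert[of p] p l(1) by simp
    moreover have "connected_component (- \<Omega>) (x - s *\<^sub>R e) x" using vert[OF x] by (rule connected_component_sym)
    ultimately show "connected_component (- \<Omega>) p x" using connected_component_trans by metis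
  qed
  then show ?thesis by blast
qed

section \<open>From local masses to the components of the complement\<close>

lemma masses:
  fixes \<Omega> :: "'a::euclidean_space set"
  assumes op: "open \<Omega>" and lb: "lipschitz_boundary \<Omega>"
  obtains \<rho> \<Phi> where "\<And>p. p \<notin> \<Omega> \<Longrightarrow> absorbs \<Omega> p (\<rho> p) (\<Phi> p)"
proof -
  have "\<forall>p\<in>- \<Omega>. \<exists>RF. absorbs \<Omega> p (fst RF) (snd RF)"
    using local_mass[OF op lb] by simp
  from bchoice[OF this] obtain RF where RF: "\<forall>p\<in>- \<Omega>. absorbs \<Omega> p (fst (RF p)) (snd (RF p))" by (rule exE)
  show ?thesis by (rule that[of "\<lambda>p. fst (RF p)" "\<lambda>p. snd (RF p)"]) (use RF in simp)
qed

lemma closed_component: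
  assumes "open \<Omega>" "C \<in> components (- \<Omega>)"
  shows "closed C"
  using closed_components[of "- \<Omega>" C] assms by auto

text \<open>The profiles at different points of \<open>C\<close> are interchangeable: this is an
  equivalence relation whose classes are open in \<open>C\<close>, and \<open>C\<close> is
  connected. Compactness then splits \<open>f\<close> into finitely many absorbed pieces, all of
  them referred to one profile, whose coefficient is the total mass zero.\<close>

lemma is_div_component:
  fixes \<Omega> :: "'a::euclidean_space set"
  assumes op: "open \<Omega>" and lb: "lipschitz_boundary \<Omega>" and C: "C \<in> components (- \<Omega>)"
    and f: "integrable lborel f" "\<And>x. x \<notin> C \<Longrightarrow> f x = 0" "\<And>x. x \<notin> cball 0 R \<Longrightarrow> f x = 0"
    and f0: "(\<integral>x. f x \<partial>lborel) = 0"
  shows "is_div \<Omega> f"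
proof -
  obtain \<rho> \<Phi> where ab: "\<And>p. p \<notin> \<Omega> \<Longrightarrow> absorbs \<Omega> p (\<rho> p) (\<Phi> p)"
    by (rule masses[OF op lb], rule that)
  have \<rho>: "\<rho> p > 0" and i\<Phi>: "integrable lborel (\<Phi> p)" if "p \<notin> \<Omega>" for p
    using ab[OF that] by (simp_all add: absorbs_def)
  have loc: "is_div \<Omega> (\<lambda>x. f x - (\<integral>y. f y \<partial>lborel) * \<Phi> p x)"
    if "p \<notin> \<Omega>" "integrable lborel f" "\<And>x. x \<in> \<Omega> \<Longrightarrow> f x = 0" "\<And>x. x \<notin> ball p (\<rho> p) \<Longrightarrow> f x = 0" for p f
    by (rule absorbs_is_div[OF ab[OF that(1)] that(2-4)])
  have C\<Omega>: "x \<notin> \<Omega>" if "x \<in> C" for x using in_components_subset[OF C] that by auto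
  have clC: "closed C" by (rule closed_component[OF op C])
  obtain p0 where p0: "p0 \<in> C" using in_components_nonempty[OF C] by blast
  have chain: "is_div \<Omega> (\<lambda>x. \<Phi> a x - \<Phi> b x)" if "a \<in> C" "b \<in> C" for a b
    using in_components_connected[OF C] that
  proof (rule connected_equivalence_relation)
    show "is_div \<Omega> (\<lambda>z. \<Phi> y z - \<Phi> x z)" if "is_div \<Omega> (\<lambda>z. \<Phi> x z - \<Phi> y z)" "x \<in> C" "y \<in> C" for x y
      by (rule is_div_diff_sym[OF i\<Phi>[OF C\<Omega>[OF that(2)]] i\<Phi>[OF C\<Omega>[OF that(3)]] that(1)])
    show "is_div \<Omega> (\<lambda>z'. \<Phi> x z' - \<Phi> z z')" if "is_div \<Omega> (\<lambda>z. \<Phi> x z - \<Phi> y z)" "is_div \<Omega> (\<lambda>z'. \<Phi> y z' - \<Phi> z z')"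
      "x \<in> C" "y \<in> C" "z \<in> C" for x y z
      by (rule is_div_diff_trans[OF i\<Phi>[OF C\<Omega>[OF that(3)]] i\<Phi>[OF C\<Omega>[OF that(4)]] i\<Phi>[OF C\<Omega>[OF that(5)]] that(1,2)])
    fix a assume a: "a \<in> C"
    show "\<exists>T. openin (top_of_set C) T \<and> a \<in> T \<and> (\<forall>x\<in>T. is_div \<Omega> (\<lambda>z. \<Phi> a z - \<Phi> x z))"
    proof (intro exI conjI ballI)
      show "openin (top_of_set C) (C \<inter> ball a (\<rho> a))" by (intro openin_open_Int open_ball)
      show "a \<in> C \<inter> ball a (\<rho> a)" using a \<rho>[OF C\<Omega>[OF a]] by simp
      fix x assume x: "x \<in> C \<inter> ball a (\<rho> a)"
      then have xC: "x \<in> C" by simp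
      have "open (ball a (\<rho> a) \<inter> ball x (\<rho> x))" "x \<in> ball a (\<rho> a) \<inter> ball x (\<rho> x)"
        using x \<rho>[OF C\<Omega>[OF xC]] by auto
      then obtain d where d: "d > 0" "ball x d \<subseteq> ball a (\<rho> a) \<inter> ball x (\<rho> x)"
        using openE by blast
      \<comment> \<open>A small uniform mass off \<open>\<Omega>\<close> that lies in the absorbing
        balls of \<open>a\<close> and of \<open>x\<close> at once. Each of the two absorbs it with
        total mass 1, so both profiles are equivalent to it and hence to each other.\<close>
      obtain r s e where l: "r > 0" "norm e = 1" "s \<ge> 0" "s + r < d" "ball (x - s *\<^sub>R e) r \<inter> \<Omega> = {}"
        by (rule complement_pushable[OF op lb C\<Omega>[OF xC] d(1)], rule that)
      have sub: "ball (x - s *\<^sub>R e) r \<subseteq> ball x d"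
      proof
        fix z assume "z \<in> ball (x - s *\<^sub>R e) r"
        then show "z \<in> ball x d"
          using dist_triangle[of x z "x - s *\<^sub>R e"] l by (simp add: dist_norm)
      qed
      let ?b = "ball_mass (x - s *\<^sub>R e) r"
      have b0: "?b z = 0" if "z \<in> \<Omega>" for z using l(5) that by (intro ball_mass_outside) auto
      have ba: "?b z = 0" if "z \<notin> ball a (\<rho> a)" for z using sub d(2) that by (intro ball_mass_outside) blast
      have bx: "?b z = 0" if "z \<notin> ball x (\<rho> x)" for z using sub d(2) that by (intro ball_mass_outside) blast
      have 1: "is_div \<Omega> (\<lambda>z. ?b z - \<Phi> a z)"
        using loc[OF C\<Omega>[OF a] ball_mass_integrable b0 ba] ball_mass_integral[OF l(1), of "x - s *\<^sub>R e"] by simp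
      have 2: "is_div \<Omega> (\<lambda>z. ?b z - \<Phi> x z)"
        using loc[OF C\<Omega>[OF xC] ball_mass_integrable b0 bx] ball_mass_integral[OF l(1), of "x - s *\<^sub>R e"] by simp
      note ia = i\<Phi>[OF C\<Omega>[OF a]] and ix = i\<Phi>[OF C\<Omega>[OF xC]]
      show "is_div \<Omega> (\<lambda>z. \<Phi> a z - \<Phi> x z)"
        by (rule is_div_diff_trans[OF ia ball_mass_integrable ix is_div_diff_sym[OF ball_mass_integrable ia 1] 2])
    qed
  qed
  have "compact (C \<inter> cball 0 R)" using clC by (simp add: closed_Int_compact)
  then obtain P where P: "P \<subseteq> C" "finite P" "C \<inter> cball 0 R \<subseteq> (\<Union>p\<in>P. ball p (\<rho> p))"
  proof (rule compactE_image[of _ C "\<lambda>p. ball p (\<rho> p)"])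
    show "C \<inter> cball 0 R \<subseteq> (\<Union>p\<in>C. ball p (\<rho> p))" using \<rho>[OF C\<Omega>] by force
  qed auto
  have "is_div \<Omega> (\<lambda>x. h x - (\<integral>y. h y \<partial>lborel) * \<Phi> p0 x)"
    if "integrable lborel h" "\<And>x. x \<notin> C \<Longrightarrow> h x = 0" "\<And>x. x \<notin> (\<Union>p\<in>P. ball p (\<rho> p)) \<Longrightarrow> h x = 0" for h
    using P(2,1) that
  proof (induction arbitrary: h)
    case empty
    then have "h = (\<lambda>x. 0)" by auto
    then show ?case unfolding is_div_def by (intro exI[of _ "\<lambda>x. 0"]) auto
  next
    case (insert p P)
    let ?B = "ball p (\<rho> p)"
    \<comment> \<open>The part inside the ball of \<open>p\<close> is absorbed there and referred to
      \<open>p0\<close> by \<open>chain\<close>; the rest lives on the remaining balls and falls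
      under the induction hypothesis.\<close>
    define h1 where "h1 x = indicator ?B x * h x" for x
    define h2 where "h2 x = indicator (- ?B) x * h x" for x
    have i: "integrable lborel h1" "integrable lborel h2"
      unfolding h1_def h2_def using integrable_mult_indicator[OF _ insert.prems(2), of ?B]
        integrable_mult_indicator[OF _ insert.prems(2), of "- ?B"] by auto
    have hs: "h x = h1 x + h2 x" for x by (simp add: h1_def h2_def indicator_def)
    have p: "p \<in> C" using insert.prems(1) by simp
    have "is_div \<Omega> (\<lambda>x. h1 x - (\<integral>y. h1 y \<partial>lborel) * \<Phi> p x)"
    proof (rule loc[OF C\<Omega>[OF p] i(1)])
      show "h1 x = 0" if "x \<in> \<Omega>" for x
      proof -
        have "x \<notin> C" using C\<Omega> that by blast
        then show ?thesis using insert.prems(3) by (simp add: h1_def)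
      qed
    qed (simp add: h1_def)
    from is_div_lin[OF _ _ this chain[OF p p0], of "\<integral>y. h1 y \<partial>lborel"]
    have 1: "is_div \<Omega> (\<lambda>x. h1 x - (\<integral>y. h1 y \<partial>lborel) * \<Phi> p0 x)"
      using i i\<Phi>[OF C\<Omega>[OF p]] i\<Phi>[OF C\<Omega>[OF p0]] by (simp add: algebra_simps)
    have 2: "is_div \<Omega> (\<lambda>x. h2 x - (\<integral>y. h2 y \<partial>lborel) * \<Phi> p0 x)"
    proof (rule insert.IH[OF _ i(2)])
      show "P \<subseteq> C" using insert.prems(1) by simp
      show "h2 x = 0" if "x \<notin> C" for x using insert.prems(3)[OF that] by (simp add: h2_def)
      show "h2 x = 0" if "x \<notin> (\<Union>p\<in>P. ball p (\<rho> p))" for x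
        using insert.prems(4)[of x] that by (cases "x \<in> ?B") (auto simp: h2_def)
    qed
    have "(\<integral>y. h y \<partial>lborel) = (\<integral>y. h1 y \<partial>lborel) + (\<integral>y. h2 y \<partial>lborel)"
      unfolding hs using i by simp
    with is_div_lin[OF _ _ 1 2, of 1] show ?case
      using i i\<Phi>[OF C\<Omega>[OF p0]] by (simp add: hs algebra_simps)
  qed
  note main = this
  have "f x = 0" if "x \<notin> (\<Union>p\<in>P. ball p (\<rho> p))" for x
  proof (cases "x \<in> C")
    case True
    then have "x \<notin> cball 0 R" using P(3) that by blast
    then show ?thesis by (rule f(3))
  qed (rule f(2))
  from main[OF f(1,2) this] have "is_div \<Omega> (\<lambda>x. f x - (\<integral>y. f y \<partial>lborel) * \<Phi> p0 x)" .
  then show ?thesis using f0 by simp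
qed

text \<open>Each absorbing ball meets only the component of its centre, and finitely many of them
  cover the complement inside a large closed ball. Components reaching outside that ball also meet
  it, by radial retraction.\<close>

lemma finite_components_complement:
  fixes \<Omega> :: "'a::euclidean_space set"
  assumes op: "open \<Omega>" and lb: "lipschitz_boundary \<Omega>" and bd: "bounded \<Omega>"
  shows "finite (components (- \<Omega>))"
proof -
  obtain R where R: "R > 0" "\<Omega> \<subseteq> ball 0 R" using bd bounded_subset_ballD by blast
  obtain \<rho> \<Phi> where ab: "\<And>p. p \<notin> \<Omega> \<Longrightarrow> absorbs \<Omega> p (\<rho> p) (\<Phi> p)"
    by (rule masses[OF op lb], rule that)
  have \<rho>: "\<rho> p > 0" and comp: "x \<in> ball p (\<rho> p) \<Longrightarrow> x \<notin> \<Omega> \<Longrightarrow> connected_component (- \<Omega>) p x"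
    if "p \<notin> \<Omega>" for p x using ab[OF that] by (simp_all add: absorbs_def)
  have "compact (cball 0 R - \<Omega>)" using op by (intro compact_diff) auto
  then obtain P where P: "P \<subseteq> - \<Omega>" "finite P" "cball 0 R - \<Omega> \<subseteq> (\<Union>p\<in>P. ball p (\<rho> p))"
  proof (rule compactE_image[of _ "- \<Omega>" "\<lambda>p. ball p (\<rho> p)"])
    show "cball 0 R - \<Omega> \<subseteq> (\<Union>p\<in>- \<Omega>. ball p (\<rho> p))" using \<rho> by force
  qed auto
  have "components (- \<Omega>) \<subseteq> connected_component_set (- \<Omega>) ` P"
  proof
    fix C assume C: "C \<in> components (- \<Omega>)"
    then obtain x where x: "x \<in> - \<Omega>" "C = connected_component_set (- \<Omega>) x" by (auto simp: components_def)
    have "\<exists>z. z \<in> cball 0 R \<and> z \<notin> \<Omega> \<and> connected_component (- \<Omega>) x z"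
    proof (cases "x \<in> cball 0 R")
      case True
      then show ?thesis using x(1) by (intro exI[of _ x]) auto
    next
      case False
      \<comment> \<open>The segment from \<open>x\<close> to its radial projection stays at norm at
        least \<open>R\<close>, hence off \<open>\<Omega>\<close>.\<close>
      define z where "z = (R / norm x) *\<^sub>R x"
      have nx: "norm x > R" using False by simp
      have seg: "closed_segment x z \<subseteq> - \<Omega>"
      proof
        fix y assume "y \<in> closed_segment x z"
        then obtain u where u: "0 \<le> u" "u \<le> 1" "y = (1 - u) *\<^sub>R x + u *\<^sub>R z" by (auto simp: closed_segment_def)
        have "y = ((1 - u) + u * (R / norm x)) *\<^sub>R x" unfolding u(3) z_def by (simp add: scaleR_add_left)
        then have "norm y = \<bar>(1 - u) + u * (R / norm x)\<bar> * norm x" by simp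
        also have "\<dots> = ((1 - u) + u * (R / norm x)) * norm x"
          using u R nx by (subst abs_of_nonneg) (auto intro!: add_nonneg_nonneg mult_nonneg_nonneg divide_nonneg_nonneg)
        also have "\<dots> = (1 - u) * norm x + u * R" using nx R by (cases "x = 0") (simp_all add: distrib_right)
        also have "\<dots> \<ge> (1 - u) * R + u * R" using u nx by (intro add_mono mult_left_mono) auto
        finally have "norm y \<ge> R" by (simp add: algebra_simps)
        then show "y \<in> - \<Omega>" using R(2) by auto
      qed
      have "connected_component (- \<Omega>) x z"
        unfolding connected_component_def using seg by (intro exI[of _ "closed_segment x z"]) auto
      moreover have "z \<in> cball 0 R" using nx R by (simp add: z_def)
      moreover have "z \<notin> \<Omega>" using seg by auto
      ultimately show ?thesis by blast
    qed
    then obtain z where z: "z \<in> cball 0 R" "z \<notin> \<Omega>" "connected_component (- \<Omega>) x z" by blast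
    then obtain p where p: "p \<in> P" "z \<in> ball p (\<rho> p)" using P(3) by blast
    have "p \<notin> \<Omega>" using p(1) P(1) by blast
    then have "connected_component (- \<Omega>) p z" using comp p(2) z(2) by blast
    then have "connected_component_set (- \<Omega>) p = connected_component_set (- \<Omega>) x"
      using z(3) connected_component_eq by (metis mem_Collect_eq)
    then show "C \<in> connected_component_set (- \<Omega>) ` P" using x(2) p(1) by blast
  qed
  then show ?thesis using P(2) finite_surj by blast
qed

text \<open>A density on the complement is the finite sum of its restrictions to the components, and
  each restriction is handled by \<open>is_div_component\<close>.\<close>

lemma is_div_balanced:
  fixes \<Omega> :: "'a::euclidean_space set"
  assumes op: "open \<Omega>" and lb: "lipschitz_boundary \<Omega>" and bd: "bounded \<Omega>"
    and f: "integrable lborel f" "\<And>x. x \<in> \<Omega> \<Longrightarrow> f x = 0" "\<And>x. x \<notin> cball 0 R \<Longrightarrow> f x = 0"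
    and f0: "\<And>C. C \<in> components (- \<Omega>) \<Longrightarrow> moment (indicator C) f = 0"
  shows "is_div \<Omega> f"
proof -
  have iC: "integrable lborel (\<lambda>x. indicator C x * f x)" if "C \<in> components (- \<Omega>)" for C
    using integrable_mult_indicator[OF _ f(1), of C] closed_component[OF op that] by simp
  have "is_div \<Omega> (\<lambda>x. \<Sum>C\<in>F. indicator C x * f x)" if "finite F" "F \<subseteq> components (- \<Omega>)" for F
    using that
  proof induction
    case empty
    show ?case unfolding is_div_def by (intro exI[of _ "\<lambda>x. 0"]) auto
  next
    case (insert C F)
    have "is_div \<Omega> (\<lambda>x. indicator C x * f x)"
      by (rule is_div_component[OF op lb, of C _ R]) (use insert.prems iC f f0 in auto)
    moreover have "integrable lborel (\<lambda>x. \<Sum>C\<in>F. indicator C x * f x)"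
      using insert.prems iC by (intro Bochner_Integration.integrable_sum) auto
    ultimately show ?case
    proof -
      assume *: "is_div \<Omega> (\<lambda>x. indicator C x * f x)" "integrable lborel (\<lambda>x. \<Sum>C\<in>F. indicator C x * f x)"
      have "is_div \<Omega> (\<lambda>x. indicator C x * f x + 1 * (\<Sum>C\<in>F. indicator C x * f x))"
        by (rule is_div_lin[OF _ *(2,1)]) (use insert in \<open>simp_all only: iC insert_subset\<close>)
      then show ?case by (rule is_div_cong) (simp only: sum.insert[OF insert.hyps] mult_1)
    qed
  qed
  from this[OF finite_components_complement[OF op lb bd] order_refl] show ?thesis
  proof (rule is_div_cong)
    fix x
    show "(\<Sum>C\<in>components (- \<Omega>). indicator C x * f x) = f x"
    proof (cases "x \<in> \<Omega>")
      case False
      then obtain C where C: "C \<in> components (- \<Omega>)" "x \<in> C" using Union_components[of "- \<Omega>"] by blast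
      have "(\<Sum>C\<in>components (- \<Omega>). indicator C x * f x) = (\<Sum>D\<in>components (- \<Omega>). if D = C then f x else 0)"
        by (rule sum.cong) (use C components_nonoverlap[of _ "- \<Omega>" C] in \<open>auto simp: indicator_def\<close>)
      then show ?thesis using C finite_components_complement[OF op lb bd] by simp
    qed (simp add: f)
  qed
qed

section \<open>The radial field\<close>

definition shell :: "'a::euclidean_space set" where
  "shell = {x. 1 \<le> norm x \<and> norm x < 2}"

lemma shell_borel [measurable]: "(shell :: 'a::euclidean_space set) \<in> sets borel"
  unfolding shell_def by measurable

lemma shell_emeasure: "emeasure lborel (shell :: 'a::euclidean_space set) < \<infinity>"
proof (rule emeasure_bounded_finite)
  show "bounded (shell :: 'a set)" unfolding bounded_iff shell_def by (intro exI[of _ 2]) auto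
qed

lemma shell_integrable: "integrable lborel (indicator (shell :: 'a::euclidean_space set) :: 'a \<Rightarrow> real)"
  by (rule integrable_real_indicator) (use shell_emeasure in auto)

lemma shell_pos: "measure lborel (shell :: 'a::euclidean_space set) > 0"
proof -
  obtain e :: 'a where e: "e \<in> Basis" using nonempty_Basis by blast
  have "ball ((3 / 2) *\<^sub>R e) (1 / 4) \<subseteq> (shell :: 'a set)"
  proof
    fix x assume "x \<in> ball ((3 / 2) *\<^sub>R e) (1 / 4)"
    then have "norm ((3 / 2) *\<^sub>R e - x) < 1 / 4" by (simp add: dist_norm)
    moreover have "norm ((3 / 2) *\<^sub>R e) = 3 / 2" using e by simp
    ultimately show "x \<in> shell"
      using norm_triangle_ineq2[of "(3 / 2) *\<^sub>R e" x] norm_triangle_ineq3[of "(3 / 2) *\<^sub>R e" x]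
      unfolding shell_def mem_Collect_eq by linarith
  qed
  then have "measure lborel (ball ((3 / 2) *\<^sub>R e) (1 / 4)) \<le> measure lborel (shell :: 'a set)"
    using shell_emeasure by (intro measure_mono_fmeasurable) (auto simp: fmeasurable_def)
  then show ?thesis using content_ball_pos[of "1 / 4" "(3 / 2) *\<^sub>R e"] by linarith
qed

text \<open>For \<open>norm y = t\<close> the interval consists of exactly those
  \<open>r > 0\<close> for which \<open>y\<close> lies in the shell dilated by \<open>r\<close>. The
  half-open interval reflects the half-open shell.\<close>

lemma integral_inverse_power:
  assumes "t > (0::real)" "n > 0"
  shows "(\<integral>r. indicator {t / 2<..t} r * (1 / r ^ (n + 1)) \<partial>lborel) = ((2 ^ n - 1) / real n) / t ^ n"
proof -
  have "(\<integral>r. indicator {t / 2..t} r *\<^sub>R (1 / r ^ (n + 1)) \<partial>lborel) = (- 1 / n) * inverse t ^ n - (- 1 / n) * inverse (t / 2) ^ n"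
  proof (rule integral_FTC_atLeastAtMost)
    fix r assume r: "t / 2 \<le> r" "r \<le> t"
    then have "r > 0" using assms by linarith
    obtain k where n: "n = Suc k" using assms(2) by (cases n) auto
    have "((\<lambda>r. (- 1 / n) * inverse r ^ n) has_real_derivative (- 1 / n) * ((1 + real k) * (- (inverse r ^ Suc (Suc 0)) * inverse r ^ k))) (at r)"
      unfolding n using \<open>r > 0\<close> by (intro DERIV_cmult DERIV_power_Suc DERIV_inverse) simp
    also have "(- 1 / n) * ((1 + real k) * (- (inverse r ^ Suc (Suc 0)) * inverse r ^ k)) = 1 / r ^ (n + 1)"
    proof -
      have gen: "(- 1 / real n) * ((1 + real k) * (- a * b)) = a * b" for a b :: real
        unfolding n by (simp add: field_simps)
      have "inverse r ^ Suc (Suc 0) * inverse r ^ k = inverse r ^ (n + 1)"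
        unfolding n power_add[symmetric] by (rule arg_cong[of _ _ "power (inverse r)"]) simp
      also have "\<dots> = 1 / r ^ (n + 1)" by (simp only: inverse_eq_divide power_one_over)
      finally show ?thesis unfolding gen .
    qed
    finally show "((\<lambda>r. (- 1 / n) * inverse r ^ n) has_vector_derivative (1 / r ^ (n + 1))) (at r within {t / 2..t})"
      unfolding has_real_derivative_iff_has_vector_derivative by (rule has_vector_derivative_at_within)
  next
    show "continuous_on {t / 2..t} (\<lambda>r. 1 / r ^ (n + 1))" using assms by (intro continuous_intros) auto
  qed (use assms in auto)
  also have "\<dots> = ((2 ^ n - 1) / real n) / t ^ n"
    using assms by (simp add: power_divide power_inverse field_simps)
  also have "(\<integral>r. indicator {t / 2..t} r *\<^sub>R (1 / r ^ (n + 1)) \<partial>lborel) = (\<integral>r. indicator {t / 2<..t} r * (1 / r ^ (n + 1)) \<partial>lborel)"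
  proof (rule integral_cong_AE)
    have "AE r in lborel. r \<noteq> t / 2" by (rule AE_lborel_singleton)
    then show "AE r in lborel. indicator {t / 2..t} r *\<^sub>R (1 / r ^ (n + 1)) = indicator {t / 2<..t} r * (1 / r ^ (n + 1))"
      by eventually_elim (auto simp: indicator_def)
  qed auto
  finally show ?thesis .
qed

text \<open>Averaging over the dilates of a fixed shell produces the weight \<open>norm y ^ - n\<close>;
  this replaces polar coordinates.\<close>

lemma dilated_shell_average:
  fixes H :: "'a::euclidean_space \<Rightarrow> real"
  assumes H[measurable]: "H \<in> borel_measurable borel" and B: "\<And>y. \<bar>H y\<bar> \<le> B * norm y" "B \<ge> 0"
    and R: "\<And>y. y \<notin> cball 0 R \<Longrightarrow> H y = 0" "R \<ge> 0"
  shows "integrable lborel (\<lambda>y. H y / norm y ^ DIM('a))"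
    and "((2 ^ DIM('a) - 1) / real DIM('a)) * (\<integral>y. H y / norm y ^ DIM('a) \<partial>lborel)
      = (\<integral>r. indicator {0<..} r * (1 / r) * (\<integral>x. indicator shell x * H (r *\<^sub>R x) \<partial>lborel) \<partial>lborel)"
proof -
  let ?n = "DIM('a)"
  define C where "C = (2 ^ ?n - 1) / real ?n"
  have "(2::real) ^ ?n > 1" by (rule one_less_power) auto
  then have C: "C > 0" by (simp add: C_def)
  \<comment> \<open>Substituting \<open>y = r x\<close> in the shell integral yields
    \<open>r ^ - n\<close>, and the measure \<open>dr / r\<close> contributes one more power. This
    is the origin of the exponent \<open>n + 1\<close>.\<close>
  define F :: "real \<Rightarrow> 'a \<Rightarrow> real" where
    "F r y = indicator {0<..} r * (1 / r ^ (?n + 1)) * indicator shell ((1 / r) *\<^sub>R y) * H y" for r y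
  have Fm[measurable]: "(\<lambda>(r, y). F r y) \<in> borel_measurable (lborel \<Otimes>\<^sub>M lborel)"
    unfolding F_def by measurable
  have sub: "(\<integral>y. indicator {0<..} r * (1 / r ^ (?n + 1)) * indicator shell ((1 / r) *\<^sub>R y) * Q y \<partial>lborel)
    = indicator {0<..} r * (1 / r) * (\<integral>x. indicator shell x * Q (r *\<^sub>R x) \<partial>lborel)"
    if [measurable]: "Q \<in> borel_measurable borel" for Q :: "'a \<Rightarrow> real" and r :: real
  proof (cases "r > 0")
    case True
    have "(\<integral>x. indicator shell x * Q (r *\<^sub>R x) \<partial>lborel) = (1 / r ^ ?n) * (\<integral>y. indicator shell ((1 / r) *\<^sub>R y) * Q y \<partial>lborel)"
      using lborel_integral_affine[of r "\<lambda>y::'a. indicator shell ((1 / r) *\<^sub>R y) * Q y" 0] True by simp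
    then show ?thesis using True by (simp add: mult.assoc)
  qed simp
  have Hbd: "\<bar>H y\<bar> \<le> B * R * indicator (cball 0 R) y" for y
  proof (cases "y \<in> cball 0 R")
    case True
    then have "B * norm y \<le> B * R" using B(2) by (intro mult_left_mono) auto
    then show ?thesis using True B(1)[of y] by simp
  qed (use R in simp)
  have icb: "integrable lborel (indicator (cball 0 R) :: 'a \<Rightarrow> real)"
    by (rule integrable_real_indicator) (use emeasure_bounded_finite[OF bounded_cball, of "0::'a" R] in auto)
  have iy: "integrable lborel (F r)" for r
  proof (rule Bochner_Integration.integrable_bound)
    show "integrable lborel (\<lambda>y::'a. \<bar>1 / r ^ (?n + 1)\<bar> * (B * R * indicator (cball 0 R) y))"
      using icb by (intro integrable_mult_right) simp
    show "AE y in lborel. norm (F r y) \<le> norm (\<bar>1 / r ^ (?n + 1)\<bar> * (B * R * indicator (cball 0 R) y))"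
    proof (rule AE_I2)
      fix y
      have "norm (F r y) \<le> \<bar>1 / r ^ (?n + 1)\<bar> * \<bar>H y\<bar>"
      proof (cases "0 < r")
        case False
        then have "norm (F r y) = 0" by (simp add: F_def)
        then show ?thesis by (simp only: mult_nonneg_nonneg abs_ge_zero)
      qed (auto simp: F_def abs_mult indicator_def)
      also have "\<dots> \<le> \<bar>1 / r ^ (?n + 1)\<bar> * (B * R * indicator (cball 0 R) y)"
        by (intro mult_left_mono Hbd) auto
      finally show "norm (F r y) \<le> norm (\<bar>1 / r ^ (?n + 1)\<bar> * (B * R * indicator (cball 0 R) y))"
        unfolding real_norm_def by (rule order_trans) (rule abs_ge_self)
    qed
  qed (simp add: F_def)
  \<comment> \<open>The linear bound on \<open>H\<close> produces a factor \<open>r\<close> that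
    cancels \<open>1 / r\<close>. Since the shell lies outside the open unit ball, only
    \<open>r \<le> R\<close> contributes, so the integral in \<open>r\<close> is finite.\<close>
  have iF: "integrable (lborel \<Otimes>\<^sub>M lborel) (\<lambda>(r, y). F r y)"
  proof (rule lborel_pair.Fubini_integrable)
    show "integrable lborel (\<lambda>r. \<integral>y. norm (case (r, y) of (r, y) \<Rightarrow> F r y) \<partial>lborel)"
    proof (rule Bochner_Integration.integrable_bound)
      show "integrable lborel (\<lambda>r::real. (2 * B * measure lborel (shell :: 'a set)) * indicator {0..R} r)"
        by (intro integrable_mult_right integrable_real_indicator) (use R in auto)
      show "AE r in lborel. norm (\<integral>y. norm (case (r, y) of (r, y) \<Rightarrow> F r y) \<partial>lborel)
        \<le> norm ((2 * B * measure lborel (shell :: 'a set)) * indicator {0..R} r)"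
      proof (rule AE_I2)
        fix r :: real
        have "(\<integral>y. norm (case (r, y) of (r, y) \<Rightarrow> F r y) \<partial>lborel)
          = (\<integral>y. indicator {0<..} r * (1 / r ^ (?n + 1)) * indicator shell ((1 / r) *\<^sub>R y) * \<bar>H y\<bar> \<partial>lborel)"
          by (rule Bochner_Integration.integral_cong) (auto simp: F_def abs_mult indicator_def)
        also have "\<dots> = indicator {0<..} r * (1 / r) * (\<integral>x. indicator shell x * \<bar>H (r *\<^sub>R x)\<bar> \<partial>lborel)"
          by (rule sub) measurable
        also have "\<dots> \<le> (2 * B * measure lborel (shell :: 'a set)) * indicator {0..R} r"
        proof (cases "0 < r")
          case True
          have le: "indicator shell x * \<bar>H (r *\<^sub>R x)\<bar> \<le> (2 * B * r * indicator {0..R} r) * indicator shell x" for x :: 'a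
          proof (cases "x \<in> shell")
            case x: True
            show ?thesis
            proof (cases "r \<le> R")
              case True
              have "\<bar>H (r *\<^sub>R x)\<bar> \<le> B * (r * norm x)" using B(1)[of "r *\<^sub>R x"] \<open>0 < r\<close> by simp
              also have "\<dots> \<le> B * (r * 2)" using x B(2) \<open>0 < r\<close> by (intro mult_left_mono) (auto simp: shell_def)
              finally show ?thesis using x True \<open>0 < r\<close> by simp
            next
              case False
              have "r * 1 \<le> r * norm x" using x \<open>0 < r\<close> by (intro mult_left_mono) (auto simp: shell_def)
              then have "R < r * norm x" using False by linarith
              then have "r *\<^sub>R x \<notin> cball 0 R" using \<open>0 < r\<close> by simp
              then show ?thesis using R(1) False by simp
            qed
          qed simp
          have "(\<integral>x. indicator shell x * \<bar>H (r *\<^sub>R x)\<bar> \<partial>lborel) \<le> (\<integral>x. (2 * B * r * indicator {0..R} r) * indicator shell (x::'a) \<partial>lborel)"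
          proof (rule integral_mono_AE)
            show "integrable lborel (\<lambda>x::'a. (2 * B * r * indicator {0..R} r) * indicator shell x)"
              using shell_integrable by (rule integrable_mult_right)
            then show "integrable lborel (\<lambda>x::'a. indicator shell x * \<bar>H (r *\<^sub>R x)\<bar>)"
            proof (rule Bochner_Integration.integrable_bound)
              show "AE x in lborel. norm (indicator shell x * \<bar>H (r *\<^sub>R x)\<bar>) \<le> norm ((2 * B * r * indicator {0..R} r) * indicator shell (x::'a))"
              proof (rule AE_I2)
                fix x :: 'a
                have "norm (indicator shell x * \<bar>H (r *\<^sub>R x)\<bar>) = indicator shell x * \<bar>H (r *\<^sub>R x)\<bar>" by simp
                also note le
                finally show "norm (indicator shell x * \<bar>H (r *\<^sub>R x)\<bar>) \<le> norm ((2 * B * r * indicator {0..R} r) * indicator shell x)"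
                  unfolding real_norm_def by (rule order_trans) (rule abs_ge_self)
              qed
            qed measurable
          qed (use le in auto)
          also have "\<dots> = r * ((2 * B * measure lborel (shell :: 'a set)) * indicator {0..R} r)"
            by (simp add: mult_ac)
          finally have "(1 / r) * (\<integral>x. indicator shell x * \<bar>H (r *\<^sub>R x)\<bar> \<partial>lborel)
             \<le> (1 / r) * (r * ((2 * B * measure lborel (shell :: 'a set)) * indicator {0..R} r))"
            using True by (intro mult_left_mono) auto
          then show ?thesis using True by simp
        qed (use B in simp)
        finally show "norm (\<integral>y. norm (case (r, y) of (r, y) \<Rightarrow> F r y) \<partial>lborel)
          \<le> norm ((2 * B * measure lborel (shell :: 'a set)) * indicator {0..R} r)"
          by simp
      qed
    qed measurable
    show "AE r in lborel. integrable lborel (\<lambda>y. case (r, y) of (r, y) \<Rightarrow> F r y)" using iy by simp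
  qed simp
  have inner: "(\<integral>r. F r y \<partial>lborel) = C * (H y / norm y ^ ?n)" for y
  proof (cases "y = 0")
    case True
    then have "H y = 0" using B(1)[of y] by simp
    then show ?thesis by (simp add: F_def)
  next
    case False
    then have ny: "norm y > 0" by simp
    have "(\<integral>r. F r y \<partial>lborel) = (\<integral>r. H y * (indicator {norm y / 2<..norm y} r * (1 / r ^ (?n + 1))) \<partial>lborel)"
    proof (rule Bochner_Integration.integral_cong[OF refl])
      fix r :: real
      have "r > 0 \<Longrightarrow> (1 / r) *\<^sub>R y \<in> shell \<longleftrightarrow> r \<in> {norm y / 2<..norm y}"
        by (auto simp: shell_def field_simps)
      moreover have "\<not> r > 0 \<Longrightarrow> r \<notin> {norm y / 2<..norm y}" using ny by auto
      ultimately show "F r y = H y * (indicator {norm y / 2<..norm y} r * (1 / r ^ (?n + 1)))"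
        by (cases "r > 0") (simp_all add: F_def indicator_def)
    qed
    also have "\<dots> = H y * (C / norm y ^ ?n)"
      by (simp only: integral_mult_right_zero integral_inverse_power[OF ny DIM_positive] C_def)
    finally show ?thesis by simp
  qed
  have "integrable lborel (\<lambda>y. \<integral>r. F r y \<partial>lborel)"
    using lborel_pair.integrable_snd[OF iF] by simp
  then have "integrable lborel (\<lambda>y. (1 / C) * (C * (H y / norm y ^ ?n)))"
    unfolding inner by (rule integrable_mult_right)
  then show "integrable lborel (\<lambda>y. H y / norm y ^ ?n)" using C by simp
  have "C * (\<integral>y. H y / norm y ^ ?n \<partial>lborel) = (\<integral>y. (\<integral>r. F r y \<partial>lborel) \<partial>lborel)"
    unfolding inner by (rule integral_mult_right_zero[symmetric])
  also have "\<dots> = (\<integral>r. (\<integral>y. F r y \<partial>lborel) \<partial>lborel)"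
    using lborel_pair.integral_snd[OF iF] lborel_pair.integral_fst[OF iF] by simp
  also have "\<dots> = (\<integral>r. indicator {0<..} r * (1 / r) * (\<integral>x. indicator shell x * H (r *\<^sub>R x) \<partial>lborel) \<partial>lborel)"
    unfolding F_def by (subst sub) auto
  finally show "((2 ^ ?n - 1) / real ?n) * (\<integral>y. H y / norm y ^ ?n \<partial>lborel)
      = (\<integral>r. indicator {0<..} r * (1 / r) * (\<integral>x. indicator shell x * H (r *\<^sub>R x) \<partial>lborel) \<partial>lborel)"
    unfolding C_def .
qed

text \<open>The field \<open>g_j\<close> with its pole moved to the origin. At the pole itself its
  value is 0 by the convention for division.\<close>

definition radial_field :: "'a::euclidean_space \<Rightarrow> 'a" where
  "radial_field x = (1 / norm x ^ DIM('a)) *\<^sub>R x"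

lemma radial_field_borel [measurable]: "radial_field \<in> borel_measurable borel"
  unfolding radial_field_def[abs_def] by measurable

text \<open>The norm of the field is \<open>norm y / norm y ^ n\<close>, so the averaging lemma
  applies to the truncated norm as \<open>H\<close>, with \<open>B = 1\<close>.\<close>

lemma radial_field_locally_integrable:
  fixes S :: "'a::euclidean_space set"
  assumes S: "S \<in> sets borel" "bounded S"
  shows "integrable lborel (\<lambda>x. indicator S x *\<^sub>R radial_field (x - a))"
proof -
  obtain R where R0: "R > 0" "S \<subseteq> ball a R" using bounded_subset_ballD[OF S(2), of a] by auto
  then have R: "R \<ge> 0" "S \<subseteq> cball a R" using ball_subset_cball[of a R] by auto
  have "integrable lborel (\<lambda>y::'a. (indicator (cball 0 R) y * norm y) / norm y ^ DIM('a))"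
    by (rule dilated_shell_average(1)[of _ 1 R]) (use R in \<open>auto simp: indicator_def\<close>)
  also have "(\<lambda>y::'a. (indicator (cball 0 R) y * norm y) / norm y ^ DIM('a)) = (\<lambda>y. norm (indicator (cball 0 R) y *\<^sub>R radial_field y))"
    by (auto simp: radial_field_def fun_eq_iff)
  finally have "integrable lborel (\<lambda>y::'a. indicator (cball 0 R) y *\<^sub>R radial_field y)"
  proof (rule integrable_norm_cancel)
    show "(\<lambda>y::'a. indicator (cball 0 R) y *\<^sub>R radial_field y) \<in> borel_measurable lborel"
      using radial_field_borel by (intro borel_measurable_scaleR borel_measurable_indicator) auto
  qed
  from push_translate(1)[OF this, of "- a"]
  have "integrable lborel (\<lambda>x. indicator (cball 0 R) (x - a) *\<^sub>R radial_field (x - a))" by simp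
  then have "integrable lborel (\<lambda>x. indicator S x *\<^sub>R (indicator (cball 0 R) (x - a) *\<^sub>R radial_field (x - a)))"
    by (rule integrable_mult_indicator[rotated]) (use S in auto)
  also have "(\<lambda>x. indicator S x *\<^sub>R (indicator (cball 0 R) (x - a) *\<^sub>R radial_field (x - a))) = (\<lambda>x. indicator S x *\<^sub>R radial_field (x - a))"
    using R(2) by (auto simp: indicator_def fun_eq_iff dist_norm norm_minus_commute)
  finally show ?thesis .
qed

text \<open>This is the surface area of the unit sphere, since the shell has volume
  \<open>(2 ^ n - 1) / n\<close> times that area. It is expressed by volumes alone; the type
  argument carries the dimension.\<close>

definition radial_flux :: "'a::euclidean_space itself \<Rightarrow> real" where
  "radial_flux _ = measure lborel (shell :: 'a set) / ((2 ^ DIM('a) - 1) / real DIM('a))"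

lemma radial_flux_pos: "radial_flux TYPE('a::euclidean_space) > 0"
proof -
  have "(2::real) ^ DIM('a) > 1" by (rule one_less_power) auto
  then show ?thesis unfolding radial_flux_def using shell_pos[where 'a = 'a] by simp
qed

text \<open>After averaging over dilated shells the singular weight disappears. For each
  \<open>x\<close> in the shell there remains the integral over \<open>r > 0\<close> of the
  derivative of \<open>\<phi> (r *\<^sub>R x)\<close>, which equals \<open>- \<phi> 0\<close>
  because \<open>\<phi>\<close> vanishes far out.\<close>

lemma radial_field_divergence_0:
  fixes \<phi> :: "'a::euclidean_space \<Rightarrow> real"
  assumes \<phi>: "test_fun UNIV \<phi>"
  shows "pairing radial_field \<phi> = - radial_flux TYPE('a) * \<phi> 0"
proof -
  let ?n = "DIM('a)"
  define C where "C = (2 ^ ?n - 1) / real ?n"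
  have "(2::real) ^ ?n > 1" by (rule one_less_power) auto
  then have C: "C > 0" by (simp add: C_def)
  note sm = test_funD(1)[OF \<phi>]
  have [measurable]: "\<phi> \<in> borel_measurable borel" "grad \<phi> \<in> borel_measurable borel"
    using smooth_measurable[OF sm] grad_measurable[OF sm] by auto
  obtain B where B: "B \<ge> 0" "\<And>x. norm (grad \<phi> x) \<le> B" by (rule test_fun_grad_bounded[OF \<phi>], rule that)
  obtain R where R: "R > 0" "closure {x. \<phi> x \<noteq> 0} \<subseteq> ball 0 R"
    using bounded_subset_ballD[OF compact_imp_bounded[OF test_funD(2)[OF \<phi>]], of 0] by auto
  have z: "\<phi> x = 0" "grad \<phi> x = 0" if "norm x \<ge> R" for x
  proof -
    have "x \<notin> closure {x. \<phi> x \<noteq> 0}" using R(2) that by auto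
    then show "\<phi> x = 0" "grad \<phi> x = 0" by (rule test_fun_support, rule test_fun_grad_support)
  qed
  define E :: "real \<Rightarrow> 'a \<Rightarrow> real" where "E r x = indicator {0<..} r * indicator shell x * (x \<bullet> grad \<phi> (r *\<^sub>R x))" for r x
  have Em[measurable]: "(\<lambda>(r, x). E r x) \<in> borel_measurable (lborel \<Otimes>\<^sub>M lborel)"
    unfolding E_def by measurable
  \<comment> \<open>For \<open>x\<close> in the shell \<open>norm (r *\<^sub>R x) \<ge> r\<close>,
    so the integrand vanishes for \<open>r > R\<close>. This bound justifies exchanging the two
    integrals.\<close>
  have Ebd: "\<bar>E r x\<bar> \<le> indicator {0<..R} r * (2 * B * indicator shell x)" for r x
  proof (cases "0 < r \<and> x \<in> shell")
    case True
    then have nx: "1 \<le> norm x" "norm x < 2" by (auto simp: shell_def)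
    show ?thesis
    proof (cases "r \<le> R")
      case r: True
      have "\<bar>x \<bullet> grad \<phi> (r *\<^sub>R x)\<bar> \<le> norm x * norm (grad \<phi> (r *\<^sub>R x))" by (rule Cauchy_Schwarz_ineq2)
      also have "\<dots> \<le> 2 * B" using nx B by (intro mult_mono) auto
      finally show ?thesis using True r by (simp add: E_def)
    next
      case False
      have "r * 1 \<le> r * norm x" using nx True by (intro mult_left_mono) auto
      then have "R \<le> r * norm x" using False by linarith
      then have "norm (r *\<^sub>R x) \<ge> R" using True by simp
      then show ?thesis using z(2) False by (simp add: E_def)
    qed
  qed (use B in \<open>auto simp: E_def\<close>)
  have iE: "integrable (lborel \<Otimes>\<^sub>M lborel) (\<lambda>(r, x). E r x)"
  proof (rule Bochner_Integration.integrable_bound)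
    show "integrable (lborel \<Otimes>\<^sub>M lborel) (\<lambda>(r, x::'a). indicator {0<..R} r * (2 * B * indicator shell x))"
    proof (rule lborel_pair.Fubini_integrable)
      show "integrable lborel (\<lambda>r. \<integral>x. norm (case (r, x::'a) of (r, x) \<Rightarrow> indicator {0<..R} r * (2 * B * indicator shell x)) \<partial>lborel)"
        using B R integrable_real_indicator[of "{0<..R}" lborel] by (simp add: abs_mult)
      show "AE r in lborel. integrable lborel (\<lambda>x. case (r, x::'a) of (r, x) \<Rightarrow> indicator {0<..R} r * (2 * B * indicator shell x))"
        using shell_integrable[where 'a = 'a] by simp
    qed measurable
    show "AE p in lborel \<Otimes>\<^sub>M lborel. norm (case p of (r, x) \<Rightarrow> E r x) \<le> norm (case p of (r, x::'a) \<Rightarrow> indicator {0<..R} r * (2 * B * indicator shell x))"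
      using Ebd by (intro AE_I2) (auto split: prod.split intro: order_trans[OF _ abs_ge_self])
  qed measurable
  have inner: "(\<integral>r. E r x \<partial>lborel) = - \<phi> 0 * indicator shell x" for x
  proof (cases "x \<in> shell")
    case True
    have FTC: "(\<integral>r. indicator {0..R} r *\<^sub>R (x \<bullet> grad \<phi> (r *\<^sub>R x)) \<partial>lborel) = \<phi> (R *\<^sub>R x) - \<phi> (0 *\<^sub>R x)"
    proof (rule integral_FTC_atLeastAtMost)
      fix r
      have "((\<phi> \<circ> (\<lambda>r. r *\<^sub>R x)) has_derivative ((\<lambda>h. grad \<phi> (r *\<^sub>R x) \<bullet> h) \<circ> (\<lambda>s. s *\<^sub>R x))) (at r within {0..R})"
        by (rule diff_chain_within)
           (auto intro!: derivative_eq_intros has_derivative_at_withinI[OF smooth_has_derivative[OF sm]])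
      then show "((\<lambda>r. \<phi> (r *\<^sub>R x)) has_vector_derivative x \<bullet> grad \<phi> (r *\<^sub>R x)) (at r within {0..R})"
        by (simp add: has_vector_derivative_def o_def inner_commute)
    next
      have "continuous_on UNIV (\<lambda>r. grad \<phi> (r *\<^sub>R x))"
        by (rule continuous_on_compose2[OF smooth_grad_continuous[OF sm, of UNIV]]) (auto intro!: continuous_intros)
      then show "continuous_on {0..R} (\<lambda>r. x \<bullet> grad \<phi> (r *\<^sub>R x))"
        by (intro continuous_intros) (auto intro: continuous_on_subset)
    qed (use R in simp)
    have nx: "1 \<le> norm x" using True by (simp add: shell_def)
    have "R * 1 \<le> R * norm x" using nx R by (intro mult_left_mono) auto
    then have "\<phi> (R *\<^sub>R x) = 0" using R by (intro z) simp
    have "(\<integral>r. E r x \<partial>lborel) = (\<integral>r. indicator {0..R} r *\<^sub>R (x \<bullet> grad \<phi> (r *\<^sub>R x)) \<partial>lborel)"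
    proof (rule integral_cong_AE)
      have "AE r in lborel. r \<noteq> (0::real)" by (rule AE_lborel_singleton)
      then show "AE r in lborel. E r x = indicator {0..R} r *\<^sub>R (x \<bullet> grad \<phi> (r *\<^sub>R x))"
      proof eventually_elim
        case (elim r)
        show ?case
        proof (cases "r > R")
          case r: True
          then have "\<bar>E r x\<bar> \<le> 0" using Ebd[of r x] by simp
          then show ?thesis using r by simp
        qed (use elim True in \<open>auto simp: E_def indicator_def\<close>)
      qed
    qed (auto simp: E_def)
    then show ?thesis using FTC \<open>\<phi> (R *\<^sub>R x) = 0\<close> True by simp
  qed (simp add: E_def)
  have K: "radial_field x \<bullet> grad \<phi> x = (x \<bullet> grad \<phi> x) / norm x ^ ?n" for x
    by (simp add: radial_field_def)
  have "C * pairing radial_field \<phi>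
    = (\<integral>r. indicator {0<..} r * (1 / r) * (\<integral>x. indicator shell x * ((r *\<^sub>R x) \<bullet> grad \<phi> (r *\<^sub>R x)) \<partial>lborel) \<partial>lborel)"
    unfolding K C_def
  proof (rule dilated_shell_average(2)[of _ B R])
    show "\<bar>x \<bullet> grad \<phi> x\<bar> \<le> B * norm x" for x
      using Cauchy_Schwarz_ineq2[of x "grad \<phi> x"] mult_left_mono[OF B(2)[of x], of "norm x"] by (simp add: mult.commute)
  qed (use R B z in auto)
  also have "\<dots> = (\<integral>r. (\<integral>x. E r x \<partial>lborel) \<partial>lborel)"
  proof (rule Bochner_Integration.integral_cong[OF refl])
    fix r :: real
    have "(\<integral>x. indicator shell x * ((r *\<^sub>R x) \<bullet> grad \<phi> (r *\<^sub>R x)) \<partial>lborel) = (\<integral>x. r * (indicator shell x * (x \<bullet> grad \<phi> (r *\<^sub>R x))) \<partial>lborel)"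
      by (simp add: mult_ac)
    then show "indicator {0<..} r * (1 / r) * (\<integral>x. indicator shell x * ((r *\<^sub>R x) \<bullet> grad \<phi> (r *\<^sub>R x)) \<partial>lborel) = (\<integral>x. E r x \<partial>lborel)"
      by (cases "r > 0") (simp_all add: E_def)
  qed
  also have "\<dots> = (\<integral>x. (\<integral>r. E r x \<partial>lborel) \<partial>lborel)"
    using lborel_pair.integral_snd[OF iE] lborel_pair.integral_fst[OF iE] by simp
  also have "\<dots> = - \<phi> 0 * measure lborel (shell :: 'a set)" unfolding inner by simp
  finally have "pairing radial_field \<phi> = - \<phi> 0 * measure lborel (shell :: 'a set) / C"
    using C by (simp add: field_simps)
  then show ?thesis by (simp add: radial_flux_def C_def)
qed

lemma radial_field_divergence:
  fixes \<phi> :: "'a::euclidean_space \<Rightarrow> real"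
  assumes \<phi>: "test_fun UNIV \<phi>"
  shows "(\<integral>x. radial_field (x - a) \<bullet> grad \<phi> x \<partial>lborel) = - radial_flux TYPE('a) * \<phi> a"
proof -
  note sm = test_funD(1)[OF \<phi>]
  have [measurable]: "grad \<phi> \<in> borel_measurable borel" using grad_measurable[OF sm] .
  have t: "test_fun UNIV (\<lambda>x. \<phi> (x - (- a)))"
  proof (rule test_funI[OF smooth_translate[OF sm]])
    show "compact ((\<lambda>x. x + (- a)) ` closure {x. \<phi> x \<noteq> 0})"
      using test_funD(2)[OF \<phi>] by (intro compact_continuous_image continuous_intros)
    show "\<phi> (x - - a) = 0" if "x \<notin> (\<lambda>x. x + (- a)) ` closure {x. \<phi> x \<noteq> 0}" for x
    proof (rule test_fun_support[where f = \<phi>], rule notI)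
      assume "x - - a \<in> closure {x. \<phi> x \<noteq> 0}"
      then have "(x - - a) + (- a) \<in> (\<lambda>x. x + (- a)) ` closure {x. \<phi> x \<noteq> 0}" by (rule imageI)
      then show False using that by simp
    qed
  qed simp
  have "(\<integral>x. radial_field (x - a) \<bullet> grad \<phi> x \<partial>lborel) = (\<integral>x. radial_field x \<bullet> grad \<phi> (x - (- a)) \<partial>lborel)"
    using lborel_integral_affine[of 1 "\<lambda>x. radial_field (x - a) \<bullet> grad \<phi> x" a] by (simp add: add.commute)
  also have "\<dots> = (\<integral>x. radial_field x \<bullet> grad (\<lambda>x. \<phi> (x - (- a))) x \<partial>lborel)"
    by (simp only: grad_translate[OF sm])
  also have "\<dots> = - radial_flux TYPE('a) * \<phi> (0 - (- a))" by (rule radial_field_divergence_0[OF t])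
  finally show ?thesis by simp
qed

section \<open>The extension operator\<close>

lemma integrable_lebesgue_borel:
  fixes f :: "'a::euclidean_space \<Rightarrow> 'a"
  assumes f: "integrable lebesgue f"
  obtains g where "integrable lborel g" "AE x in lebesgue. f x = g x"
proof -
  have fm: "f \<in> borel_measurable lebesgue" using f by auto
  have "\<exists>g. g \<in> borel_measurable lborel \<and> (AE x in lborel. f x \<bullet> b = g x)" for b
  proof -
    have "(\<lambda>x. f x \<bullet> b) \<in> borel_measurable (completion lborel)" using fm by measurable
    from completion_ex_borel_measurable_real[OF this] show ?thesis by blast
  qed
  then have "\<forall>b. \<exists>g. g \<in> borel_measurable lborel \<and> (AE x in lborel. f x \<bullet> b = g x)" by (rule allI)
  from choice[OF this] obtain g where g: "\<And>b. g b \<in> borel_measurable lborel" "\<And>b. AE x in lborel. f x \<bullet> b = g b x"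
    by blast
  define G where "G x = (\<Sum>b\<in>Basis. g b x *\<^sub>R b)" for x
  have Gm: "G \<in> borel_measurable lborel" unfolding G_def using g(1) by measurable
  have "AE x in lborel. \<forall>b\<in>Basis. f x \<bullet> b = g b x"
    using g(2) by (intro AE_finite_allI) auto
  then have ae: "AE x in lborel. f x = G x"
  proof eventually_elim
    case (elim x)
    have "f x = (\<Sum>b\<in>Basis. (f x \<bullet> b) *\<^sub>R b)" by (simp add: euclidean_representation)
    also have "\<dots> = G x" unfolding G_def by (rule sum.cong) (use elim in auto)
    finally show ?case .
  qed
  then have aeL: "AE x in lebesgue. f x = G x" by (rule AE_completion)
  have "integrable lebesgue G"
    using f by (rule Bochner_Integration.integrable_cong_AE_imp) (use aeL Gm in \<open>auto intro: measurable_completion\<close>)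
  then have "integrable lborel G" using integrable_completion[OF Gm] by simp
  then show ?thesis using that aeL by blast
qed

text \<open>\<open>L1div\<close> is phrased with Lebesgue measure, whereas images and Fubini are
  carried out over \<open>lborel\<close>. A Borel representative of the field extended by zero
  translates the condition.\<close>

lemma L1div_lborel_iff:
  fixes u u0 :: "'a::euclidean_space \<Rightarrow> 'a"
  assumes u0: "integrable lborel u0" and ae: "AE x in lebesgue. indicator U x *\<^sub>R u x = u0 x"
    and meas: "(\<lambda>x. indicator U x *\<^sub>R u x) \<in> borel_measurable lebesgue"
  shows "u \<in> L1div U \<longleftrightarrow> (\<forall>\<phi>. test_fun U \<phi> \<longrightarrow> pairing u0 \<phi> = 0)"
proof -
  have um: "u0 \<in> borel_measurable lborel" using u0 by auto
  have iL: "integrable lebesgue u0" using u0 integrable_completion[OF um] by simp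
  have "integrable lebesgue (\<lambda>x. indicator U x *\<^sub>R u x)"
    using iL by (rule Bochner_Integration.integrable_cong_AE_imp) (use ae meas in auto)
  then have "set_integrable lebesgue U u" by (simp add: set_integrable_def)
  moreover have "(LINT x:U|lebesgue. u x \<bullet> grad \<phi> x) = pairing u0 \<phi>" if \<phi>: "test_fun U \<phi>" for \<phi>
  proof -
    have gm: "grad \<phi> \<in> borel_measurable lborel" using grad_measurable[OF test_funD(1)[OF \<phi>]] by simp
    then have gL: "grad \<phi> \<in> borel_measurable lebesgue" by (rule measurable_completion)
    have "(LINT x:U|lebesgue. u x \<bullet> grad \<phi> x) = (\<integral>x. (indicator U x *\<^sub>R u x) \<bullet> grad \<phi> x \<partial>lebesgue)"
      by (simp add: set_lebesgue_integral_def)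
    also have "\<dots> = (\<integral>x. u0 x \<bullet> grad \<phi> x \<partial>lebesgue)"
    proof (rule integral_cong_AE)
      show "AE x in lebesgue. (indicator U x *\<^sub>R u x) \<bullet> grad \<phi> x = u0 x \<bullet> grad \<phi> x"
        using ae by eventually_elim simp
      show "(\<lambda>x. (indicator U x *\<^sub>R u x) \<bullet> grad \<phi> x) \<in> borel_measurable lebesgue"
        using meas gL by (rule borel_measurable_inner)
      show "(\<lambda>x. u0 x \<bullet> grad \<phi> x) \<in> borel_measurable lebesgue"
        using measurable_completion[OF um] gL by (rule borel_measurable_inner)
    qed
    also have "\<dots> = pairing u0 \<phi>"
      by (rule integral_completion) (use um gm in measurable)
    finally show ?thesis .
  qed
  ultimately show ?thesis by (auto simp: L1div_def)
qed

section \<open>Fluxes through the bounded components of the complement\<close>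

lemma test_fun_zero_outside:
  assumes "test_fun U \<phi>" "x \<notin> U"
  shows "\<phi> x = 0" "grad \<phi> x = 0"
proof -
  have "x \<notin> closure {x. \<phi> x \<noteq> 0}" using test_funD(3)[OF assms(1)] assms(2) by blast
  then show "\<phi> x = 0" "grad \<phi> x = 0" by (rule test_fun_support, rule test_fun_grad_support)
qed

lemma unbounded_component_unique:
  fixes \<Omega> :: "'a::euclidean_space set"
  assumes "DIM('a) \<ge> 2" "bounded \<Omega>" "C \<in> components (- \<Omega>)" "D \<in> components (- \<Omega>)" "\<not> bounded C" "\<not> bounded D"
  shows "C = D"
  using assms cobounded_unique_unbounded_component[of "- \<Omega>"] by (auto simp: components_def)

text \<open>There are finitely many closed components, so the compact \<open>C\<close> has an open
  neighbourhood disjoint from all others, and the transition takes place inside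
  \<open>\<Omega>\<close>. Pairing \<open>u\<close> with this cutoff is the weak form of the flux of
  \<open>u\<close> through the boundary of \<open>C\<close>.\<close>

lemma component_cutoff:
  fixes \<Omega> :: "'a::euclidean_space set"
  assumes op: "open \<Omega>" and bd: "bounded \<Omega>" and lb: "lipschitz_boundary \<Omega>"
    and C: "C \<in> components (- \<Omega>)" "bounded C"
  obtains \<theta> where "test_fun UNIV \<theta>" "\<And>x. x \<notin> \<Omega> \<Longrightarrow> \<theta> x = indicator C x" "\<And>x. x \<notin> \<Omega> \<Longrightarrow> grad \<theta> x = 0"
proof -
  let ?X = "\<Union>(components (- \<Omega>) - {C})"
  have "closed ?X"
    using finite_components_complement[OF op lb bd] closed_component[OF op] by (intro closed_Union) auto
  moreover have dis: "C \<inter> ?X = {}" using components_nonoverlap[OF C(1)] by blast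
  ultimately obtain \<theta> V where \<theta>: "test_fun (- ?X) \<theta>" "open V" "C \<subseteq> V" "\<And>x. x \<in> V \<Longrightarrow> \<theta> x = 1"
    by (rule_tac smooth_cutoff[of C "- ?X"]) (use closed_component[OF op C(1)] C(2) in \<open>auto simp: compact_eq_bounded_closed\<close>)
  have cov: "x \<in> C \<or> x \<in> ?X" if "x \<notin> \<Omega>" for x
    using Union_components[of "- \<Omega>"] that by blast
  show ?thesis
  proof (rule that)
    show "test_fun UNIV \<theta>" using \<theta>(1) by (rule test_fun_mono) simp
    fix x assume "x \<notin> \<Omega>"
    then consider "x \<in> C" | "x \<in> ?X" using cov by blast
    then have "\<theta> x = indicator C x \<and> grad \<theta> x = 0"
    proof cases
      case 1
      then have "grad \<theta> x = 0" using \<theta> by (intro grad_const_on[of V]) auto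
      then show ?thesis using 1 \<theta> by auto
    next
      case 2
      then have "x \<notin> - ?X" "x \<notin> C" using dis by auto
      then show ?thesis using test_fun_zero_outside[OF \<theta>(1)] by simp
    qed
    then show "\<theta> x = indicator C x" "grad \<theta> x = 0" by auto
  qed
qed

text \<open>The residual density \<open>f\<close> vanishes in mass on bounded components because the
  fluxes do. Its total mass is zero for every \<open>u\<close>, so the mass on the single unbounded
  component vanishes as well, and \<open>f\<close> can be removed by a field off
  \<open>\<Omega>\<close>.\<close>

lemma extension_of_zero_flux:
  fixes u :: "'a::euclidean_space \<Rightarrow> 'a"
  assumes dim: "DIM('a) \<ge> 2" and u: "integrable lborel u" "\<And>x. x \<notin> \<Omega> \<Longrightarrow> u x = 0"
    and div: "\<And>\<phi>. test_fun \<Omega> \<phi> \<Longrightarrow> pairing u \<phi> = 0"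
    and op: "open \<Omega>" and bd: "bounded \<Omega>" and lb: "lipschitz_boundary \<Omega>"
    and flux: "\<And>C. C \<in> components (- \<Omega>) \<Longrightarrow> bounded C \<Longrightarrow> \<exists>\<theta>. test_fun UNIV \<theta> \<and>
      (\<forall>x. x \<notin> \<Omega> \<longrightarrow> \<theta> x = indicator C x \<and> grad \<theta> x = 0) \<and> pairing u \<theta> = 0"
  obtains v where "integrable lborel v" "\<And>x. x \<in> \<Omega> \<Longrightarrow> v x = u x"
    "\<And>\<phi>. test_fun UNIV \<phi> \<Longrightarrow> pairing v \<phi> = 0"
proof -
  obtain w f R where w: "integrable lborel w" "integrable lborel f"
    "\<And>x. x \<in> \<Omega> \<Longrightarrow> w x = 0" "\<And>x. x \<in> \<Omega> \<Longrightarrow> f x = 0"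
    "\<And>x. x \<notin> cball 0 R \<Longrightarrow> w x = 0" "\<And>x. x \<notin> cball 0 R \<Longrightarrow> f x = 0"
    "\<And>\<phi>. test_fun UNIV \<phi> \<Longrightarrow> pairing u \<phi>
        = pairing w \<phi> + moment f \<phi>"
  proof (rule global_extension[OF u(1) _ _ op bd lb])
    show "u x = 0" if "x \<notin> \<Omega>" for x using u(2) that .
    show "pairing u \<phi> = 0" if "test_fun \<Omega> \<phi>" for \<phi> using div that .
  qed (rule that)
  let ?Co = "components (- \<Omega>)"
  have fin: "finite ?Co" by (rule finite_components_complement[OF op lb bd])
  have iC: "integrable lborel (\<lambda>x. indicator C x * f x)" if "C \<in> ?Co" for C
    using integrable_mult_indicator[OF _ w(2), of C] closed_component[OF op that] by simp
  have bC: "moment (indicator C) f = 0" if C: "C \<in> ?Co" "bounded C" for C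
  proof -
    \<comment> \<open>\<open>w\<close> vanishes on \<open>\<Omega>\<close> and
      \<open>grad \<theta>\<close> off \<open>\<Omega>\<close>, so the field term drops out; the
      density term is the mass of \<open>f\<close> on \<open>C\<close>.\<close>
    obtain \<theta> where \<theta>: "test_fun UNIV \<theta>" "\<And>x. x \<notin> \<Omega> \<Longrightarrow> \<theta> x = indicator C x" "\<And>x. x \<notin> \<Omega> \<Longrightarrow> grad \<theta> x = 0"
      "pairing u \<theta> = 0"
      using flux[OF C] by blast
    have "0 = pairing w \<theta> + moment f \<theta>"
      using \<theta>(4) w(7)[OF \<theta>(1)] by simp
    also have "(\<lambda>x. w x \<bullet> grad \<theta> x) = (\<lambda>x. 0)"
    proof
      fix x show "w x \<bullet> grad \<theta> x = 0" using w(3) \<theta>(3) by (cases "x \<in> \<Omega>") auto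
    qed
    also have "(\<lambda>x. f x * \<theta> x) = (\<lambda>x. indicator C x * f x)"
    proof
      fix x show "f x * \<theta> x = indicator C x * f x" using w(4) \<theta>(2) by (cases "x \<in> \<Omega>") auto
    qed
    finally show ?thesis by simp
  qed
  have f0: "(\<integral>x. f x \<partial>lborel) = 0"
  proof -
    \<comment> \<open>A test function equal to 1 near \<open>\<Omega>\<close> and the supports of
      \<open>w\<close> and \<open>f\<close>: all gradient terms vanish and only the total mass of
      \<open>f\<close> remains.\<close>
    obtain R' where R': "R' > 0" "\<Omega> \<union> cball 0 R \<subseteq> ball 0 R'"
      using bounded_subset_ballD[of "\<Omega> \<union> cball 0 R" 0] bd by auto
    obtain \<theta> and V :: "'a set" where \<theta>: "test_fun UNIV \<theta>" "open V" "cball 0 R' \<subseteq> V" "\<And>x. x \<in> V \<Longrightarrow> \<theta> x = (1::real)"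
      by (rule smooth_cutoff[OF compact_cball open_UNIV subset_UNIV], rule that)
    have V: "x \<in> V" if "x \<in> \<Omega> \<or> x \<in> cball 0 R" for x
      using R'(2) \<theta>(3) that ball_subset_cball[of 0 R'] by blast
    have g: "grad \<theta> x = 0" if "x \<in> V" for x by (rule grad_const_on[OF \<theta>(2) that \<theta>(4)])
    have "(\<lambda>x. u x \<bullet> grad \<theta> x) = (\<lambda>x. 0)"
    proof
      fix x show "u x \<bullet> grad \<theta> x = 0" using u(2)[of x] g[OF V, of x] by (cases "x \<in> \<Omega>") auto
    qed
    moreover have "(\<lambda>x. w x \<bullet> grad \<theta> x) = (\<lambda>x. 0)"
    proof
      fix x show "w x \<bullet> grad \<theta> x = 0" using w(5)[of x] g[OF V, of x] by (cases "x \<in> cball 0 R") auto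
    qed
    moreover have "(\<lambda>x. f x * \<theta> x) = f"
    proof
      fix x show "f x * \<theta> x = f x" using w(6)[of x] \<theta>(4)[OF V, of x] by (cases "x \<in> cball 0 R") auto
    qed
    ultimately show ?thesis using w(7)[OF \<theta>(1)] by simp
  qed
  have aC: "moment (indicator C) f = 0" if C: "C \<in> ?Co" for C
  proof (cases "bounded C")
    case True
    then show ?thesis by (rule bC[OF C])
  next
    case False
    \<comment> \<open>Total mass zero is distributed over the components. The bounded ones
      contribute zero, and any other unbounded component would coincide with
      \<open>C\<close>.\<close>
    have split: "f x = (\<Sum>D\<in>?Co. indicator D x * f x)" for x
    proof (cases "x \<in> \<Omega>")
      case False
      then obtain D where D: "D \<in> ?Co" "x \<in> D" using Union_components[of "- \<Omega>"] by blast
      have "(\<Sum>E\<in>?Co. indicator E x * f x) = (\<Sum>E\<in>?Co. if E = D then f x else 0)"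
        by (rule sum.cong) (use D components_nonoverlap[of _ "- \<Omega>" D] in \<open>auto simp: indicator_def\<close>)
      then show ?thesis using D fin by simp
    qed (simp add: w)
    have "0 = (\<integral>x. (\<Sum>D\<in>?Co. indicator D x * f x) \<partial>lborel)" using f0 by (simp only: split[symmetric])
    also have "\<dots> = (\<Sum>D\<in>?Co. \<integral>x. indicator D x * f x \<partial>lborel)"
      using iC by (rule Bochner_Integration.integral_sum)
    also have "\<dots> = (\<Sum>D\<in>?Co. if D = C then \<integral>x. indicator C x * f x \<partial>lborel else 0)"
    proof (rule sum.cong[OF refl])
      fix D assume D: "D \<in> ?Co"
      show "moment (indicator D) f = (if D = C then \<integral>x. indicator C x * f x \<partial>lborel else 0)"
      proof (cases "bounded D")
        case True
        then show ?thesis using bC[OF D] False by auto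
      qed (use unbounded_component_unique[OF dim bd D C _ False] in simp)
    qed
    also have "\<dots> = moment (indicator C) f" using fin C by simp
    finally show ?thesis by simp
  qed
  have "is_div \<Omega> f"
    by (rule is_div_balanced[OF op lb bd w(2,4,6) aC])
  then obtain w' where w': "integrable lborel w'" "\<And>x. x \<in> \<Omega> \<Longrightarrow> w' x = 0"
     "\<And>\<phi>. test_fun UNIV \<phi> \<Longrightarrow> moment f \<phi> = pairing w' \<phi>"
    unfolding is_div_def by auto
  \<comment> \<open>Both corrections live off \<open>\<Omega>\<close>: \<open>w\<close> accounts for
    the pairing of \<open>u\<close> across the boundary, and \<open>w'\<close> for the density left
    over by it.\<close>
  show ?thesis
  proof (rule that[of "\<lambda>x. u x - w x - w' x"])
    show "integrable lborel (\<lambda>x. u x - w x - w' x)" using u w w' by auto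
    show "u x - w x - w' x = u x" if "x \<in> \<Omega>" for x using w(3) w'(2) that by simp
    fix \<phi> :: "'a \<Rightarrow> real" assume \<phi>: "test_fun UNIV \<phi>"
    have "(\<integral>x. (u x - w x - w' x) \<bullet> grad \<phi> x \<partial>lborel)
      = pairing u \<phi> - pairing w \<phi> - pairing w' \<phi>"
      unfolding inner_diff_left
      by (simp add: integrable_test(1)[OF \<phi>] u(1) w(1) w'(1))
    then show "(\<integral>x. (u x - w x - w' x) \<bullet> grad \<phi> x \<partial>lborel) = 0"
      using w(7)[OF \<phi>] w'(3)[OF \<phi>] by simp
  qed
qed

lemma exists_extension:
  fixes \<Omega> :: "'a::euclidean_space set" and y :: "'a set \<Rightarrow> 'a"
  assumes dim: "DIM('a) \<ge> 2" and bd: "bounded \<Omega>" and op: "open \<Omega>" and lb: "lipschitz_boundary \<Omega>"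
    and y: "\<And>C. C \<in> components (- \<Omega>) \<Longrightarrow> bounded C \<Longrightarrow> y C \<in> C"
    and u: "u \<in> L1div \<Omega>"
  obtains v lam where "v \<in> L1div UNIV"
    "AE x\<in>\<Omega> in lebesgue. v x = u x + (\<Sum>C\<in>{C\<in>components (- \<Omega>). bounded C}. lam C *\<^sub>R radial_field (x - y C))"
proof -
  let ?B = "{C\<in>components (- \<Omega>). bounded C}"
  let ?c = "radial_flux TYPE('a)"
  have fin: "finite ?B" using finite_components_complement[OF op lb bd] by simp
  have yC: "y C \<in> C" "y C \<notin> \<Omega>" if "C \<in> ?B" for C
    using y[of C] that in_components_subset[of C "- \<Omega>"] by auto
  have iu: "integrable lebesgue (\<lambda>x. indicator \<Omega> x *\<^sub>R u x)"
    using u by (simp add: L1div_def set_integrable_def)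
  obtain u' where u': "integrable lborel u'" "AE x in lebesgue. indicator \<Omega> x *\<^sub>R u x = u' x"
    by (rule integrable_lebesgue_borel[OF iu], rule that)
  define u0 where "u0 x = indicator \<Omega> x *\<^sub>R u' x" for x
  have iu0: "integrable lborel u0" unfolding u0_def by (rule integrable_mult_indicator) (use op u' in auto)
  have ae0: "AE x in lebesgue. indicator \<Omega> x *\<^sub>R u x = u0 x"
    using u'(2) by eventually_elim (auto simp: u0_def indicator_def)
  have div0: "pairing u0 \<phi> = 0" if "test_fun \<Omega> \<phi>" for \<phi>
    using L1div_lborel_iff[OF iu0 ae0] iu u that by auto
  have "\<forall>C\<in>?B. \<exists>\<theta>. test_fun UNIV \<theta> \<and> (\<forall>x. x \<notin> \<Omega> \<longrightarrow> \<theta> x = indicator C x \<and> grad \<theta> x = 0)"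
  proof
    fix C assume "C \<in> ?B"
    then have C: "C \<in> components (- \<Omega>)" "bounded C" by auto
    obtain \<theta> where "test_fun UNIV \<theta>" "\<And>x. x \<notin> \<Omega> \<Longrightarrow> \<theta> x = indicator C x" "\<And>x. x \<notin> \<Omega> \<Longrightarrow> grad \<theta> x = 0"
      by (rule component_cutoff[OF op bd lb C], rule that)
    then show "\<exists>\<theta>. test_fun UNIV \<theta> \<and> (\<forall>x. x \<notin> \<Omega> \<longrightarrow> \<theta> x = indicator C x \<and> grad \<theta> x = 0)" by blast
  qed
  from bchoice[OF this] obtain \<Theta> where \<Theta>: "\<forall>C\<in>?B. test_fun UNIV (\<Theta> C) \<and> (\<forall>x. x \<notin> \<Omega> \<longrightarrow> \<Theta> C x = indicator C x \<and> grad (\<Theta> C) x = 0)"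
    by (rule exE)
  \<comment> \<open>The field attached to \<open>C\<close> pairs with \<open>\<Theta> C\<close> to
    \<open>- ?c\<close> and with the cutoffs of the other bounded components to 0, since
    \<open>\<Theta> C\<close> equals the indicator of \<open>C\<close> at each pole. The system for
    the coefficients is therefore diagonal.\<close>
  define lam where "lam C = pairing u0 (\<Theta> C) / ?c" for C
  \<comment> \<open>Restricting to \<open>\<Omega>\<close> removes the pole from view and gives an
    integrable field. For test functions whose gradient vanishes off \<open>\<Omega>\<close>, the
    restriction does not alter the pairing.\<close>
  define k where "k C x = indicator \<Omega> x *\<^sub>R radial_field (x - y C)" for C x
  have ik: "integrable lborel (k C)" for C
    unfolding k_def using op bd by (intro radial_field_locally_integrable) auto
  define u1 where "u1 x = u0 x + (\<Sum>C\<in>?B. lam C *\<^sub>R k C x)" for x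
  have iu1: "integrable lborel u1" unfolding u1_def using iu0 ik by auto
  have pair: "pairing u1 \<phi> = pairing u0 \<phi> - (\<Sum>C\<in>?B. lam C * (?c * \<phi> (y C)))"
    if \<phi>: "test_fun UNIV \<phi>" and g0: "\<And>x. x \<notin> \<Omega> \<Longrightarrow> grad \<phi> x = 0" for \<phi>
  proof -
    have kk: "pairing (k C) \<phi> = - ?c * \<phi> (y C)" for C
    proof -
      have "(\<lambda>x. k C x \<bullet> grad \<phi> x) = (\<lambda>x. radial_field (x - y C) \<bullet> grad \<phi> x)"
      proof
        fix x show "k C x \<bullet> grad \<phi> x = radial_field (x - y C) \<bullet> grad \<phi> x"
          using g0[of x] by (cases "x \<in> \<Omega>") (auto simp: k_def)
      qed
      then show ?thesis using radial_field_divergence[OF \<phi>, of "y C"] by simp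
    qed
    have i: "integrable lborel (\<lambda>x. lam C * (k C x \<bullet> grad \<phi> x))" for C
      by (intro integrable_mult_right integrable_test(1)[OF \<phi>] ik)
    have "pairing u1 \<phi> = (\<integral>x. u0 x \<bullet> grad \<phi> x + (\<Sum>C\<in>?B. lam C * (k C x \<bullet> grad \<phi> x)) \<partial>lborel)"
      by (simp add: u1_def inner_add_left inner_sum_left)
    also have "\<dots> = pairing u0 \<phi> + (\<integral>x. (\<Sum>C\<in>?B. lam C * (k C x \<bullet> grad \<phi> x)) \<partial>lborel)"
      by (intro Bochner_Integration.integral_add integrable_test(1)[OF \<phi>] iu0 Bochner_Integration.integrable_sum i)
    also have "(\<integral>x. (\<Sum>C\<in>?B. lam C * (k C x \<bullet> grad \<phi> x)) \<partial>lborel) = (\<Sum>C\<in>?B. \<integral>x. lam C * (k C x \<bullet> grad \<phi> x) \<partial>lborel)"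
      by (rule Bochner_Integration.integral_sum[OF i])
    also have "\<dots> = (\<Sum>C\<in>?B. - (lam C * (?c * \<phi> (y C))))"
      by (rule sum.cong) (simp_all add: kk)
    finally show ?thesis by (simp add: sum_negf)
  qed
  have u1z: "u1 x = 0" if "x \<notin> \<Omega>" for x using that by (simp add: u1_def u0_def k_def)
  \<comment> \<open>The poles lie outside \<open>\<Omega>\<close>, where test functions on
    \<open>\<Omega>\<close> vanish, so adding the radial fields keeps the divergence in
    \<open>\<Omega>\<close> zero.\<close>
  have div1: "pairing u1 \<phi> = 0" if \<phi>: "test_fun \<Omega> \<phi>" for \<phi>
  proof -
    have "\<phi> (y C) = 0" if "C \<in> ?B" for C using test_fun_zero_outside(1)[OF \<phi>] yC(2)[OF that] by blast
    then show ?thesis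
      using pair[OF test_fun_mono[OF \<phi> subset_UNIV] test_fun_zero_outside(2)[OF \<phi>]] div0[OF \<phi>] by simp
  qed
  have flux: "\<exists>\<theta>. test_fun UNIV \<theta> \<and> (\<forall>x. x \<notin> \<Omega> \<longrightarrow> \<theta> x = indicator C x \<and> grad \<theta> x = 0) \<and> pairing u1 \<theta> = 0"
    if C: "C \<in> components (- \<Omega>)" "bounded C" for C
  proof -
    have CB: "C \<in> ?B" using C by simp
    have \<Theta>C: "test_fun UNIV (\<Theta> C)" "\<And>x. x \<notin> \<Omega> \<Longrightarrow> \<Theta> C x = indicator C x" "\<And>x. x \<notin> \<Omega> \<Longrightarrow> grad (\<Theta> C) x = 0"
      using \<Theta> CB by auto
    have "(\<Sum>D\<in>?B. lam D * (?c * \<Theta> C (y D))) = (\<Sum>D\<in>?B. if D = C then lam C * ?c else 0)"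
    proof (rule sum.cong[OF refl])
      fix D assume D: "D \<in> ?B"
      have "\<Theta> C (y D) = indicator C (y D)" by (rule \<Theta>C(2)[OF yC(2)[OF D]])
      moreover have "y D \<in> C \<longleftrightarrow> D = C"
        using yC(1)[OF D] D C(1) components_nonoverlap[of D "- \<Omega>" C] by blast
      ultimately show "lam D * (?c * \<Theta> C (y D)) = (if D = C then lam C * ?c else 0)"
        by (auto simp: indicator_def)
    qed
    also have "\<dots> = lam C * ?c" using fin CB by simp
    also have "\<dots> = pairing u0 (\<Theta> C)" using radial_flux_pos[where 'a = 'a] by (simp add: lam_def)
    finally have "pairing u1 (\<Theta> C) = 0" using pair[OF \<Theta>C(1,3)] by simp
    then show ?thesis using \<Theta>C by (intro exI[of _ "\<Theta> C"]) simp
  qed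
  obtain v where v: "integrable lborel v" "\<And>x. x \<in> \<Omega> \<Longrightarrow> v x = u1 x"
    "\<And>\<phi>. test_fun UNIV \<phi> \<Longrightarrow> pairing v \<phi> = 0"
  proof (rule extension_of_zero_flux[OF dim iu1 _ _ op bd lb])
    show "u1 x = 0" if "x \<notin> \<Omega>" for x using u1z that .
    show "pairing u1 \<phi> = 0" if "test_fun \<Omega> \<phi>" for \<phi> using div1 that .
    show "\<exists>\<theta>. test_fun UNIV \<theta> \<and> (\<forall>x. x \<notin> \<Omega> \<longrightarrow> \<theta> x = indicator C x \<and> grad \<theta> x = 0) \<and> pairing u1 \<theta> = 0"
      if "C \<in> components (- \<Omega>)" "bounded C" for C using flux that .
  qed (rule that)
  have vm: "v \<in> borel_measurable lborel" using v(1) by auto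
  have "v \<in> L1div UNIV"
    using v(3) L1div_lborel_iff[OF v(1), of UNIV v] measurable_completion[OF vm] by simp
  moreover have "AE x\<in>\<Omega> in lebesgue. v x = u x + (\<Sum>C\<in>?B. lam C *\<^sub>R radial_field (x - y C))"
    using ae0
  proof eventually_elim
    case (elim x)
    then show ?case by (auto simp: v(2) u1_def k_def)
  qed
  ultimately show ?thesis by (rule that)
qed

section \<open>Linear selection and the operator\<close>

lemma L1div_lin:
  assumes "u \<in> L1div U" "v \<in> L1div U"
  shows "(\<lambda>x. a *\<^sub>R u x + b *\<^sub>R v x) \<in> L1div U"
proof -
  have i: "integrable lebesgue (\<lambda>x. indicator U x *\<^sub>R u x)" "integrable lebesgue (\<lambda>x. indicator U x *\<^sub>R v x)"
    using assms by (simp_all add: L1div_def set_integrable_def)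
  have "set_integrable lebesgue U (\<lambda>x. a *\<^sub>R u x + b *\<^sub>R v x)"
    using assms unfolding L1div_def by (intro set_integral_add set_integrable_scaleR_right) auto
  moreover have "(LINT x:U|lebesgue. (a *\<^sub>R u x + b *\<^sub>R v x) \<bullet> grad \<phi> x) = 0" if \<phi>: "test_fun U \<phi>" for \<phi>
  proof -
    have gL: "grad \<phi> \<in> borel_measurable lebesgue"
      using grad_measurable[OF test_funD(1)[OF \<phi>]] by (intro measurable_completion) simp
    obtain B where B: "\<And>x. norm (grad \<phi> x) \<le> B" by (rule test_fun_grad_bounded[OF \<phi>], rule that)
    have s: "set_integrable lebesgue U (\<lambda>x. u x \<bullet> grad \<phi> x)" "set_integrable lebesgue U (\<lambda>x. v x \<bullet> grad \<phi> x)"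
      unfolding set_integrable_def
      using integrable_inner_bounded_borel[OF i(1) gL B] integrable_inner_bounded_borel[OF i(2) gL B] by simp_all
    have "(LINT x:U|lebesgue. (a *\<^sub>R u x + b *\<^sub>R v x) \<bullet> grad \<phi> x)
      = (LINT x:U|lebesgue. a * (u x \<bullet> grad \<phi> x) + b * (v x \<bullet> grad \<phi> x))"
      by (simp add: inner_add_left)
    also have "\<dots> = (LINT x:U|lebesgue. a * (u x \<bullet> grad \<phi> x)) + (LINT x:U|lebesgue. b * (v x \<bullet> grad \<phi> x))"
      by (intro set_integral_add set_integrable_mult_right s)
    also have "\<dots> = a * (LINT x:U|lebesgue. u x \<bullet> grad \<phi> x) + b * (LINT x:U|lebesgue. v x \<bullet> grad \<phi> x)"
      by simp
    also have "\<dots> = 0" using assms \<phi> by (simp add: L1div_def)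
    finally show ?thesis .
  qed
  ultimately show ?thesis by (simp add: L1div_def)
qed

lemma L1div_zero: "(\<lambda>x. 0) \<in> L1div U"
  by (simp add: L1div_def set_integrable_def set_lebesgue_integral_def)

text \<open>The pointwise real vector space of all functions; it provides the Hamel bases and the
  linear extension from a basis.\<close>

interpretation fun_space: vector_space "\<lambda>(c::real) (f::'a \<Rightarrow> 'b::real_vector) x. c *\<^sub>R f x"
  by unfold_locales (auto simp: fun_eq_iff scaleR_add_right scaleR_add_left)

interpretation fun_space_pair: vector_space_pair
    "\<lambda>(c::real) (f::'a \<Rightarrow> 'b::real_vector) x. c *\<^sub>R f x" "\<lambda>(c::real) (f::'a \<Rightarrow> 'b::real_vector) x. c *\<^sub>R f x"
  by unfold_locales

text \<open>\<open>Rel\<close> is a linear relation that is total on \<open>L\<close>, so choosing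
  values on a basis of \<open>L\<close> and extending linearly stays inside it. The basis of
  \<open>L\<close> extends a basis of the span of \<open>N\<close>, whose members are sent to
  zero.\<close>

lemma linear_selection:
  fixes L N :: "('a \<Rightarrow> 'b::real_vector) set" and Rel :: "('a \<Rightarrow> 'b) \<Rightarrow> ('a \<Rightarrow> 'b) \<Rightarrow> bool"
  assumes L: "(\<lambda>x. 0) \<in> L" "\<And>u v a b. u \<in> L \<Longrightarrow> v \<in> L \<Longrightarrow> (\<lambda>x. a *\<^sub>R u x + b *\<^sub>R v x) \<in> L"
    and N: "N \<subseteq> L" "\<And>u. u \<in> N \<Longrightarrow> Rel u (\<lambda>x. 0)"
    and tot: "\<And>u. u \<in> L \<Longrightarrow> \<exists>v. Rel u v" and Rel0: "Rel (\<lambda>x. 0) (\<lambda>x. 0)"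
    and Rel: "\<And>u u' v v' a b. Rel u v \<Longrightarrow> Rel u' v' \<Longrightarrow> Rel (\<lambda>x. a *\<^sub>R u x + b *\<^sub>R u' x) (\<lambda>x. a *\<^sub>R v x + b *\<^sub>R v' x)"
  obtains E where "\<And>u. u \<in> L \<Longrightarrow> Rel u (E u)" "\<And>u. u \<in> N \<Longrightarrow> E u = (\<lambda>x. 0)"
    "\<And>u v a b. E (\<lambda>x. a *\<^sub>R u x + b *\<^sub>R v x) = (\<lambda>x. a *\<^sub>R E u x + b *\<^sub>R E v x)"
proof -
  have z: "(0 :: 'a \<Rightarrow> 'b) = (\<lambda>x. 0)" by (simp add: fun_eq_iff)
  obtain B0 where B0: "B0 \<subseteq> N" "fun_space.independent B0" "N \<subseteq> fun_space.span B0"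
    by (rule fun_space.maximal_independent_subset)
  obtain B where B: "B0 \<subseteq> B" "B \<subseteq> L" "fun_space.independent B" "L \<subseteq> fun_space.span B"
    by (rule fun_space.maximal_independent_subset_extend[OF subset_trans[OF B0(1) N(1)] B0(2)])
  \<comment> \<open>On the basis part taken from \<open>N\<close> the value zero is forced, and it
    is an admissible value there; elsewhere any related function will do.\<close>
  define e where "e u = (if u \<in> B0 then (\<lambda>x. 0) else (SOME v. Rel u v))" for u
  have e: "Rel u (e u)" if "u \<in> B" for u
  proof (cases "u \<in> B0")
    case True
    then show ?thesis using N(2) B0(1) by (auto simp: e_def)
  next
    case False
    then show ?thesis using someI_ex[OF tot[of u]] that B(2) by (auto simp: e_def)
  qed
  obtain E where E: "Vector_Spaces.linear (\<lambda>c f x. c *\<^sub>R f x) (\<lambda>c f x. c *\<^sub>R f x) E" "\<forall>u\<in>B. E u = e u"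
    using fun_space_pair.linear_independent_extend[OF B(3), of e] by blast
  interpret E: Vector_Spaces.linear "\<lambda>(c::real) (f::'a \<Rightarrow> 'b) x. c *\<^sub>R f x" "\<lambda>(c::real) (f::'a \<Rightarrow> 'b) x. c *\<^sub>R f x" E
    by (rule E(1))
  have lin: "E (\<lambda>x. a *\<^sub>R u x + b *\<^sub>R v x) = (\<lambda>x. a *\<^sub>R E u x + b *\<^sub>R E v x)" for u v a b
  proof -
    have "E (\<lambda>x. a *\<^sub>R u x + b *\<^sub>R v x) = E ((\<lambda>x. a *\<^sub>R u x) + (\<lambda>x. b *\<^sub>R v x))"
      by (simp only: plus_fun_def)
    also have "\<dots> = (\<lambda>x. a *\<^sub>R E u x) + (\<lambda>x. b *\<^sub>R E v x)"
      by (simp only: E.add E.scale)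
    finally show ?thesis by (simp only: plus_fun_def)
  qed
  have "fun_space.subspace {u. Rel u (E u)}"
  proof (rule fun_space.subspaceI)
    show "0 \<in> {u. Rel u (E u)}" using Rel0 by (simp add: E.zero) (simp add: z)
    show "u + v \<in> {u. Rel u (E u)}" if "u \<in> {u. Rel u (E u)}" "v \<in> {u. Rel u (E u)}" for u v
    proof -
      have "u + v = (\<lambda>x. 1 *\<^sub>R u x + 1 *\<^sub>R v x)" by (simp add: fun_eq_iff)
      then show ?thesis using Rel[of u "E u" v "E v" 1 1] that by (simp only: lin mem_Collect_eq)
    qed
    show "(\<lambda>x. c *\<^sub>R u x) \<in> {u. Rel u (E u)}" if "u \<in> {u. Rel u (E u)}" for c u
    proof -
      have "(\<lambda>x. c *\<^sub>R u x) = (\<lambda>x. c *\<^sub>R u x + 0 *\<^sub>R u x)" by (simp add: fun_eq_iff)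
      then show ?thesis using Rel[of u "E u" u "E u" c 0] that by (simp only: lin mem_Collect_eq)
    qed
  qed
  then have "fun_space.span B \<subseteq> {u. Rel u (E u)}"
    by (rule fun_space.span_minimal[rotated]) (use E(2) e in auto)
  then have R: "Rel u (E u)" if "u \<in> L" for u using B(4) that by blast
  have "fun_space.subspace {u. E u = 0}"
  proof (rule fun_space.subspaceI)
    show "(\<lambda>x. c *\<^sub>R u x) \<in> {u. E u = 0}" if "u \<in> {u. E u = 0}" for c u
    proof -
      have "E (\<lambda>x. c *\<^sub>R u x) = (\<lambda>x. c *\<^sub>R E u x)" by (rule E.scale)
      also have "\<dots> = 0" using that by (simp add: fun_eq_iff)
      finally show ?thesis by simp
    qed
  qed (simp_all add: E.zero E.add)
  then have "fun_space.span B0 \<subseteq> {u. E u = 0}"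
    by (rule fun_space.span_minimal[rotated]) (use E(2) B(1) in \<open>auto simp: e_def z\<close>)
  then have "E u = (\<lambda>x. 0)" if "u \<in> N" for u using B0(3) that by (auto simp: z)
  then show ?thesis using that R lin by blast
qed

text \<open>The index \<open>j\<close> becomes the bounded component \<open>C\<close> itself, so
  poles and coefficients are functions of components. The sum has its intended meaning because the
  complement has finitely many components. The operator acts on representatives, hence its
  compatibility with equality almost everywhere is stated as a separate clause.\<close>

theorem theorem6p12:
  fixes \<Omega> :: "'a::euclidean_space set" and y :: "'a set \<Rightarrow> 'a"
  assumes "DIM('a) \<ge> 2"
    and "bounded \<Omega>" and "lipschitz_domain \<Omega>"
    and "\<forall>C\<in>components (- \<Omega>). bounded C \<longrightarrow> y C \<in> C"
  defines "g \<equiv> (\<lambda>C x. (1 / norm (x - y C) ^ DIM('a)) *\<^sub>R (x - y C))"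
  shows "\<exists>E :: ('a \<Rightarrow> 'a) \<Rightarrow> ('a \<Rightarrow> 'a).
     (\<forall>u\<in>L1div \<Omega>. E u \<in> L1div UNIV)
   \<and> (\<forall>u\<in>L1div \<Omega>. \<forall>v\<in>L1div \<Omega>. (AE x\<in>\<Omega> in lebesgue. u x = v x) \<longrightarrow>
        (AE x in lebesgue. E u x = E v x))
   \<and> (\<forall>u\<in>L1div \<Omega>. \<forall>v\<in>L1div \<Omega>. \<forall>a b :: real.
        AE x in lebesgue. E (\<lambda>z. a *\<^sub>R u z + b *\<^sub>R v z) x = a *\<^sub>R E u x + b *\<^sub>R E v x)
   \<and> (\<forall>u\<in>L1div \<Omega>. \<exists>lam :: 'a set \<Rightarrow> real.
        AE x\<in>\<Omega> in lebesgue.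
          E u x = u x + (\<Sum>C\<in>{C\<in>components (- \<Omega>). bounded C}. lam C *\<^sub>R g C x))"
proof -
  have op: "open \<Omega>" and lb: "lipschitz_boundary \<Omega>" using assms(3) by (auto simp: lipschitz_domain_def)
  have y: "y C \<in> C" if "C \<in> components (- \<Omega>)" "bounded C" for C using assms(4) that by blast
  let ?B = "{C\<in>components (- \<Omega>). bounded C}"
  have g: "g C x = radial_field (x - y C)" for C x by (simp add: g_def radial_field_def)
  \<comment> \<open>The coefficients are hidden under an existential quantifier. Linear combinations
    of related pairs are related, with the coefficients combined accordingly, so no linear choice of
    them has to be made.\<close>
  define Rel where "Rel u v \<longleftrightarrow> v \<in> L1div UNIV \<and>
    (\<exists>lam. AE x\<in>\<Omega> in lebesgue. v x = u x + (\<Sum>C\<in>?B. lam C *\<^sub>R g C x))" for u v :: "'a \<Rightarrow> 'a"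
  \<comment> \<open>The representatives of the zero class. Zero is an admissible extension for them,
    with all coefficients equal to 0.\<close>
  define N where "N = {u \<in> L1div \<Omega>. AE x\<in>\<Omega> in lebesgue. u x = 0}"
  obtain E where E: "\<And>u. u \<in> L1div \<Omega> \<Longrightarrow> Rel u (E u)" "\<And>u. u \<in> N \<Longrightarrow> E u = (\<lambda>x. 0)"
    "\<And>u v a b. E (\<lambda>x. a *\<^sub>R u x + b *\<^sub>R v x) = (\<lambda>x. a *\<^sub>R E u x + b *\<^sub>R E v x)"
  proof (rule linear_selection[of "L1div \<Omega>" N Rel])
    show "(\<lambda>x. 0) \<in> L1div \<Omega>" by (rule L1div_zero)
    show "(\<lambda>x. a *\<^sub>R u x + b *\<^sub>R v x) \<in> L1div \<Omega>" if "u \<in> L1div \<Omega>" "v \<in> L1div \<Omega>" for u v a b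
      using that by (rule L1div_lin)
    show "N \<subseteq> L1div \<Omega>" by (auto simp: N_def)
    have null: "Rel u (\<lambda>x. 0)" if "AE x\<in>\<Omega> in lebesgue. u x = 0" for u
      unfolding Rel_def
    proof (intro conjI exI[of _ "\<lambda>_. 0"])
      show "AE x\<in>\<Omega> in lebesgue. 0 = u x + (\<Sum>C\<in>?B. 0 *\<^sub>R g C x)"
        using that by eventually_elim simp
    qed (rule L1div_zero)
    show "Rel u (\<lambda>x. 0)" if "u \<in> N" for u using null that by (simp add: N_def)
    show "Rel (\<lambda>x. 0) (\<lambda>x. 0)" by (rule null) simp
    show "\<exists>v. Rel u v" if u: "u \<in> L1div \<Omega>" for u
    proof -
      obtain v lam where "v \<in> L1div UNIV"
        "AE x\<in>\<Omega> in lebesgue. v x = u x + (\<Sum>C\<in>?B. lam C *\<^sub>R radial_field (x - y C))"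
        by (rule exists_extension[OF assms(1,2) op lb y u]) blast+
      then show ?thesis unfolding Rel_def g by blast
    qed
    show "Rel (\<lambda>x. a *\<^sub>R u x + b *\<^sub>R u' x) (\<lambda>x. a *\<^sub>R v x + b *\<^sub>R v' x)"
      if r: "Rel u v" and r': "Rel u' v'" for u u' v v' a b
    proof -
      obtain l where l1: "AE x\<in>\<Omega> in lebesgue. v x = u x + (\<Sum>C\<in>?B. l C *\<^sub>R g C x)"
        using r[unfolded Rel_def, THEN conjunct2] by (rule exE)
      obtain l' where l2: "AE x\<in>\<Omega> in lebesgue. v' x = u' x + (\<Sum>C\<in>?B. l' C *\<^sub>R g C x)"
        using r'[unfolded Rel_def, THEN conjunct2] by (rule exE)
      have "AE x\<in>\<Omega> in lebesgue. a *\<^sub>R v x + b *\<^sub>R v' x = (a *\<^sub>R u x + b *\<^sub>R u' x) + (\<Sum>C\<in>?B. (a * l C + b * l' C) *\<^sub>R g C x)"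
        using l1 l2
      proof eventually_elim
        case (elim x)
        show ?case
        proof
          assume "x \<in> \<Omega>"
          then have "v x = u x + (\<Sum>C\<in>?B. l C *\<^sub>R g C x)" "v' x = u' x + (\<Sum>C\<in>?B. l' C *\<^sub>R g C x)"
            using elim by blast+
          then show "a *\<^sub>R v x + b *\<^sub>R v' x = (a *\<^sub>R u x + b *\<^sub>R u' x) + (\<Sum>C\<in>?B. (a * l C + b * l' C) *\<^sub>R g C x)"
            by (simp only: scaleR_add_right scaleR_add_left sum.distrib scaleR_scaleR[symmetric] scaleR_sum_right[symmetric]) simp
        qed
      qed
      moreover have "(\<lambda>x. a *\<^sub>R v x + b *\<^sub>R v' x) \<in> L1div UNIV"
        using r r' unfolding Rel_def by (intro L1div_lin) auto
      ultimately show ?thesis unfolding Rel_def by (intro conjI exI[of _ "\<lambda>C. a * l C + b * l' C"])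
    qed
  qed (rule that)
  show ?thesis
  proof (intro exI[of _ E] conjI ballI allI impI)
    show "E u \<in> L1div UNIV" if "u \<in> L1div \<Omega>" for u using E(1)[OF that] by (simp add: Rel_def)
    show "AE x in lebesgue. E (\<lambda>z. a *\<^sub>R u z + b *\<^sub>R v z) x = a *\<^sub>R E u x + b *\<^sub>R E v x" for u v a b
      by (simp add: E(3))
    show "\<exists>lam. AE x\<in>\<Omega> in lebesgue. E u x = u x + (\<Sum>C\<in>?B. lam C *\<^sub>R g C x)" if "u \<in> L1div \<Omega>" for u
      using E(1)[OF that] by (simp add: Rel_def)
    fix u v assume uv: "u \<in> L1div \<Omega>" "v \<in> L1div \<Omega>" "AE x\<in>\<Omega> in lebesgue. u x = v x"
    \<comment> \<open>The difference of two representatives of one class lies in \<open>N\<close>,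
      so by linearity \<open>E\<close> gives the same function for both, even pointwise.\<close>
    have "(\<lambda>x. 1 *\<^sub>R u x + (-1) *\<^sub>R v x) \<in> N"
      unfolding N_def
    proof (intro CollectI conjI L1div_lin uv)
      show "AE x\<in>\<Omega> in lebesgue. 1 *\<^sub>R u x + (-1) *\<^sub>R v x = 0" using uv(3) by eventually_elim simp
    qed
    then have "(\<lambda>x. 1 *\<^sub>R E u x + (-1) *\<^sub>R E v x) = (\<lambda>x. 0)" using E(2,3) by metis
    then show "AE x in lebesgue. E u x = E v x" by (simp add: fun_eq_iff)
  qed
qed

end
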